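(* The index set $\{ e: \mathcal{C}_e \text{ has degree of bi-embeddable categoricity } \mathbf{0}'\}$ is $\Sigma^0_4$-complete.
   Context: An equivalence structure $\mathcal{A}=(A,E)$ has universe $A\subseteq\omega$ and an equivalence relation $E$ on $A$; it is computable if its atomic diagram is computable. Two structures are bi-embeddable if each embeds into the other. The degree of bi-embeddable categoricity of a computable structure $\mathcal{A}$ is the least Turing degree $\mathbf{d}$ (if it exists) such that for any two computable structures bi-embeddable with $\mathcal{A}$, $\mathbf{d}$ computes embeddings between them in both directions. $(\mathcal{C}_e)_{e\in\omega}$ is the enumeration of partial computable equivalence structures: for the $e$-th partial computable function $\phi_e:\omega\times\omega\to\{0,1\}$, $\mathcal{C}_e$ has universe $\omega$ and $x E^{\mathcal{C}_e} y$ iff $\phi_e(x,y)=1$. A set is $\Sigma^0_4$-complete if it is $\Sigma^0_4$ and every $\Sigma^0_4$ set is many-one reducible to it via a computable function. *)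

theory Defs
  imports Main "HOL-Library.Nat_Bijection"
begin

datatype recf =
    Zero
  | Succ
  | Proj nat
  | Orc
  | Comp recf "recf list"
  | Prim recf recf
  | Mu recf

inductive eval :: "nat set \<Rightarrow> recf \<Rightarrow> nat list \<Rightarrow> nat \<Rightarrow> bool" for X where
  zero: "eval X Zero xs 0"
| succ: "eval X Succ (x # xs) (Suc x)"
| proj: "i < length xs \<Longrightarrow> eval X (Proj i) xs (xs ! i)"
| orc:  "eval X Orc (x # xs) (if x \<in> X then 1 else 0)"
| comp: "length ys = length gs \<Longrightarrow> (\<forall>i < length gs. eval X (gs ! i) xs (ys ! i))
         \<Longrightarrow> eval X f ys y \<Longrightarrow> eval X (Comp f gs) xs y"
| prim0: "eval X f xs y \<Longrightarrow> eval X (Prim f g) (0 # xs) y"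
| primS: "eval X (Prim f g) (n # xs) r \<Longrightarrow> eval X g (n # r # xs) y
         \<Longrightarrow> eval X (Prim f g) (Suc n # xs) y"
| mu: "eval X f (n # xs) 0 \<Longrightarrow> (\<forall>m < n. \<exists>k. eval X f (m # xs) (Suc k))
         \<Longrightarrow> eval X (Mu f) xs n"

fun encode :: "recf \<Rightarrow> nat" where
  "encode Zero = prod_encode (0, 0)"
| "encode Succ = prod_encode (1, 0)"
| "encode (Proj i) = prod_encode (2, i)"
| "encode Orc = prod_encode (3, 0)"
| "encode (Comp f gs) = prod_encode (4, prod_encode (encode f, list_encode (map encode gs)))"
| "encode (Prim f g) = prod_encode (5, prod_encode (encode f, encode g))"
| "encode (Mu f) = prod_encode (6, encode f)"

text \<open>phi X e xs y: the e-th partial X-computable function on arguments xs has value y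
  (nowhere defined if e codes no term).\<close>
definition phi :: "nat set \<Rightarrow> nat \<Rightarrow> nat list \<Rightarrow> nat \<Rightarrow> bool" where
  "phi X e xs y \<longleftrightarrow> (\<exists>p. encode p = e \<and> eval X p xs y)"

definition computable_fun :: "(nat \<Rightarrow> nat) \<Rightarrow> bool" where
  "computable_fun f \<longleftrightarrow> (\<exists>p. \<forall>x. eval {} p [x] (f x))"

definition computable_set :: "nat set \<Rightarrow> bool" where
  "computable_set S \<longleftrightarrow> (\<exists>p. \<forall>x. eval {} p [x] (if x \<in> S then 1 else 0))"

definition computable_rel :: "(nat \<times> nat) set \<Rightarrow> bool" where
  "computable_rel R \<longleftrightarrow> (\<exists>p. \<forall>x y. eval {} p [x, y] (if (x, y) \<in> R then 1 else 0))"

definition turing_le :: "nat set \<Rightarrow> nat set \<Rightarrow> bool" where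
  "turing_le A B \<longleftrightarrow> (\<exists>p. \<forall>x. eval B p [x] (if x \<in> A then 1 else 0))"

text \<open>The halting set; its Turing degree is 0'.\<close>
definition halting_set :: "nat set" where
  "halting_set = {e. \<exists>y. phi {} e [e] y}"

definition computes_on :: "nat set \<Rightarrow> nat set \<Rightarrow> (nat \<Rightarrow> nat) \<Rightarrow> bool" where
  "computes_on X U f \<longleftrightarrow> (\<exists>p. \<forall>x \<in> U. eval X p [x] (f x))"

definition sigma4 :: "nat set \<Rightarrow> bool" where
  "sigma4 A \<longleftrightarrow> (\<exists>R. computable_set R \<and>
     (\<forall>n. n \<in> A \<longleftrightarrow> (\<exists>a. \<forall>b. \<exists>c. \<forall>d. list_encode [n, a, b, c, d] \<in> R)))"

definition sigma4_complete :: "nat set \<Rightarrow> bool" where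
  "sigma4_complete A \<longleftrightarrow> sigma4 A \<and>
     (\<forall>B. sigma4 B \<longrightarrow> (\<exists>f. computable_fun f \<and> (\<forall>n. n \<in> B \<longleftrightarrow> f n \<in> A)))"

definition computable_struct :: "nat set \<Rightarrow> (nat \<times> nat) set \<Rightarrow> bool" where
  "computable_struct U R \<longleftrightarrow> R \<subseteq> U \<times> U \<and> computable_set U \<and> computable_rel R"

definition is_embedding :: "(nat \<Rightarrow> nat) \<Rightarrow> nat set \<Rightarrow> (nat \<times> nat) set
    \<Rightarrow> nat set \<Rightarrow> (nat \<times> nat) set \<Rightarrow> bool" where
  "is_embedding f U R V S \<longleftrightarrow> f ` U \<subseteq> V \<and> inj_on f U \<and>
     (\<forall>x \<in> U. \<forall>y \<in> U. (x, y) \<in> R \<longleftrightarrow> (f x, f y) \<in> S)"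

definition embeds :: "nat set \<Rightarrow> (nat \<times> nat) set \<Rightarrow> nat set \<Rightarrow> (nat \<times> nat) set \<Rightarrow> bool" where
  "embeds U R V S \<longleftrightarrow> (\<exists>f. is_embedding f U R V S)"

definition bi_embeddable :: "nat set \<Rightarrow> (nat \<times> nat) set \<Rightarrow> nat set \<Rightarrow> (nat \<times> nat) set \<Rightarrow> bool" where
  "bi_embeddable U R V S \<longleftrightarrow> embeds U R V S \<and> embeds V S U R"

definition be_cat_computes :: "nat set \<Rightarrow> nat set \<Rightarrow> (nat \<times> nat) set \<Rightarrow> bool" where
  "be_cat_computes X U R \<longleftrightarrow>
     (\<forall>V S W T. computable_struct V S \<and> computable_struct W T \<and>
        bi_embeddable V S U R \<and> bi_embeddable W T U R \<longrightarrow>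
        (\<exists>f. is_embedding f V S W T \<and> computes_on X V f) \<and>
        (\<exists>g. is_embedding g W T V S \<and> computes_on X W g))"

definition be_cat_degree_is :: "nat set \<Rightarrow> nat set \<Rightarrow> (nat \<times> nat) set \<Rightarrow> bool" where
  "be_cat_degree_is D U R \<longleftrightarrow>
     be_cat_computes D U R \<and> (\<forall>X. be_cat_computes X U R \<longrightarrow> turing_le D X)"

definition C_rel :: "nat \<Rightarrow> (nat \<times> nat) set" where
  "C_rel e = {(x, y). phi {} e [x, y] 1}"

definition C_is_comp_eq :: "nat \<Rightarrow> bool" where
  "C_is_comp_eq e \<longleftrightarrow> (\<forall>x y. phi {} e [x, y] 0 \<or> phi {} e [x, y] 1) \<and> equiv UNIV (C_rel e)"

end

theory Submission
  imports Defs "HOL-Library.Infinite_Set"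
begin

text \<open>Let K be the halting set. For an equivalence structure on the natural numbers one shows:

  \<^item> If for some k only finitely many classes have at least k elements, then matching these finitely
    many classes by hand and the remaining ones greedily gives computable embeddings between any two
    computable bi-embeddable copies.
  \<^item> If finitely many classes are infinite and the finite ones are unbounded, then K computes sizes of
    finite classes, so the same greedy matching is K-computable. Conversely, let the classes of one
    copy be as large as least halting witnesses, and let those of another have known sizes: an
    embedding bounds the witnesses and thus computes K.
  \<^item> If infinitely many classes are infinite, let D be the diagonal set of the K-computable functions.
    In a suitable copy the infinite classes are indexed by initial segments of the characteristic
    function of D, annotated with witnesses. A K-computable embedding of the structure
    with only infinite classes would enumerate such segments and decide D.

  So K is the degree iff finitely many classes are infinite and the finite ones are unbounded, a
  \<open>\<Sigma>\<^sub>4\<close> condition. For hardness, a \<open>\<Pi>\<^sub>4\<close> statement \<open>\<forall>a. \<exists>b. \<forall>c. \<exists>d. Q\<close> is turned into the infinity of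
  the set of infinite classes, again indexing them by lists of canonical witnesses for the first values
  of a; uniqueness of the witnesses leaves one list of each length.\<close>

text \<open>The closure rules handle total functions only, and no universal program is built. Where
  computations have to be quantified over, as for the halting set, the diagonal set and the
  complexity of the index set, they are replaced by finite certificates that can be checked without
  the oracle. This makes the diagonal set of the K-computable functions
  \<open>\<Sigma>\<^sub>2\<close>. Hence membership and non-membership both have the form
  \<exists>b. \<forall>c. \<exists>d, and the construction that proves hardness also serves, with a
  formula that is always true, to defeat K when infinitely many classes are infinite.

  An embedding never shrinks a class, so having infinitely many infinite classes, or infinitely many
  of size at least k, is invariant under bi-embeddability. The obstacle to a computable matching is
  that the size of a target class is unknown. But finitely many elements confirm that a class has at
  least k of them, so only an upper bound for the size of the source class has to be computed. This
  is what K is used for, and the finitely many infinite classes are exempted because they have no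
  such bound.\<close>

inductive_cases eval_ZeroE: "eval X Zero xs y"
inductive_cases eval_SuccE: "eval X Succ xs y"
inductive_cases eval_ProjE: "eval X (Proj i) xs y"
inductive_cases eval_OrcE: "eval X Orc xs y"
inductive_cases eval_CompE: "eval X (Comp f gs) xs y"
inductive_cases eval_PrimE: "eval X (Prim f g) xs y"
inductive_cases eval_MuE: "eval X (Mu f) xs y"

lemma eval_det: "eval X p xs y \<Longrightarrow> eval X p xs z \<Longrightarrow> y = z"
proof (induction arbitrary: z rule: eval.induct)
  case (comp ys gs xs f y)
  from comp.prems show ?case
  proof (rule eval_CompE)
    fix ys' assume l: "length ys' = length gs"
      and e: "\<forall>i<length gs. eval X (gs ! i) xs (ys' ! i)" and f: "eval X f ys' z"
    have "ys = ys'"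
      using comp.hyps l e comp.IH by (intro nth_equalityI) auto
    with f comp.IH show "y = z" by simp
  qed
next
  case (mu f n xs)
  from mu.prems show ?case
  proof (rule eval_MuE)
    assume z: "eval X f (z # xs) 0" and sm: "\<forall>m<z. \<exists>k. eval X f (m # xs) (Suc k)"
    show "n = z"
    proof (cases n z rule: linorder_cases)
      case less
      then obtain k where "eval X f (n # xs) (Suc k)" using sm by blast
      then show ?thesis using mu.IH by blast
    next
      case greater
      then show ?thesis using mu.IH(2) z by blast
    qed
  qed
next
  case (primS f g n xs r y)
  from primS.prems show ?case by (rule eval_PrimE) (use primS.IH in auto)
next
  case (prim0 f xs y g)
  from prim0.prems show ?case by (rule eval_PrimE) (use prim0.IH in auto)
qed (auto elim: eval_ZeroE eval_SuccE eval_ProjE eval_OrcE)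

lemma encode_inj: "encode p = encode q \<Longrightarrow> p = q"
proof (induction p arbitrary: q)
  case (Comp f gs)
  then obtain f' gs' where q: "q = Comp f' gs'" by (cases q) auto
  have gs: "map encode gs = map encode gs'" and f: "encode f = encode f'"
    using Comp.prems q by (auto simp: list_encode_eq)
  have "length gs = length gs'" using gs map_eq_imp_length_eq by blast
  moreover have "gs ! i = gs' ! i" if "i < length gs" for i
    using Comp.IH(2)[of "gs ! i"] gs that \<open>length gs = length gs'\<close> by (metis nth_map nth_mem)
  ultimately have "gs = gs'" by (intro nth_equalityI) auto
  with Comp.IH(1)[OF f] q show ?case by simp
qed (case_tac q; auto; fail)+

lemma phi_encode [simp]: "phi X (encode p) = eval X p"
  unfolding phi_def fun_eq_iff using encode_inj by blast

lemma phi_det: "phi X e xs y \<Longrightarrow> phi X e xs z \<Longrightarrow> y = z"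
  unfolding phi_def using encode_inj eval_det by blast

lemma halting_set_encode: "encode p \<in> halting_set \<longleftrightarrow> (\<exists>y. eval {} p [encode p] y)"
  by (simp add: halting_set_def)

section \<open>Evaluation of composed programs\<close>

lemma eval_Comp1: "eval X g xs a \<Longrightarrow> eval X f [a] y \<Longrightarrow> eval X (Comp f [g]) xs y"
  by (rule eval.comp[of "[a]"]) auto

lemma eval_Comp2:
  "eval X g xs a \<Longrightarrow> eval X h xs b \<Longrightarrow> eval X f [a, b] y \<Longrightarrow> eval X (Comp f [g, h]) xs y"
  by (rule eval.comp[of "[a, b]"]) (auto simp: less_Suc_eq)

lemma eval_Comp3:
  "eval X g xs a \<Longrightarrow> eval X h xs b \<Longrightarrow> eval X k xs c \<Longrightarrow> eval X f [a, b, c] y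
    \<Longrightarrow> eval X (Comp f [g, h, k]) xs y"
  by (rule eval.comp[of "[a, b, c]"]) (auto simp: less_Suc_eq)

lemma eval_Proj0: "eval X (Proj 0) (x # xs) x"
  using eval.proj[of 0 "x # xs"] by simp

lemma eval_Proj1: "eval X (Proj (Suc 0)) (x # y # xs) y"
  using eval.proj[of 1 "x # y # xs"] by simp

lemma eval_Proj2: "eval X (Proj (Suc (Suc 0))) (x # y # z # xs) z"
  using eval.proj[of 2 "x # y # z # xs"] by (simp add: numeral_2_eq_2)

lemmas eval_basic = eval_Proj0 eval_Proj1 eval_Proj2 eval.zero eval.succ eval_Comp1 eval_Comp2 eval_Comp3

lemma eval_Prim_rec:
  assumes "eval X f xs a" "\<And>n r. eval X g (n # r # xs) (b n r)"
  shows "eval X (Prim f g) (n # xs) (rec_nat a b n)"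
  by (induction n) (auto intro: assms eval.intros)

fun const_prog :: "nat \<Rightarrow> recf" where
  "const_prog 0 = Zero"
| "const_prog (Suc n) = Comp Succ [const_prog n]"

lemma eval_const_prog: "eval X (const_prog n) xs n"
  by (induction n) (auto intro: eval_basic)

section \<open>Closure properties of computable functions\<close>

text \<open>Only unary functions are considered; several arguments are passed through prod_encode.
  A predicate on several variables occurs below with those variables replaced by projections of a
  single variable, so that the closure rules can be applied syntactically.\<close>

definition cf :: "nat set \<Rightarrow> (nat \<Rightarrow> nat) \<Rightarrow> bool" where
  "cf X f \<longleftrightarrow> (\<exists>p. \<forall>x. eval X p [x] (f x))"

definition cp :: "nat set \<Rightarrow> (nat \<Rightarrow> bool) \<Rightarrow> bool" where
  "cp X P \<longleftrightarrow> cf X (\<lambda>x. of_bool (P x))"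

definition pfst :: "nat \<Rightarrow> nat" where "pfst z = fst (prod_decode z)"
definition psnd :: "nat \<Rightarrow> nat" where "psnd z = snd (prod_decode z)"

lemma pfst_pair [simp]: "pfst (prod_encode (a, b)) = a"
  and psnd_pair [simp]: "psnd (prod_encode (a, b)) = b"
  and pair_pfst_psnd [simp]: "prod_encode (pfst z, psnd z) = z"
  by (simp_all add: pfst_def psnd_def)

lemma cf_comp: "cf X f \<Longrightarrow> cf X g \<Longrightarrow> cf X (\<lambda>x. f (g x))"
  unfolding cf_def by (meson eval_Comp1)

lemma cf_id: "cf X (\<lambda>x. x)"
  unfolding cf_def by (blast intro: eval_Proj0)

lemma cf_const: "cf X (\<lambda>x. c)"
  unfolding cf_def by (blast intro: eval_const_prog)

lemma cf_Suc: "cf X f \<Longrightarrow> cf X (\<lambda>x. Suc (f x))"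
  unfolding cf_def by (meson eval_Comp1 eval.succ)

lemma cf_comp2_prog:
  "(\<And>x y. eval X p [x, y] (h x y)) \<Longrightarrow> cf X f \<Longrightarrow> cf X g \<Longrightarrow> cf X (\<lambda>x. h (f x) (g x))"
  unfolding cf_def by (meson eval_Comp2)

section \<open>Arithmetic functions\<close>

definition add_prog :: recf where "add_prog = Prim (Proj 0) (Comp Succ [Proj (Suc 0)])"

lemma eval_add_prog: "eval X add_prog [x, y] (x + y)"
proof -
  have "eval X add_prog [x, y] (rec_nat y (\<lambda>n r. Suc r) x)"
    unfolding add_prog_def by (intro eval_Prim_rec) (auto intro: eval_basic)
  moreover have "rec_nat y (\<lambda>n r. Suc r) x = x + y" by (induction x) auto
  ultimately show ?thesis by simp
qed

lemma cf_add: "cf X f \<Longrightarrow> cf X g \<Longrightarrow> cf X (\<lambda>x. f x + g x)"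
  using cf_comp2_prog[OF eval_add_prog] .

definition pred_prog :: recf where "pred_prog = Prim Zero (Proj 0)"

lemma eval_pred_prog: "eval X pred_prog [x] (x - 1)"
proof -
  have "eval X pred_prog [x] (rec_nat 0 (\<lambda>n r. n) x)"
    unfolding pred_prog_def by (intro eval_Prim_rec) (auto intro: eval_basic)
  then show ?thesis by (cases x) auto
qed

text \<open>The arguments are swapped: recursion runs over the subtrahend.\<close>
definition sub_prog :: recf where "sub_prog = Prim (Proj 0) (Comp pred_prog [Proj (Suc 0)])"

lemma eval_sub_prog: "eval X sub_prog [y, x] (x - y)"
proof -
  have "eval X sub_prog [y, x] (rec_nat x (\<lambda>n r. r - 1) y)"
    unfolding sub_prog_def
    by (intro eval_Prim_rec) (auto intro!: eval_basic eval_pred_prog simp del: One_nat_def)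
  moreover have "rec_nat x (\<lambda>n r. r - 1) y = x - y" by (induction y) auto
  ultimately show ?thesis by simp
qed

lemma cf_sub: "cf X f \<Longrightarrow> cf X g \<Longrightarrow> cf X (\<lambda>x. f x - g x)"
  using cf_comp2_prog[OF eval_sub_prog] .

definition mult_prog :: recf where
  "mult_prog = Prim Zero (Comp add_prog [Proj (Suc 0), Proj (Suc (Suc 0))])"

lemma eval_mult_prog: "eval X mult_prog [x, y] (x * y)"
proof -
  have "eval X mult_prog [x, y] (rec_nat 0 (\<lambda>n r. r + y) x)"
    unfolding mult_prog_def
    by (intro eval_Prim_rec) (auto intro!: eval_basic eval_add_prog)
  moreover have "rec_nat 0 (\<lambda>n r. r + y) x = x * y" by (induction x) auto
  ultimately show ?thesis by simp
qed

lemma cf_mult: "cf X f \<Longrightarrow> cf X g \<Longrightarrow> cf X (\<lambda>x. f x * g x)"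
  using cf_comp2_prog[OF eval_mult_prog] .

definition triangle_prog :: recf where
  "triangle_prog = Prim Zero (Comp add_prog [Proj (Suc 0), Comp Succ [Proj 0]])"

lemma eval_triangle_prog: "eval X triangle_prog [x] (triangle x)"
proof -
  have "eval X triangle_prog [x] (rec_nat 0 (\<lambda>n r. r + Suc n) x)"
    unfolding triangle_prog_def
    by (intro eval_Prim_rec) (auto intro!: eval_basic eval_add_prog simp del: add_Suc_right)
  moreover have "rec_nat 0 (\<lambda>n r. r + Suc n) x = triangle x" by (induction x) auto
  ultimately show ?thesis by simp
qed

lemma cf_triangle: "cf X f \<Longrightarrow> cf X (\<lambda>x. triangle (f x))"
  unfolding cf_def by (meson eval_Comp1 eval_triangle_prog)

lemma cf_pair: "cf X f \<Longrightarrow> cf X g \<Longrightarrow> cf X (\<lambda>x. prod_encode (f x, g x))"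
  unfolding prod_encode_def by (simp add: cf_add cf_triangle)

lemma eval_pair_prog: "\<exists>p. \<forall>X x y. eval X p [x, y] (prod_encode (x, y))"
proof (intro exI allI)
  fix X x y
  show "eval X (Comp add_prog [Comp triangle_prog [add_prog], Proj 0]) [x, y] (prod_encode (x, y))"
    unfolding prod_encode_def
    by (auto intro!: eval_basic eval_add_prog eval_triangle_prog)
qed

lemma eval_Mu_least:
  assumes "\<And>n. eval X p (n # xs) (of_bool (\<not> P n))" "\<exists>n. P n"
  shows "eval X (Mu p) xs (LEAST n. P n)"
proof (rule eval.mu)
  show "eval X p ((LEAST n. P n) # xs) 0"
    using assms(1)[of "LEAST n. P n"] LeastI_ex[OF assms(2)] by simp
  show "\<forall>m<(LEAST n. P n). \<exists>k. eval X p (m # xs) (Suc k)"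
    using assms(1) not_less_Least by (metis One_nat_def of_bool_eq(2))
qed

section \<open>Inverting the pairing function\<close>

lemma triangle_mono: "a \<le> b \<Longrightarrow> triangle a \<le> triangle b"
  by (induction b) (auto simp: le_Suc_eq)

text \<open>Since \<open>prod_encode (a, b) = triangle (a + b) + a\<close>, the least k found here
  is a + b, from which both components follow by subtraction. The search is programmed by hand
  because \<open>cf_Least\<close> expects a condition on pairs that are already decoded.\<close>

lemma cf_pair_index: "cf X (\<lambda>z. LEAST k. z < triangle (Suc k))"
proof -
  let ?p = "Comp sub_prog [Comp triangle_prog [Comp Succ [Proj 0]], Comp Succ [Proj (Suc 0)]]"
  let ?q = "Comp sub_prog [Comp sub_prog [Comp triangle_prog [Comp Succ [Proj 0]], Comp Succ [Proj (Suc 0)]], const_prog 1]"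
  have "eval X (Mu ?p) [z] (LEAST k. z < triangle (Suc k))" for z
  proof (rule eval.mu)
    have ex: "z < triangle (Suc z)" by simp
    \<comment> \<open>The truncated difference is 0 exactly when
      \<open>z < triangle (Suc k)\<close>, and 0 is the value at which \<open>Mu\<close> stops.
      \<open>sub_prog\<close> takes the subtrahend first.\<close>
    have p: "eval X ?p [k, z] (Suc z - triangle (Suc k))" for k
      by (rule eval_basic eval_triangle_prog eval_sub_prog)+
    from LeastI[of "\<lambda>k. z < triangle (Suc k)", OF ex]
    show "eval X ?p [LEAST k. z < triangle (Suc k), z] 0"
      using p[of "LEAST k. z < triangle (Suc k)"] by (metis Suc_leI diff_is_0_eq)
    show "\<forall>m<(LEAST k. z < triangle (Suc k)). \<exists>k. eval X ?p [m, z] (Suc k)"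
    proof (intro allI impI)
      fix m assume "m < (LEAST k. z < triangle (Suc k))"
      then have "\<not> z < triangle (Suc m)" by (rule not_less_Least)
      then have "Suc z - triangle (Suc m) = Suc (z - triangle (Suc m))"
        by (simp add: Suc_diff_le)
      then show "\<exists>k. eval X ?p [m, z] (Suc k)" using p by metis
    qed
  qed
  then show ?thesis unfolding cf_def by blast
qed

lemma pair_index: "(LEAST k. prod_encode (a, b) < triangle (Suc k)) = a + b"
proof (rule Least_equality)
  show "prod_encode (a, b) < triangle (Suc (a + b))" by (simp add: prod_encode_def)
  fix y assume y: "prod_encode (a, b) < triangle (Suc y)"
  show "a + b \<le> y"
  proof (rule ccontr)
    assume "\<not> a + b \<le> y"
    then have "triangle (Suc y) \<le> triangle (a + b)" by (intro triangle_mono) simp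
    with y show False by (simp add: prod_encode_def)
  qed
qed

lemma cf_pfst: assumes "cf X f" shows "cf X (\<lambda>x. pfst (f x))"
proof -
  have "pfst z = z - triangle (LEAST k. z < triangle (Suc k))" for z
  proof (cases "prod_decode z")
    case (Pair a b)
    then have z: "z = prod_encode (a, b)" by (metis prod_decode_inverse)
    show ?thesis unfolding z pair_index pfst_pair by (simp add: prod_encode_def)
  qed
  then have "pfst = (\<lambda>z. z - triangle (LEAST k. z < triangle (Suc k)))" by (rule ext)
  moreover have "cf X \<dots>" by (intro cf_sub cf_id cf_triangle cf_pair_index)
  ultimately have "cf X pfst" by simp
  from cf_comp[OF this assms] show ?thesis .
qed

lemma cf_psnd: assumes "cf X f" shows "cf X (\<lambda>x. psnd (f x))"
proof -
  have "psnd z = (LEAST k. z < triangle (Suc k)) - pfst z" for z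
  proof (cases "prod_decode z")
    case (Pair a b)
    then have z: "z = prod_encode (a, b)" by (metis prod_decode_inverse)
    show ?thesis unfolding z pair_index by simp
  qed
  then have "psnd = (\<lambda>z. (LEAST k. z < triangle (Suc k)) - pfst z)" by (rule ext)
  moreover have "cf X \<dots>" by (intro cf_sub cf_id cf_pfst cf_pair_index)
  ultimately have "cf X psnd" by simp
  from cf_comp[OF this assms] show ?thesis .
qed

lemma cf_comp2:
  "cf X (\<lambda>z. h (pfst z) (psnd z)) \<Longrightarrow> cf X f \<Longrightarrow> cf X g \<Longrightarrow> cf X (\<lambda>x. h (f x) (g x))"
  using cf_comp[of X "\<lambda>z. h (pfst z) (psnd z)" "\<lambda>x. prod_encode (f x, g x)"] cf_pair by simp

lemma cf_comp3:
  "cf X (\<lambda>z. h (pfst z) (pfst (psnd z)) (psnd (psnd z))) \<Longrightarrow> cf X f \<Longrightarrow> cf X g \<Longrightarrow> cf X k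
    \<Longrightarrow> cf X (\<lambda>x. h (f x) (g x) (k x))"
  using cf_comp[of X "\<lambda>z. h (pfst z) (pfst (psnd z)) (psnd (psnd z))"
      "\<lambda>x. prod_encode (f x, prod_encode (g x, k x))"] cf_pair by simp

lemma cf_rec:
  assumes f: "cf X f" and g: "cf X (\<lambda>z. g (pfst z) (pfst (psnd z)) (psnd (psnd z)))" and h: "cf X h"
  shows "cf X (\<lambda>x. rec_nat (f x) (\<lambda>n r. g n r x) (h x))"
proof -
  obtain pp where pp: "\<And>x y. eval X pp [x, y] (prod_encode (x, y))"
    using eval_pair_prog by blast
  obtain pf pg ph where p: "\<And>x. eval X pf [x] (f x)" "\<And>x. eval X ph [x] (h x)"
    and pg: "\<And>z. eval X pg [z] (g (pfst z) (pfst (psnd z)) (psnd (psnd z)))"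
    using f g h unfolding cf_def by blast
  have q: "eval X (Comp pg [Comp pp [Proj 0, Comp pp [Proj (Suc 0), Proj (Suc (Suc 0))]]]) [n, r, x] (g n r x)" for n r x
    using pg[of "prod_encode (n, prod_encode (r, x))"]
    by (intro eval_Comp1[OF eval_Comp2[OF eval_Proj0 eval_Comp2[OF eval_Proj1 eval_Proj2 pp] pp]]) simp
  let ?p = "Comp (Prim pf (Comp pg [Comp pp [Proj 0, Comp pp [Proj (Suc 0), Proj (Suc (Suc 0))]]])) [ph, Proj 0]"
  have "eval X ?p [x] (rec_nat (f x) (\<lambda>n r. g n r x) (h x))" for x
    by (rule eval_Comp2[OF p(2) eval_Proj0 eval_Prim_rec[OF p(1) q]])
  then show ?thesis unfolding cf_def by blast
qed

section \<open>Decidable predicates, bounded quantifiers and searches\<close>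

lemma cf_if: assumes "cp X P" "cf X f" "cf X g" shows "cf X (\<lambda>x. if P x then f x else g x)"
proof -
  have "(if P x then f x else g x) = of_bool (P x) * f x + (1 - of_bool (P x)) * g x" for x
    by simp
  then show ?thesis
    using assms unfolding cp_def by (simp add: cf_add cf_mult cf_sub cf_const del: One_nat_def)
qed

lemma cp_iff_if: "cp X P \<longleftrightarrow> cf X (\<lambda>x. if P x then 1 else 0)"
  by (simp add: cp_def of_bool_def)

lemma cp_const: "cp X (\<lambda>x. c)"
  unfolding cp_def by (rule cf_const)

lemma cp_not: assumes "cp X P" shows "cp X (\<lambda>x. \<not> P x)"
proof -
  have "of_bool (\<not> P x) = (1::nat) - of_bool (P x)" for x by simp
  then show ?thesis using assms unfolding cp_def by (simp only: cf_sub cf_const)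
qed

lemma cp_and: assumes "cp X P" "cp X Q" shows "cp X (\<lambda>x. P x \<and> Q x)"
proof -
  have "of_bool (P x \<and> Q x) = (of_bool (P x) * of_bool (Q x) :: nat)" for x by simp
  then show ?thesis using assms unfolding cp_def by (simp only: cf_mult)
qed

lemma cp_or: "cp X P \<Longrightarrow> cp X Q \<Longrightarrow> cp X (\<lambda>x. P x \<or> Q x)"
  using cp_not[OF cp_and[OF cp_not cp_not]] by simp

lemma cp_imp: "cp X P \<Longrightarrow> cp X Q \<Longrightarrow> cp X (\<lambda>x. P x \<longrightarrow> Q x)"
  using cp_not[OF cp_and[OF _ cp_not]] by simp

lemma cp_iff: assumes "cp X P" "cp X Q" shows "cp X (\<lambda>x. P x \<longleftrightarrow> Q x)"
proof -
  have "cp X (\<lambda>x. (P x \<longrightarrow> Q x) \<and> (Q x \<longrightarrow> P x))" by (intro cp_and cp_imp assms)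
  moreover have "(\<lambda>x. P x \<longleftrightarrow> Q x) = (\<lambda>x. (P x \<longrightarrow> Q x) \<and> (Q x \<longrightarrow> P x))" by auto
  ultimately show ?thesis by simp
qed

lemma cp_le: assumes "cf X f" "cf X g" shows "cp X (\<lambda>x. f x \<le> g x)"
proof -
  have "of_bool (f x \<le> g x) = 1 - (f x - g x)" for x by simp
  then show ?thesis using assms unfolding cp_def by (simp only: cf_sub cf_const)
qed

lemma cp_less: assumes "cf X f" "cf X g" shows "cp X (\<lambda>x. f x < g x)"
  using cp_le[OF cf_Suc[OF assms(1)] assms(2)] by (simp add: Suc_le_eq)

lemma cp_eq: assumes "cf X f" "cf X g" shows "cp X (\<lambda>x. f x = g x)"
proof -
  have "cp X (\<lambda>x. f x \<le> g x \<and> g x \<le> f x)" by (intro cp_and cp_le assms)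
  then show ?thesis by (simp add: eq_iff)
qed

lemma cp_comp: "cp X P \<Longrightarrow> cf X f \<Longrightarrow> cp X (\<lambda>x. P (f x))"
  unfolding cp_def using cf_comp[of X "\<lambda>x. of_bool (P x)"] by simp

lemma cp_comp2:
  "cp X (\<lambda>z. P (pfst z) (psnd z)) \<Longrightarrow> cf X f \<Longrightarrow> cf X g \<Longrightarrow> cp X (\<lambda>x. P (f x) (g x))"
  unfolding cp_def using cf_comp2[of X "\<lambda>a b. of_bool (P a b)"] by simp

lemma cp_comp3:
  "cp X (\<lambda>z. P (pfst z) (pfst (psnd z)) (psnd (psnd z))) \<Longrightarrow> cf X f \<Longrightarrow> cf X g \<Longrightarrow> cf X k
    \<Longrightarrow> cp X (\<lambda>x. P (f x) (g x) (k x))"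
  unfolding cp_def using cf_comp3[of X "\<lambda>a b c. of_bool (P a b c)"] by simp

lemma cp_ex_less:
  assumes "cp X (\<lambda>z. P (pfst z) (psnd z))" "cf X b"
  shows "cp X (\<lambda>x. \<exists>i<b x. P i x)"
proof -
  have eq: "of_bool (\<exists>i<n. P i x) = rec_nat 0 (\<lambda>n r. if P n x then 1 else r) n" for n x
  proof (induction n)
    case (Suc n)
    have "(\<exists>i<Suc n. P i x) \<longleftrightarrow> P n x \<or> (\<exists>i<n. P i x)" by (auto simp: less_Suc_eq)
    then show ?case by (simp flip: Suc)
  qed simp
  have P: "cp X (\<lambda>z. P (pfst z) (psnd (psnd z)))"
    by (rule cp_comp2[OF assms(1)]) (intro cf_pfst cf_psnd cf_id)+
  show ?thesis
    unfolding cp_def eq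
    by (intro cf_rec cf_const assms cf_if P cf_pfst cf_psnd cf_id)
qed

lemma cp_all_less:
  assumes "cp X (\<lambda>z. P (pfst z) (psnd z))" "cf X b"
  shows "cp X (\<lambda>x. \<forall>i<b x. P i x)"
  using cp_not[OF cp_ex_less[OF cp_not[OF assms(1)] assms(2)]] by simp

lemma cp_ex_le:
  assumes "cp X (\<lambda>z. P (pfst z) (psnd z))" "cf X b"
  shows "cp X (\<lambda>x. \<exists>i\<le>b x. P i x)"
  using cp_ex_less[OF assms(1) cf_Suc[OF assms(2)]] by (simp add: less_Suc_eq_le)

lemma cp_all_le:
  assumes "cp X (\<lambda>z. P (pfst z) (psnd z))" "cf X b"
  shows "cp X (\<lambda>x. \<forall>i\<le>b x. P i x)"
  using cp_all_less[OF assms(1) cf_Suc[OF assms(2)]] by (simp add: less_Suc_eq_le)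

text \<open>As \<open>cf\<close> speaks of total functions, the search must succeed for every x.
  Later searches meet this by a condition that holds vacuously outside the intended domain, such as
  \<open>x \<in> V \<longrightarrow> (y, x) \<in> S\<close>.\<close>

lemma cf_Least:
  assumes P: "cp X (\<lambda>z. P (pfst z) (psnd z))" and ex: "\<And>x. \<exists>n. P n x"
  shows "cf X (\<lambda>x. LEAST n. P n x)"
proof -
  obtain pp where pp: "\<And>x y. eval X pp [x, y] (prod_encode (x, y))"
    using eval_pair_prog by blast
  from cp_not[OF P] obtain q where q: "\<And>z. eval X q [z] (of_bool (\<not> P (pfst z) (psnd z)))"
    unfolding cp_def cf_def by blast
  have "eval X (Comp q [pp]) [n, x] (of_bool (\<not> P n x))" for n x
    using q[of "prod_encode (n, x)"] by (intro eval_Comp1[OF pp]) simp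
  then have "eval X (Mu (Comp q [pp])) [x] (LEAST n. P n x)" for x
    using ex by (intro eval_Mu_least)
  then show ?thesis unfolding cf_def by blast
qed

lemma cf_card_less:
  assumes P: "cp X (\<lambda>z. P (pfst z) (psnd z))" and b: "cf X b"
  shows "cf X (\<lambda>x. card {i. i < b x \<and> P i x})"
proof -
  have eq: "card {i. i < n \<and> P i x} = rec_nat 0 (\<lambda>n r. if P n x then Suc r else r) n" for n x
  proof (induction n)
    case (Suc n)
    have "{i. i < Suc n \<and> P i x} = (if P n x then insert n {i. i < n \<and> P i x} else {i. i < n \<and> P i x})"
      by (auto simp: less_Suc_eq)
    then show ?case using Suc by simp
  qed simp
  have "cp X (\<lambda>z. P (pfst z) (psnd (psnd z)))"
    by (rule cp_comp2[OF P]) (intro cf_pfst cf_psnd cf_id)+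
  then show ?thesis
    unfolding eq by (intro cf_rec cf_const b cf_if cf_pfst cf_psnd cf_id cf_Suc)
qed

section \<open>Lists coded as numbers\<close>

definition llen :: "nat \<Rightarrow> nat" where "llen c = length (list_decode c)"
definition lhd :: "nat \<Rightarrow> nat" where "lhd c = pfst (c - 1)"
definition ltl :: "nat \<Rightarrow> nat" where "ltl c = psnd (c - 1)"
definition ldrop :: "nat \<Rightarrow> nat \<Rightarrow> nat" where "ldrop n c = rec_nat c (\<lambda>n r. ltl r) n"
definition lnth :: "nat \<Rightarrow> nat \<Rightarrow> nat" where "lnth c n = lhd (ldrop n c)"
definition lcons :: "nat \<Rightarrow> nat \<Rightarrow> nat" where "lcons a c = Suc (prod_encode (a, c))"
definition lmem :: "nat \<Rightarrow> nat \<Rightarrow> bool" where "lmem a c \<longleftrightarrow> a \<in> set (list_decode c)"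

lemma list_decode_lcons [simp]: "list_decode (lcons a c) = a # list_decode c"
  by (simp add: lcons_def)

lemma lcons_encode [simp]: "lcons a (list_encode xs) = list_encode (a # xs)"
  by (simp add: lcons_def)

lemma lhd_lcons [simp]: "lhd (lcons a c) = a" and ltl_lcons [simp]: "ltl (lcons a c) = c"
  by (simp_all add: lhd_def ltl_def lcons_def)

lemma list_code_cases: obtains "c = 0" | a d where "c = lcons a d"
proof (cases c)
  case (Suc m)
  then have "c = lcons (pfst m) (psnd m)" by (simp add: lcons_def)
  then show ?thesis using that by blast
qed (use that in blast)

lemma prod_decode_0: "prod_decode 0 = (0, 0)"
proof -
  have "prod_encode (0, 0) = 0" by (simp add: prod_encode_def)
  then show ?thesis by (metis prod_encode_inverse)
qed

lemma ltl_0 [simp]: "ltl 0 = 0"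
  by (simp add: ltl_def psnd_def prod_decode_0)

lemma list_decode_ltl: "list_decode (ltl c) = tl (list_decode c)"
  by (cases c rule: list_code_cases) auto

lemma list_decode_ldrop [simp]: "list_decode (ldrop n c) = drop n (list_decode c)"
  by (induction n) (auto simp: ldrop_def list_decode_ltl drop_Suc tl_drop)

lemma llen_0 [simp]: "llen 0 = 0" and llen_lcons [simp]: "llen (lcons a c) = Suc (llen c)"
  by (simp_all add: llen_def)

lemma ldrop_lcons_Suc [simp]: "ldrop (Suc n) (lcons a c) = ldrop n c"
  and ldrop_zero [simp]: "ldrop 0 c = c"
proof -
  show "ldrop (Suc n) (lcons a c) = ldrop n c"
    by (metis drop_Suc_Cons list_decode_inverse list_decode_lcons list_decode_ldrop)
qed (simp add: ldrop_def)

lemma lnth_lcons_Suc [simp]: "lnth (lcons a c) (Suc n) = lnth c n"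
  and lnth_lcons_0 [simp]: "lnth (lcons a c) 0 = a"
  by (simp_all add: lnth_def)

lemma lnth_eq_nth: "n < llen c \<Longrightarrow> lnth c n = list_decode c ! n"
proof (induction n arbitrary: c)
  case 0 then show ?case by (cases c rule: list_code_cases) auto
next
  case (Suc n) then show ?case by (cases c rule: list_code_cases) auto
qed

lemma lmem_iff: "lmem a c \<longleftrightarrow> (\<exists>i<llen c. lnth c i = a)"
  unfolding lmem_def in_set_conv_nth using lnth_eq_nth by (auto simp: llen_def)

lemma lmem_lcons [simp]: "lmem a (lcons b c) \<longleftrightarrow> a = b \<or> lmem a c" and lmem_0 [simp]: "\<not> lmem a 0"
  by (auto simp: lmem_def)

lemma list_code_induct [case_names Nil Cons]:
  assumes "P 0" "\<And>a c. P c \<Longrightarrow> P (lcons a c)"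
  shows "P c"
proof -
  have "P (list_encode xs)" for xs
    by (induction xs) (use assms in \<open>auto simp: lcons_def\<close>)
  from this[of "list_decode c"] show ?thesis by simp
qed

lemma cf_lcons: "cf X f \<Longrightarrow> cf X g \<Longrightarrow> cf X (\<lambda>x. lcons (f x) (g x))"
  unfolding lcons_def by (intro cf_Suc cf_pair)

lemma cf_lhd: "cf X f \<Longrightarrow> cf X (\<lambda>x. lhd (f x))"
  unfolding lhd_def by (intro cf_pfst cf_sub cf_const)

lemma cf_ltl: "cf X f \<Longrightarrow> cf X (\<lambda>x. ltl (f x))"
  unfolding ltl_def by (intro cf_psnd cf_sub cf_const)

lemma cf_ldrop: "cf X f \<Longrightarrow> cf X g \<Longrightarrow> cf X (\<lambda>x. ldrop (f x) (g x))"
  unfolding ldrop_def by (intro cf_rec cf_ltl cf_pfst cf_psnd cf_id)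

lemma cf_lnth: "cf X f \<Longrightarrow> cf X g \<Longrightarrow> cf X (\<lambda>x. lnth (f x) (g x))"
  unfolding lnth_def by (intro cf_lhd cf_ldrop)

text \<open>Dropping elements reaches 0, the code of the empty list, as soon as the list is
  exhausted. This turns the length into the result of an unbounded search.\<close>

lemma llen_eq_Least: "llen c = (LEAST n. ldrop n c = 0)"
proof (rule sym, rule Least_equality)
  show "ldrop (llen c) c = 0"
    by (metis drop_all le_refl list_decode.simps(1) list_decode_inverse list_decode_ldrop llen_def)
  show "llen c \<le> n" if "ldrop n c = 0" for n
    using that list_decode_ldrop[of n c] by (simp add: llen_def)
qed

lemma cf_llen: assumes "cf X f" shows "cf X (\<lambda>x. llen (f x))"
proof -
  have "cf X (\<lambda>c. LEAST n. ldrop n c = 0)"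
  proof (rule cf_Least)
    show "cp X (\<lambda>z. ldrop (pfst z) (psnd z) = 0)"
      by (intro cp_eq cf_ldrop cf_pfst cf_psnd cf_id cf_const)
    show "\<exists>n. ldrop n c = 0" for c
      by (rule exI[of _ "llen c"]) (metis drop_all le_refl list_decode.simps(1) list_decode_inverse list_decode_ldrop llen_def)
  qed
  then have "cf X llen" by (simp add: llen_eq_Least[abs_def])
  from cf_comp[OF this assms] show ?thesis .
qed

lemma cp_lmem: "cf X f \<Longrightarrow> cf X g \<Longrightarrow> cp X (\<lambda>x. lmem (f x) (g x))"
  by (rule cp_comp2[where P = lmem]) (unfold lmem_iff, intro cp_ex_less cp_eq cf_lnth cf_llen cf_pfst cf_psnd cf_id)

lemma cf_list_encode_Cons:
  "cf X f \<Longrightarrow> cf X (\<lambda>x. list_encode (g x)) \<Longrightarrow> cf X (\<lambda>x. list_encode (f x # g x))"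
  using cf_lcons[of X f "\<lambda>x. list_encode (g x)"] by (simp add: lcons_def)

lemmas cf_arith = cf_const cf_id cf_Suc cf_pair cf_pfst cf_psnd cf_add cf_sub cf_mult cf_if
  cf_lcons cf_lhd cf_ltl cf_ldrop cf_lnth cf_llen
lemmas cp_logic = cp_const cp_not cp_and cp_or cp_imp cp_iff cp_le cp_less cp_eq cp_lmem
  cp_ex_less cp_all_less cp_ex_le cp_all_le
lemmas c_rules = cp_logic cf_arith

section \<open>Adding an oracle to a computation without one\<close>

fun no_oracle :: "recf \<Rightarrow> recf" where
  "no_oracle Orc = Comp Zero [Proj 0]"
| "no_oracle (Comp f gs) = Comp (no_oracle f) (map no_oracle gs)"
| "no_oracle (Prim f g) = Prim (no_oracle f) (no_oracle g)"
| "no_oracle (Mu f) = Mu (no_oracle f)"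
| "no_oracle p = p"

text \<open>The empty oracle answers 0 to every query, so a program with \<open>Orc\<close> replaced
  by 0 gives the same values under any oracle. The projection inside the replacement keeps the
  domain of \<open>Orc\<close>, which is undefined on the empty list.\<close>

lemma eval_no_oracle: "eval {} p xs y \<Longrightarrow> eval X (no_oracle p) xs y"
proof (induction rule: eval.induct)
  case (orc x xs) then show ?case by (auto intro: eval_basic)
next
  case (comp ys gs xs f y) then show ?case by (auto intro!: eval.comp[of ys])
qed (auto intro: eval.intros)

lemma cf_oracle: "cf {} f \<Longrightarrow> cf X f"
  unfolding cf_def using eval_no_oracle by meson

lemma cp_oracle: "cp {} P \<Longrightarrow> cp X P"
  unfolding cp_def by (rule cf_oracle)

lemma cp_mem_oracle: "cf X f \<Longrightarrow> cp X (\<lambda>x. f x \<in> X)"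
  unfolding cp_iff_if cf_def by (meson eval_Comp1 eval.orc)

lemma computable_fun_iff: "computable_fun f \<longleftrightarrow> cf {} f"
  by (simp add: computable_fun_def cf_def)

lemma computable_set_iff: "computable_set S \<longleftrightarrow> cp {} (\<lambda>x. x \<in> S)"
  by (simp add: computable_set_def cp_iff_if cf_def)

lemma turing_le_iff: "turing_le A X \<longleftrightarrow> cp X (\<lambda>x. x \<in> A)"
  by (simp add: turing_le_def cp_iff_if cf_def)

lemma binary_prog_iff:
  "(\<exists>p. \<forall>x y. eval X p [x, y] (h x y)) \<longleftrightarrow> cf X (\<lambda>z. h (pfst z) (psnd z))"
proof
  assume "\<exists>p. \<forall>x y. eval X p [x, y] (h x y)"
  then obtain p where "\<And>x y. eval X p [x, y] (h x y)" by blast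
  from cf_comp2_prog[OF this] show "cf X (\<lambda>z. h (pfst z) (psnd z))"
    by (simp add: cf_pfst cf_psnd cf_id)
next
  assume "cf X (\<lambda>z. h (pfst z) (psnd z))"
  then obtain p where p: "\<And>z. eval X p [z] (h (pfst z) (psnd z))" unfolding cf_def by blast
  obtain pp where pp: "\<And>x y. eval X pp [x, y] (prod_encode (x, y))"
    using eval_pair_prog by blast
  have "eval X (Comp p [pp]) [x, y] (h x y)" for x y
    using p[of "prod_encode (x, y)"] by (intro eval_Comp1[OF pp]) simp
  then show "\<exists>p. \<forall>x y. eval X p [x, y] (h x y)" by blast
qed

lemma computable_rel_iff: "computable_rel R \<longleftrightarrow> cp {} (\<lambda>z. (pfst z, psnd z) \<in> R)"
  unfolding computable_rel_def cp_iff_if binary_prog_iff ..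

section \<open>Certificates of computations\<close>

text \<open>A computation is certified by a list of facts, each of which follows by one rule from later
  entries of the list: either that a number codes a program, or that a coded program has a given
  value on given arguments. The answers to oracle queries are left open.\<close>

definition fwf :: "nat \<Rightarrow> nat" where "fwf e = prod_encode (0, e)"
definition fev :: "nat \<Rightarrow> nat \<Rightarrow> nat \<Rightarrow> nat" where
  "fev e xs y = prod_encode (1, prod_encode (e, prod_encode (xs, y)))"
definition fprog :: "nat \<Rightarrow> nat" where "fprog h = pfst (psnd h)"
definition farg :: "nat \<Rightarrow> nat" where "farg h = pfst (psnd (psnd h))"
definition fres :: "nat \<Rightarrow> nat" where "fres h = psnd (psnd (psnd h))"

lemma fev_simps [simp]:
  "fprog (fev e xs y) = e" "farg (fev e xs y) = xs" "fres (fev e xs y) = y" "pfst (fev e xs y) = 1"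
  by (simp_all add: fprog_def farg_def fres_def fev_def)

lemma fwf_simps [simp]: "pfst (fwf e) = 0" "psnd (fwf e) = e"
  by (simp_all add: fwf_def)

definition wf_step :: "nat \<Rightarrow> nat \<Rightarrow> bool" where
  "wf_step e M \<longleftrightarrow> e = prod_encode (0, 0) \<or> e = prod_encode (1, 0) \<or> pfst e = 2 \<or> e = prod_encode (3, 0) \<or>
     (pfst e = 4 \<and> lmem (fwf (pfst (psnd e))) M \<and>
        (\<forall>i<llen (psnd (psnd e)). lmem (fwf (lnth (psnd (psnd e)) i)) M)) \<or>
     (pfst e = 5 \<and> lmem (fwf (pfst (psnd e))) M \<and> lmem (fwf (psnd (psnd e))) M) \<or>
     (pfst e = 6 \<and> lmem (fwf (psnd e)) M)"

definition comp_step :: "nat \<Rightarrow> nat \<Rightarrow> nat \<Rightarrow> nat \<Rightarrow> nat \<Rightarrow> bool" where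
  "comp_step f gs xs y M \<longleftrightarrow>
     (\<exists>ys. lmem (fev f ys y) M \<and> llen ys = llen gs \<and>
        (\<forall>i<llen gs. lmem (fev (lnth gs i) xs (lnth ys i)) M))"

text \<open>At 0 the recursion never evaluates \<open>g\<close>, so that \<open>g\<close> codes a
  program has to be certified separately. This is why there are facts \<open>fwf\<close> besides the
  facts \<open>fev\<close>.\<close>

definition prim_step :: "nat \<Rightarrow> nat \<Rightarrow> nat \<Rightarrow> nat \<Rightarrow> nat \<Rightarrow> nat \<Rightarrow> bool" where
  "prim_step e f g xs y M \<longleftrightarrow> xs \<noteq> 0 \<and>
     (if lhd xs = 0 then lmem (fev f (ltl xs) y) M \<and> lmem (fwf g) M
      else \<exists>r. lmem (fev e (lcons (lhd xs - 1) (ltl xs)) r) M \<and>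
             lmem (fev g (lcons (lhd xs - 1) (lcons r (ltl xs))) y) M)"

definition mu_step :: "nat \<Rightarrow> nat \<Rightarrow> nat \<Rightarrow> nat \<Rightarrow> bool" where
  "mu_step f xs y M \<longleftrightarrow> lmem (fev f (lcons y xs) 0) M \<and>
     (\<forall>m<y. \<exists>r. lmem (fev f (lcons m xs) r) M \<and> r \<noteq> 0)"

definition ev_step :: "nat \<Rightarrow> nat \<Rightarrow> nat \<Rightarrow> nat \<Rightarrow> bool" where
  "ev_step e xs y M \<longleftrightarrow>
     (e = prod_encode (0, 0) \<and> y = 0) \<or>
     (e = prod_encode (1, 0) \<and> xs \<noteq> 0 \<and> y = Suc (lhd xs)) \<or>
     (pfst e = 2 \<and> psnd e < llen xs \<and> y = lnth xs (psnd e)) \<or>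
     (e = prod_encode (3, 0) \<and> xs \<noteq> 0 \<and> y \<le> 1) \<or>
     (pfst e = 4 \<and> comp_step (pfst (psnd e)) (psnd (psnd e)) xs y M) \<or>
     (pfst e = 5 \<and> prim_step e (pfst (psnd e)) (psnd (psnd e)) xs y M) \<or>
     (pfst e = 6 \<and> mu_step (psnd e) xs y M)"

definition step :: "nat \<Rightarrow> nat \<Rightarrow> bool" where
  "step f M \<longleftrightarrow> (pfst f = 0 \<and> wf_step (psnd f) M) \<or>
     (pfst f = 1 \<and> ev_step (fprog f) (farg f) (fres f) M)"

definition valid :: "nat \<Rightarrow> bool" where
  "valid c \<longleftrightarrow> (\<forall>j<llen c. step (lnth c j) (ldrop (Suc j) c))"

text \<open>Correctness of the recorded answers is kept apart from \<open>valid\<close>, which stays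
  decidable without an oracle. For the halting set it can then be expressed by quantifiers over
  halting witnesses, see \<open>diag_wit\<close>.\<close>

definition oracle_ok :: "nat set \<Rightarrow> nat \<Rightarrow> bool" where
  "oracle_ok X c \<longleftrightarrow> (\<forall>f. lmem f c \<longrightarrow> pfst f = 1 \<and> fprog f = prod_encode (3, 0) \<longrightarrow>
     (fres f = 1 \<longleftrightarrow> lhd (farg f) \<in> X))"

lemma cp_ex_lmem:
  assumes "cp X (\<lambda>z. P (pfst z) (psnd z))" "cf X M"
  shows "cp X (\<lambda>x. \<exists>h. lmem h (M x) \<and> P h x)"
proof -
  have "(\<exists>h. lmem h (M x) \<and> P h x) \<longleftrightarrow> (\<exists>i<llen (M x). P (lnth (M x) i) x)" for x
    by (auto simp: lmem_iff)
  moreover have "cp X (\<lambda>x. \<exists>i<llen (M x). P (lnth (M x) i) x)"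
    by (rule cp_ex_less[OF cp_comp2[OF assms(1) cf_lnth[OF cf_comp[OF assms(2)]]] cf_llen[OF assms(2)]])
      (intro cf_pfst cf_psnd cf_id)+
  ultimately show ?thesis by simp
qed

lemma cp_all_lmem:
  assumes "cp X (\<lambda>z. P (pfst z) (psnd z))" "cf X M"
  shows "cp X (\<lambda>x. \<forall>h. lmem h (M x) \<longrightarrow> P h x)"
  using cp_not[OF cp_ex_lmem[OF cp_not[OF assms(1)] assms(2)]] by simp

lemma cp_if: "cp X P \<Longrightarrow> cp X Q \<Longrightarrow> cp X R \<Longrightarrow> cp X (\<lambda>x. if P x then Q x else R x)"
  using cp_or[OF cp_and cp_and[OF cp_not]] by (simp add: if_bool_eq_disj)

lemma cf_fwf: "cf X f \<Longrightarrow> cf X (\<lambda>x. fwf (f x))"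
  unfolding fwf_def by (intro c_rules)

lemma cf_fev: "cf X f \<Longrightarrow> cf X g \<Longrightarrow> cf X h \<Longrightarrow> cf X (\<lambda>x. fev (f x) (g x) (h x))"
  unfolding fev_def by (intro c_rules)

lemma cf_fields: "cf X f \<Longrightarrow> cf X (\<lambda>x. fprog (f x))" "cf X f \<Longrightarrow> cf X (\<lambda>x. farg (f x))"
  "cf X f \<Longrightarrow> cf X (\<lambda>x. fres (f x))"
  unfolding fprog_def farg_def fres_def by (intro c_rules; assumption)+

text \<open>The quantified argument list is a field of some member of \<open>M\<close>, so the
  unbounded quantifier becomes a search through a finite list.\<close>

lemma cp_ex_fev_arg:
  assumes "cp X (\<lambda>z. P (pfst z) (psnd z))" "cf X e" "cf X y" "cf X M"
  shows "cp X (\<lambda>x. \<exists>a. lmem (fev (e x) a (y x)) (M x) \<and> P a x)"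
proof -
  have "(\<exists>a. lmem (fev (e x) a (y x)) (M x) \<and> P a x) \<longleftrightarrow>
      (\<exists>h. lmem h (M x) \<and> h = fev (e x) (farg h) (y x) \<and> P (farg h) x)" for x
  proof
    assume "\<exists>h. lmem h (M x) \<and> h = fev (e x) (farg h) (y x) \<and> P (farg h) x"
    then obtain h where h: "h = fev (e x) (farg h) (y x)" "lmem h (M x)" "P (farg h) x" by blast
    from h(1,2) have "lmem (fev (e x) (farg h) (y x)) (M x)" by (rule subst)
    with h(3) show "\<exists>a. lmem (fev (e x) a (y x)) (M x) \<and> P a x" by blast
  qed (metis fev_simps(2))
  moreover have "cp X (\<lambda>x. \<exists>h. lmem h (M x) \<and> h = fev (e x) (farg h) (y x) \<and> P (farg h) x)"
    by (intro cp_ex_lmem cp_and cp_eq cf_fev cf_fields cf_comp[OF assms(2)] cf_comp[OF assms(3)]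
        cp_comp2[OF assms(1)] cf_pfst cf_psnd cf_id assms(4))
  ultimately show ?thesis by simp
qed

lemma cp_ex_fev_res:
  assumes "cp X (\<lambda>z. P (pfst z) (psnd z))" "cf X e" "cf X a" "cf X M"
  shows "cp X (\<lambda>x. \<exists>r. lmem (fev (e x) (a x) r) (M x) \<and> P r x)"
proof -
  have "(\<exists>r. lmem (fev (e x) (a x) r) (M x) \<and> P r x) \<longleftrightarrow>
      (\<exists>h. lmem h (M x) \<and> h = fev (e x) (a x) (fres h) \<and> P (fres h) x)" for x
  proof
    assume "\<exists>h. lmem h (M x) \<and> h = fev (e x) (a x) (fres h) \<and> P (fres h) x"
    then obtain h where h: "h = fev (e x) (a x) (fres h)" "lmem h (M x)" "P (fres h) x" by blast
    from h(1,2) have "lmem (fev (e x) (a x) (fres h)) (M x)" by (rule subst)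
    with h(3) show "\<exists>r. lmem (fev (e x) (a x) r) (M x) \<and> P r x" by blast
  qed (metis fev_simps(3))
  moreover have "cp X (\<lambda>x. \<exists>h. lmem h (M x) \<and> h = fev (e x) (a x) (fres h) \<and> P (fres h) x)"
    by (intro cp_ex_lmem cp_and cp_eq cf_fev cf_fields cf_comp[OF assms(2)] cf_comp[OF assms(3)]
        cp_comp2[OF assms(1)] cf_pfst cf_psnd cf_id assms(4))
  ultimately show ?thesis by simp
qed

lemmas cert_rules = c_rules cp_if cp_ex_fev_arg cp_ex_fev_res cp_ex_lmem cp_all_lmem cf_fwf cf_fev cf_fields

lemma cp_step: assumes "cf X f" "cf X g" shows "cp X (\<lambda>x. step (f x) (g x))"
proof (rule cp_comp2[where P = step, OF _ assms])
  show "cp X (\<lambda>z. step (pfst z) (psnd z))"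
    unfolding step_def wf_step_def ev_step_def comp_step_def prim_step_def mu_step_def
    by (intro cert_rules)
qed

lemma cp_valid: assumes "cf X f" shows "cp X (\<lambda>x. valid (f x))"
proof (rule cp_comp[OF _ assms])
  show "cp X valid"
    unfolding valid_def by (intro cert_rules cp_step)
qed

lemma lhd_ltl_Suc [simp]: "lhd (Suc (prod_encode (a, c))) = a" "ltl (Suc (prod_encode (a, c))) = c"
  by (simp_all add: lhd_def ltl_def)

lemma valid_0 [simp]: "valid 0"
  by (simp add: valid_def)

lemma valid_lcons [simp]: "valid (lcons f M) \<longleftrightarrow> step f M \<and> valid M"
proof -
  have "(\<forall>j<Suc n. P j) \<longleftrightarrow> P 0 \<and> (\<forall>j<n. P (Suc j))" for P :: "nat \<Rightarrow> bool" and n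
    using less_Suc_eq_0_disj by auto
  then show ?thesis unfolding valid_def by simp
qed

lemma oracle_ok_0 [simp]: "oracle_ok X 0"
  by (simp add: oracle_ok_def)

lemma oracle_ok_lcons: "oracle_ok X (lcons f M) \<longleftrightarrow>
    (pfst f = 1 \<and> fprog f = prod_encode (3, 0) \<longrightarrow> (fres f = 1 \<longleftrightarrow> lhd (farg f) \<in> X)) \<and> oracle_ok X M"
  unfolding oracle_ok_def lmem_lcons by blast

lemma encode_tags:
  "encode Zero = prod_encode (0, 0)" "encode Succ = prod_encode (1, 0)" "encode Orc = prod_encode (3, 0)"
  by simp_all

lemma eval_lcons:
  "xs \<noteq> 0 \<Longrightarrow> list_decode xs = lhd xs # list_decode (ltl xs)"
  by (cases xs rule: list_code_cases) auto

lemma encode_Comp_pfst_psnd: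
  assumes "encode f = ef" "llen gs = length ps" "\<And>i. i < llen gs \<Longrightarrow> encode (ps ! i) = lnth gs i"
  shows "encode (Comp f ps) = prod_encode (4, prod_encode (ef, gs))"
proof -
  have "map encode ps = list_decode gs"
    by (rule nth_equalityI) (use assms in \<open>auto simp: llen_def lnth_eq_nth\<close>)
  then have "list_encode (map encode ps) = gs" by simp
  then show ?thesis using assms(1) by simp
qed

lemma wf_step_sound:
  assumes IH: "\<And>e. lmem (fwf e) M \<Longrightarrow> \<exists>p. encode p = e" and s: "wf_step e M"
  shows "\<exists>p. encode p = e"
proof -
  have e: "e = prod_encode (pfst e, psnd e)" by simp
  have e': "psnd e = prod_encode (pfst (psnd e), psnd (psnd e))" by simp
  from s[unfolded wf_step_def] show ?thesis
  proof (elim disjE conjE)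
    assume "pfst e = 2"
    then have "encode (Proj (psnd e)) = e" using e by (metis encode.simps(3))
    then show ?thesis by blast
  next
    assume 4: "pfst e = 4" and f: "lmem (fwf (pfst (psnd e))) M"
      and g: "\<forall>i<llen (psnd (psnd e)). lmem (fwf (lnth (psnd (psnd e)) i)) M"
    obtain f where f: "encode f = pfst (psnd e)" using IH f by blast
    have "\<forall>i<llen (psnd (psnd e)). \<exists>p. encode p = lnth (psnd (psnd e)) i" using IH g by blast
    then obtain q where q: "\<And>i. i < llen (psnd (psnd e)) \<Longrightarrow> encode (q i) = lnth (psnd (psnd e)) i" by metis
    have "encode (Comp f (map q [0..<llen (psnd (psnd e))])) = prod_encode (4, prod_encode (pfst (psnd e), psnd (psnd e)))"
      by (rule encode_Comp_pfst_psnd) (use f q in auto)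
    then show ?thesis using e e' 4 by metis
  next
    assume 5: "pfst e = 5" and f: "lmem (fwf (pfst (psnd e))) M" "lmem (fwf (psnd (psnd e))) M"
    then obtain p q where "encode p = pfst (psnd e)" "encode q = psnd (psnd e)" using IH by metis
    then have "encode (Prim p q) = e" using e e' 5 by (metis encode.simps(6))
    then show ?thesis by blast
  next
    assume 6: "pfst e = 6" and f: "lmem (fwf (psnd e)) M"
    then obtain p where "encode p = psnd e" using IH by metis
    then have "encode (Mu p) = e" using e 6 by (metis encode.simps(7))
    then show ?thesis by blast
  qed (metis encode_tags)+
qed

lemma ev_step_sound:
  assumes W: "\<And>e. lmem (fwf e) M \<Longrightarrow> \<exists>p. encode p = e"
    and IH: "\<And>e xs y. lmem (fev e xs y) M \<Longrightarrow> phi X e (list_decode xs) y"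
    and s: "ev_step e xs y M"
    and o: "e = prod_encode (3, 0) \<Longrightarrow> (y = 1 \<longleftrightarrow> lhd xs \<in> X)"
  shows "phi X e (list_decode xs) y"
proof -
  have e: "e = prod_encode (pfst e, psnd e)" by simp
  have e': "psnd e = prod_encode (pfst (psnd e), psnd (psnd e))" by simp
  from s[unfolded ev_step_def] show ?thesis
  proof (elim disjE conjE)
    assume "e = prod_encode (0, 0)" "y = 0"
    then show ?thesis by (auto simp flip: encode_tags intro: eval.zero)
  next
    assume "e = prod_encode (1, 0)" "xs \<noteq> 0" "y = Suc (lhd xs)"
    then have "e = encode Succ" "eval X Succ (list_decode xs) y"
      by (simp_all only: encode_tags eval_lcons eval.succ not_False_eq_True)
    then show ?thesis by (simp only: phi_encode)
  next
    assume *: "pfst e = 2" "psnd e < llen xs" "y = lnth xs (psnd e)"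
    then have "encode (Proj (psnd e)) = e" using e by (metis encode.simps(3))
    moreover have "eval X (Proj (psnd e)) (list_decode xs) y"
      using * eval.proj[of "psnd e" "list_decode xs"] by (simp add: lnth_eq_nth llen_def)
    ultimately show ?thesis unfolding phi_def by blast
  next
    assume *: "e = prod_encode (3, 0)" "xs \<noteq> 0" "y \<le> 1"
    then have "eval X Orc (list_decode xs) (if lhd xs \<in> X then 1 else 0)"
      by (simp only: eval_lcons eval.orc not_False_eq_True)
    moreover have "y = (if lhd xs \<in> X then 1 else 0)" using * o by auto
    ultimately show ?thesis using * by (simp flip: encode_tags)
  next
    let ?f = "pfst (psnd e)" and ?gs = "psnd (psnd e)"
    assume 4: "pfst e = 4" and "comp_step ?f ?gs xs y M"
    then obtain ys where f: "lmem (fev ?f ys y) M" and l: "llen ys = llen ?gs"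
      and g: "\<forall>i<llen ?gs. lmem (fev (lnth ?gs i) xs (lnth ys i)) M"
      unfolding comp_step_def by blast
    from IH[OF f] obtain f where f: "encode f = ?f" "eval X f (list_decode ys) y"
      unfolding phi_def by blast
    have "\<forall>i<llen ?gs. \<exists>q. encode q = lnth ?gs i \<and> eval X q (list_decode xs) (lnth ys i)"
      using g IH unfolding phi_def by blast
    then obtain q where q: "\<And>i. i < llen ?gs \<Longrightarrow> encode (q i) = lnth ?gs i"
      "\<And>i. i < llen ?gs \<Longrightarrow> eval X (q i) (list_decode xs) (lnth ys i)" by metis
    have "encode (Comp f (map q [0..<llen ?gs])) = prod_encode (4, prod_encode (?f, ?gs))"
      by (rule encode_Comp_pfst_psnd) (use f q in auto)
    then have "encode (Comp f (map q [0..<llen ?gs])) = e" using e e' 4 by metis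
    moreover have "eval X (Comp f (map q [0..<llen ?gs])) (list_decode xs) y"
    proof (rule eval.comp[OF _ _ f(2)])
      show "\<forall>i<length (map q [0..<llen ?gs]). eval X (map q [0..<llen ?gs] ! i) (list_decode xs) (list_decode ys ! i)"
        using q(2) l by (simp add: lnth_eq_nth)
    qed (use l in \<open>simp add: llen_def\<close>)
    ultimately show ?thesis unfolding phi_def by blast
  next
    let ?f = "pfst (psnd e)" and ?g = "psnd (psnd e)"
    assume 5: "pfst e = 5" and p: "prim_step e ?f ?g xs y M"
    have xs: "list_decode xs = lhd xs # list_decode (ltl xs)"
      using p eval_lcons unfolding prim_step_def by blast
    show ?thesis
    proof (cases "lhd xs = 0")
      case True
      then obtain f g where "encode f = ?f" "eval X f (list_decode (ltl xs)) y" "encode g = ?g"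
        using p W IH unfolding prim_step_def phi_def by metis
      then have "encode (Prim f g) = e" "eval X (Prim f g) (list_decode xs) y"
        using e e' 5 xs True eval.prim0 by (metis encode.simps(6))+
      then show ?thesis unfolding phi_def by blast
    next
      case False
      let ?n = "lhd xs - 1"
      from False p obtain r where
        r: "lmem (fev e (lcons ?n (ltl xs)) r) M" "lmem (fev ?g (lcons ?n (lcons r (ltl xs))) y) M"
        unfolding prim_step_def by auto
      obtain q where q: "encode q = e" "eval X q (?n # list_decode (ltl xs)) r"
        using IH[OF r(1)] unfolding phi_def by auto
      obtain g where g: "encode g = ?g" "eval X g (?n # r # list_decode (ltl xs)) y"
        using IH[OF r(2)] unfolding phi_def by auto
      \<comment> \<open>The first fact yields some program with code \<open>e\<close>. Its tag 5
        forces it to be a \<open>Prim\<close>, and injectivity of the coding identifies its step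
        program with the one supplied by the second fact.\<close>
      from q(1) 5 obtain f g' where q': "q = Prim f g'" by (cases q) auto
      then have "encode g' = ?g" using q(1) by auto
      then have "g' = g" using g(1) encode_inj by simp
      then have "eval X q (Suc ?n # list_decode (ltl xs)) y"
        using q(2) g(2) q' by (auto intro: eval.primS)
      then show ?thesis using q(1) xs False unfolding phi_def by auto
    qed
  next
    let ?f = "psnd e"
    assume 6: "pfst e = 6" and p: "mu_step ?f xs y M"
    then have "lmem (fev ?f (lcons y xs) 0) M" unfolding mu_step_def by blast
    from IH[OF this] obtain f where f: "encode f = ?f" "eval X f (y # list_decode xs) 0"
      unfolding phi_def by auto
    have "\<exists>k. eval X f (m # list_decode xs) (Suc k)" if m: "m < y" for m
    proof -
      obtain r where "lmem (fev ?f (lcons m xs) r) M" "r \<noteq> 0"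
        using p m unfolding mu_step_def by blast
      then have "phi X (encode f) (m # list_decode xs) r" "\<exists>k. r = Suc k"
        using IH[of ?f "lcons m xs" r] f(1) not0_implies_Suc by simp_all
      then show ?thesis by auto
    qed
    then have "eval X (Mu f) (list_decode xs) y" using f(2) by (auto intro: eval.mu)
    moreover have "encode (Mu f) = e" using e 6 f(1) by (metis encode.simps(7))
    ultimately show ?thesis unfolding phi_def by blast
  qed
qed

text \<open>Every entry rests on later ones, so induction over the list code meets each fact after
  its premises. Both kinds of facts are treated together because an evaluation step may use a fact
  \<open>fwf\<close>.\<close>

lemma cert_sound:
  assumes "valid c" "oracle_ok X c"
  shows "(lmem (fwf e) c \<longrightarrow> (\<exists>p. encode p = e)) \<and> (lmem (fev e xs y) c \<longrightarrow> phi X e (list_decode xs) y)"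
  using assms
proof (induction c arbitrary: e xs y rule: list_code_induct)
  case (Cons a c)
  then have s: "step a c" and v: "valid c" and o: "oracle_ok X c"
    and oa: "pfst a = 1 \<Longrightarrow> fprog a = prod_encode (3, 0) \<Longrightarrow> (fres a = 1 \<longleftrightarrow> lhd (farg a) \<in> X)"
    by (auto simp: oracle_ok_lcons)
  note IH = Cons.IH[OF v o]
  have "\<exists>p. encode p = e" if "a = fwf e"
    using s that IH wf_step_sound[of c e] unfolding step_def by auto
  moreover have "phi X e (list_decode xs) y" if "a = fev e xs y"
    using s that IH ev_step_sound[of c X e xs y] oa unfolding step_def by auto
  ultimately show ?case using IH by auto
qed simp

section \<open>Every computation has a certificate\<close>

lemma wf_step_mono: "wf_step e M \<Longrightarrow> (\<And>h. lmem h M \<Longrightarrow> lmem h N) \<Longrightarrow> wf_step e N"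
  unfolding wf_step_def by auto

lemma ev_step_mono: "ev_step e xs y M \<Longrightarrow> (\<And>h. lmem h M \<Longrightarrow> lmem h N) \<Longrightarrow> ev_step e xs y N"
  unfolding ev_step_def comp_step_def prim_step_def mu_step_def
  by (elim disjE; simp split: if_splits; metis)

lemma step_mono: "step f M \<Longrightarrow> (\<And>h. lmem h M \<Longrightarrow> lmem h N) \<Longrightarrow> step f N"
  unfolding step_def using wf_step_mono ev_step_mono by blast

definition lapp :: "nat \<Rightarrow> nat \<Rightarrow> nat" where
  "lapp a b = list_encode (list_decode a @ list_decode b)"

lemma lapp_simps [simp]: "lapp 0 b = b" "lapp (lcons x a) b = lcons x (lapp a b)"
  "lmem h (lapp a b) \<longleftrightarrow> lmem h a \<or> lmem h b"
  by (auto simp: lapp_def lmem_def lcons_def)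

text \<open>A step asks only for members of the remaining list and survives its extension. Hence the
  certificates of several premises can be joined by concatenation.\<close>

lemma valid_lapp: "valid a \<Longrightarrow> valid b \<Longrightarrow> valid (lapp a b)"
  by (induction a rule: list_code_induct) (auto intro: step_mono)

lemma oracle_ok_lapp: "oracle_ok X a \<Longrightarrow> oracle_ok X b \<Longrightarrow> oracle_ok X (lapp a b)"
  unfolding oracle_ok_def by auto

definition certified :: "nat set \<Rightarrow> nat \<Rightarrow> bool" where
  "certified X f \<longleftrightarrow> (\<exists>c. valid c \<and> oracle_ok X c \<and> lmem f c)"

lemma certified_all:
  "(\<forall>f\<in>set fs. certified X f) \<Longrightarrow> \<exists>c. valid c \<and> oracle_ok X c \<and> (\<forall>f\<in>set fs. lmem f c)"
proof (induction fs)
  case (Cons f fs)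
  then obtain c d where "valid c" "oracle_ok X c" "\<forall>f\<in>set fs. lmem f c"
    "valid d" "oracle_ok X d" "lmem f d" unfolding certified_def by auto
  then show ?case by (intro exI[of _ "lapp d c"]) (simp add: valid_lapp oracle_ok_lapp)
qed (auto intro: exI[of _ 0])

lemma certified_step:
  assumes "\<forall>f\<in>set fs. certified X f" and "\<And>c. \<forall>f\<in>set fs. lmem f c \<Longrightarrow> step h c"
    and "pfst h = 1 \<Longrightarrow> fprog h = prod_encode (3, 0) \<Longrightarrow> (fres h = 1 \<longleftrightarrow> lhd (farg h) \<in> X)"
  shows "certified X h"
proof -
  obtain c where "valid c" "oracle_ok X c" "\<forall>f\<in>set fs. lmem f c" using certified_all[OF assms(1)] by blast
  then show ?thesis unfolding certified_def
    using assms(2,3) by (intro exI[of _ "lcons h c"]) (simp add: oracle_ok_lcons)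
qed

lemma lnth_list_encode: "i < length xs \<Longrightarrow> lnth (list_encode xs) i = xs ! i"
  by (simp add: lnth_eq_nth llen_def)

lemma llen_list_encode [simp]: "llen (list_encode xs) = length xs"
  by (simp add: llen_def)

lemma certified_wf: "certified X (fwf (encode p))"
proof (induction p)
  case (Comp f gs)
  show ?case
    by (rule certified_step[of "fwf (encode f) # map (\<lambda>g. fwf (encode g)) gs"])
      (use Comp in \<open>auto simp: step_def wf_step_def lnth_list_encode\<close>)
next
  case (Prim f g)
  show ?case
    by (rule certified_step[of "[fwf (encode f), fwf (encode g)]"])
      (use Prim in \<open>auto simp: step_def wf_step_def\<close>)
next
  case (Mu f)
  show ?case
    by (rule certified_step[of "[fwf (encode f)]"])
      (use Mu in \<open>auto simp: step_def wf_step_def\<close>)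
qed (rule certified_step[of "[]"]; simp add: step_def wf_step_def)+

lemma certified_eval: "eval X p xs y \<Longrightarrow> certified X (fev (encode p) (list_encode xs) y)"
proof (induction rule: eval.induct)
  case (comp ys gs xs f y)
  let ?fs = "fev (encode f) (list_encode ys) y #
    map (\<lambda>i. fev (encode (gs ! i)) (list_encode xs) (ys ! i)) [0..<length gs]"
  show ?case
  proof (rule certified_step[of ?fs])
    fix c assume c: "\<forall>f\<in>set ?fs. lmem f c"
    have "comp_step (encode f) (list_encode (map encode gs)) (list_encode xs) y c"
      unfolding comp_step_def
      by (rule exI[of _ "list_encode ys"])
        (use c comp.hyps in \<open>auto simp: lnth_list_encode\<close>)
    then show "step (fev (encode (Comp f gs)) (list_encode xs) y) c"
      by (simp add: step_def ev_step_def)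
  qed (use comp in auto)
next
  case (prim0 f xs y g)
  show ?case
    by (rule certified_step[of "[fev (encode f) (list_encode xs) y, fwf (encode g)]"])
      (use prim0 certified_wf in \<open>auto simp: step_def ev_step_def prim_step_def simp flip: lcons_encode\<close>)
next
  case (primS f g n xs r y)
  let ?fs = "[fev (encode (Prim f g)) (list_encode (n # xs)) r, fev (encode g) (list_encode (n # r # xs)) y]"
  show ?case
  proof (rule certified_step[of ?fs])
    fix c assume c: "\<forall>f\<in>set ?fs. lmem f c"
    have "prim_step (encode (Prim f g)) (encode f) (encode g) (lcons (Suc n) (list_encode xs)) y c"
      unfolding prim_step_def
      using c by (auto simp: lcons_def intro!: exI[of _ r])
    then show "step (fev (encode (Prim f g)) (list_encode (Suc n # xs)) y) c"
      by (simp add: step_def ev_step_def lcons_def)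
  qed (use primS in auto)
next
  case (mu f n xs)
  then obtain k where k: "\<And>m. m < n \<Longrightarrow> certified X (fev (encode f) (list_encode (m # xs)) (Suc (k m)))"
    by metis
  let ?fs = "fev (encode f) (list_encode (n # xs)) 0 #
    map (\<lambda>m. fev (encode f) (list_encode (m # xs)) (Suc (k m))) [0..<n]"
  show ?case
  proof (rule certified_step[of ?fs])
    fix c assume c: "\<forall>f\<in>set ?fs. lmem f c"
    have "\<exists>r. lmem (fev (encode f) (lcons m (list_encode xs)) r) c \<and> r \<noteq> 0" if "m < n" for m
      using c that by (intro exI[of _ "Suc (k m)"]) auto
    then have "mu_step (encode f) (list_encode xs) n c"
      unfolding mu_step_def using c by auto
    then show "step (fev (encode (Mu f)) (list_encode xs) n) c"
      by (simp add: step_def ev_step_def)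
  qed (use mu k in auto)
next
  case (orc x xs)
  show ?case
    by (rule certified_step[of "[]"]) (auto simp: step_def ev_step_def simp flip: lcons_encode)
qed (rule certified_step[of "[]"]; simp add: step_def ev_step_def lnth_list_encode flip: lcons_encode)+

text \<open>This takes the place of Kleene's normal form: for the empty oracle the matrix is
  decidable, and for other oracles only \<open>oracle_ok\<close> depends on
  \<open>X\<close>.\<close>

theorem phi_iff_cert:
  "phi X e (list_decode xs) y \<longleftrightarrow> (\<exists>c. valid c \<and> oracle_ok X c \<and> lmem (fev e xs y) c)"
proof
  assume "phi X e (list_decode xs) y"
  then show "\<exists>c. valid c \<and> oracle_ok X c \<and> lmem (fev e xs y) c"
    using certified_eval[of X _ "list_decode xs" y] unfolding phi_def certified_def by auto
qed (use cert_sound in blast)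

section \<open>The halting set\<close>

lemma cp_oracle_ok_empty: "cf X f \<Longrightarrow> cp X (\<lambda>x. oracle_ok {} (f x))"
  by (rule cp_comp[where P = "oracle_ok {}"]) (unfold oracle_ok_def empty_iff, intro cert_rules)

lemma phi_list_encode_iff:
  "phi X e xs y \<longleftrightarrow> (\<exists>c. valid c \<and> oracle_ok X c \<and> lmem (fev e (list_encode xs) y) c)"
  using phi_iff_cert[of X e "list_encode xs" y] by simp

text \<open>The conjunct \<open>True\<close> brings the body into the shape of the closure rule
  \<open>cp_ex_fev_res\<close>.\<close>

definition halt_wit :: "nat \<Rightarrow> nat \<Rightarrow> bool" where
  "halt_wit e c \<longleftrightarrow> valid c \<and> oracle_ok {} c \<and> (\<exists>r. lmem (fev e (lcons e 0) r) c \<and> True)"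

lemma halting_set_iff: "e \<in> halting_set \<longleftrightarrow> (\<exists>c. halt_wit e c)"
proof -
  have "lcons e 0 = list_encode [e]" by (simp add: lcons_def)
  then show ?thesis
    unfolding halting_set_def phi_list_encode_iff halt_wit_def by auto
qed

lemma cp_halt_wit: "cf X f \<Longrightarrow> cf X g \<Longrightarrow> cp X (\<lambda>x. halt_wit (f x) (g x))"
  by (rule cp_comp2[where P = halt_wit])
    (unfold halt_wit_def, intro cert_rules cp_valid cp_oracle_ok_empty)

lemma semidecidable_prog:
  assumes "cp {} (\<lambda>z. P (pfst z) (psnd z))"
  obtains r where "\<And>x. (\<exists>y. eval {} r [x] y) \<longleftrightarrow> (\<exists>s. P s x)"
proof -
  obtain pp where pp: "\<And>x y. eval {} pp [x, y] (prod_encode (x, y))"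
    using eval_pair_prog by blast
  from cp_not[OF assms] obtain q where q: "\<And>z. eval {} q [z] (of_bool (\<not> P (pfst z) (psnd z)))"
    unfolding cp_def cf_def by blast
  have e: "eval {} (Comp q [pp]) [n, x] (of_bool (\<not> P n x))" for n x
    using q[of "prod_encode (n, x)"] by (intro eval_Comp1[OF pp]) simp
  have "(\<exists>y. eval {} (Mu (Comp q [pp])) [x] y) \<longleftrightarrow> (\<exists>s. P s x)" for x
  proof
    assume "\<exists>y. eval {} (Mu (Comp q [pp])) [x] y"
    then obtain y where "eval {} (Comp q [pp]) [y, x] 0" by (auto elim: eval_MuE)
    then have "of_bool (\<not> P y x) = (0::nat)" using e eval_det by blast
    then show "\<exists>s. P s x" by auto
  next
    assume "\<exists>s. P s x"
    then show "\<exists>y. eval {} (Mu (Comp q [pp])) [x] y" using eval_Mu_least[of "{}" "Comp q [pp]" "[x]" "\<lambda>n. P n x"] e by blast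
  qed
  then show ?thesis by (rule that)
qed

text \<open>Decidability would give a program halting exactly on the numbers outside
  \<open>halting_set\<close>, which contradicts itself on its own code. The search variable of that
  program is a dummy.\<close>

lemma halting_set_undecidable: "\<not> cp {} (\<lambda>e. e \<in> halting_set)"
proof
  assume "cp {} (\<lambda>e. e \<in> halting_set)"
  then have *: "cp {} (\<lambda>z. psnd z \<notin> halting_set)"
    by (rule cp_not[OF cp_comp[OF _ cf_psnd[OF cf_id]]])
  obtain r where "\<And>x. (\<exists>y. eval {} r [x] y) \<longleftrightarrow> (\<exists>s::nat. x \<notin> halting_set)"
    by (rule semidecidable_prog[of "\<lambda>s x. x \<notin> halting_set", OF *]) blast
  from this[of "encode r"] halting_set_encode[of r] show False by blast
qed

lemma cf_encode_const_prog: "cf X f \<Longrightarrow> cf X (\<lambda>x. encode (const_prog (f x)))"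
proof -
  have "encode (const_prog n) = rec_nat (encode Zero)
      (\<lambda>n r. prod_encode (4, prod_encode (encode Succ, lcons r 0))) n" for n
    by (induction n) (auto simp: lcons_def)
  moreover assume "cf X f"
  ultimately show ?thesis by (auto intro!: cf_rec c_rules simp del: encode.simps)
qed

text \<open>With x wired in by \<open>const_prog\<close>, the searching program ignores its input.
  It therefore halts on its own code iff the search for x succeeds, and a single query to the oracle
  decides this.\<close>

lemma cp_halting_set_semidecidable:
  assumes "cp {} (\<lambda>z. P (pfst z) (psnd z))"
  shows "cp halting_set (\<lambda>x. \<exists>s. P s x)"
proof -
  obtain r where r: "\<And>x. (\<exists>y. eval {} r [x] y) \<longleftrightarrow> (\<exists>s. P s x)"
    using semidecidable_prog[OF assms] by blast
  let ?f = "\<lambda>x. encode (Comp r [const_prog x])"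
  have "(\<exists>s. P s x) \<longleftrightarrow> ?f x \<in> halting_set" for x
  proof -
    have "(\<exists>y. eval {} (Comp r [const_prog x]) xs y) \<longleftrightarrow> (\<exists>y. eval {} r [x] y)" for xs
    proof
      assume "\<exists>y. eval {} (Comp r [const_prog x]) xs y"
      then obtain ys y where y: "length ys = 1" "eval {} (const_prog x) xs (ys ! 0)" "eval {} r ys y"
        by (auto elim!: eval_CompE)
      then have "ys = [x]" using eval_const_prog eval_det by (cases ys) force+
      then show "\<exists>y. eval {} r [x] y" using y by blast
    qed (meson eval_Comp1 eval_const_prog)
    then show ?thesis unfolding halting_set_encode r[symmetric] by blast
  qed
  moreover have "cf {} ?f"
    unfolding encode.simps list.map by (intro cf_list_encode_Cons c_rules cf_encode_const_prog)
  ultimately show ?thesis using cp_mem_oracle[OF cf_oracle, of ?f halting_set] by simp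
qed

lemma smn_decidable:
  assumes "cp {} (\<lambda>z. P (pfst z) (pfst (psnd z)) (psnd (psnd z)))"
  obtains f where "cf {} f" "\<And>n x y. phi {} (f n) [x, y] (if P n x y then 1 else 0)"
proof -
  obtain pp where pp: "\<And>x y. eval {} pp [x, y] (prod_encode (x, y))"
    using eval_pair_prog by blast
  obtain q where q: "\<And>z. eval {} q [z] (of_bool (P (pfst z) (pfst (psnd z)) (psnd (psnd z))))"
    using assms unfolding cp_def cf_def by blast
  let ?f = "\<lambda>n. encode (Comp q [Comp pp [const_prog n, pp]])"
  have "cf {} ?f"
    unfolding encode.simps list.map by (intro cf_list_encode_Cons c_rules cf_encode_const_prog)
  moreover have "phi {} (?f n) [x, y] (if P n x y then 1 else 0)" for n x y
    using q[of "prod_encode (n, prod_encode (x, y))"]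
      eval_Comp1[OF eval_Comp2[OF eval_const_prog pp pp], of q n x y]
    by (simp add: of_bool_def del: encode.simps)
  ultimately show ?thesis by (rule that)
qed

section \<open>A set not computable from the halting set\<close>

definition diag_set :: "nat set" where
  "diag_set = {e. phi halting_set e [e] 0}"

lemma diag_set_not_computable: "\<not> cp halting_set (\<lambda>e. e \<in> diag_set)"
proof
  assume "cp halting_set (\<lambda>e. e \<in> diag_set)"
  then obtain p where p: "\<And>x. eval halting_set p [x] (of_bool (x \<in> diag_set))"
    unfolding cp_def cf_def by blast
  then have "encode p \<in> diag_set \<longleftrightarrow> eval halting_set p [encode p] 0"
    by (simp add: diag_set_def)
  then show False using p[of "encode p"] eval_det[OF p[of "encode p"], of 0] by auto
qed

text \<open>\<open>z\<close> pairs a certificate with a bound below which the positively answered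
  queries have halting witnesses; \<open>u\<close> is tried as a halting witness against the
  negative answers. Quantifying over all \<open>u\<close> makes every recorded answer correct for
  the halting set.\<close>

definition diag_wit :: "nat \<Rightarrow> nat \<Rightarrow> nat \<Rightarrow> bool" where
  "diag_wit e z u \<longleftrightarrow> valid (pfst z) \<and> lmem (fev e (lcons e 0) 0) (pfst z) \<and>
     (\<forall>f. lmem f (pfst z) \<longrightarrow> pfst f = 1 \<and> fprog f = prod_encode (3, 0) \<longrightarrow>
        (if fres f = 1 then \<exists>s<psnd z. halt_wit (lhd (farg f)) s else \<not> halt_wit (lhd (farg f)) u))"

lemma cp_diag_wit: "cp X (\<lambda>z. diag_wit (pfst z) (pfst (psnd z)) (psnd (psnd z)))"
  unfolding diag_wit_def by (intro cert_rules cp_valid cp_halt_wit)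

lemma diag_set_iff: "e \<in> diag_set \<longleftrightarrow> (\<exists>z. \<forall>u. diag_wit e z u)"
proof
  assume "e \<in> diag_set"
  then obtain c where c: "valid c" "oracle_ok halting_set c" "lmem (fev e (lcons e 0) 0) c"
    unfolding diag_set_def mem_Collect_eq phi_list_encode_iff by (auto simp: lcons_def)
  let ?A = "{f. lmem f c \<and> lhd (farg f) \<in> halting_set}"
  have "\<forall>f\<in>?A. \<exists>s. halt_wit (lhd (farg f)) s" by (auto simp: halting_set_iff)
  then obtain w where w: "\<And>f. f \<in> ?A \<Longrightarrow> halt_wit (lhd (farg f)) (w f)" by metis
  \<comment> \<open>A certificate has finitely many entries, so one bound covers a halting witness
    for each query that has one.\<close>
  have "finite (w ` ?A)" by (simp add: lmem_def)
  then obtain t where t: "\<And>f. f \<in> ?A \<Longrightarrow> w f < t"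
    by (metis finite_nat_set_iff_bounded image_eqI)
  have "diag_wit e (prod_encode (c, t)) u" for u
  proof -
    have "if fres f = 1 then \<exists>s<t. halt_wit (lhd (farg f)) s else \<not> halt_wit (lhd (farg f)) u"
      if f: "lmem f c" "pfst f = 1" "fprog f = prod_encode (3, 0)" for f
    proof -
      have *: "fres f = 1 \<longleftrightarrow> lhd (farg f) \<in> halting_set" using c(2) f unfolding oracle_ok_def by blast
      show ?thesis
      proof (cases "fres f = 1")
        case True
        then have "f \<in> ?A" using f(1) * by blast
        then show ?thesis using True w t by auto
      next
        case False
        then show ?thesis using * halting_set_iff by auto
      qed
    qed
    then show ?thesis unfolding diag_wit_def pfst_pair psnd_pair using c by blast
  qed
  then show "\<exists>z. \<forall>u. diag_wit e z u" by blast
next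
  assume "\<exists>z. \<forall>u. diag_wit e z u"
  then obtain z where z: "\<And>u. diag_wit e z u" by blast
  have "oracle_ok halting_set (pfst z)"
    unfolding oracle_ok_def
  proof (intro allI impI)
    fix f assume f: "lmem f (pfst z)" "pfst f = 1 \<and> fprog f = prod_encode (3, 0)"
    then have "if fres f = 1 then \<exists>s<psnd z. halt_wit (lhd (farg f)) s else \<not> halt_wit (lhd (farg f)) u" for u
      using z unfolding diag_wit_def by blast
    then show "fres f = 1 \<longleftrightarrow> lhd (farg f) \<in> halting_set"
      unfolding halting_set_iff by (metis (full_types))
  qed
  then show "e \<in> diag_set"
    using z[of 0] unfolding diag_set_def mem_Collect_eq phi_list_encode_iff diag_wit_def
    by (auto simp: lcons_def)
qed

section \<open>The arithmetical hierarchy\<close>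

text \<open>The negation inside the recursion spares a mutual definition with the dual classes: if
  \<open>Q\<close> is \<open>\<Sigma>\<^sub>k\<close>, then \<open>\<not> Q\<close> is
  \<open>\<Pi>\<^sub>k\<close>.\<close>

fun Sg :: "nat \<Rightarrow> (nat \<Rightarrow> bool) \<Rightarrow> bool" where
  "Sg 0 P \<longleftrightarrow> cp {} P"
| "Sg (Suc k) P \<longleftrightarrow> (\<exists>Q. Sg k Q \<and> (\<forall>x. P x \<longleftrightarrow> (\<exists>y. \<not> Q (prod_encode (x, y)))))"

definition Pg :: "nat \<Rightarrow> (nat \<Rightarrow> bool) \<Rightarrow> bool" where
  "Pg k P \<longleftrightarrow> Sg k (\<lambda>x. \<not> P x)"

lemma Sg_Suc_iff: "Sg (Suc k) P \<longleftrightarrow> (\<exists>Q. Pg k Q \<and> (\<forall>x. P x \<longleftrightarrow> (\<exists>y. Q (prod_encode (x, y)))))"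
  unfolding Pg_def Sg.simps
  by (rule iffI; elim exE; rule_tac x = "\<lambda>x. \<not> Q x" in exI) auto

lemma Pg_Suc_iff: "Pg (Suc k) P \<longleftrightarrow> (\<exists>Q. Sg k Q \<and> (\<forall>x. P x \<longleftrightarrow> (\<forall>y. Q (prod_encode (x, y)))))"
proof -
  have "(\<not> p \<longleftrightarrow> (\<exists>y. \<not> q y)) \<longleftrightarrow> (p \<longleftrightarrow> (\<forall>y. q y))" for p and q :: "nat \<Rightarrow> bool" by blast
  then show ?thesis unfolding Pg_def Sg.simps by simp
qed

lemma Pg_0: "Pg 0 P \<longleftrightarrow> cp {} P"
  unfolding Pg_def Sg.simps using cp_not[of "{}" P] cp_not[of "{}" "\<lambda>x. \<not> P x"] by auto

text \<open>Each class is built from the dual class one level below, so both are carried through one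
  induction.\<close>

lemma SPg_subst: "(Sg k P \<longrightarrow> cf {} f \<longrightarrow> Sg k (\<lambda>x. P (f x))) \<and> (Pg k P \<longrightarrow> cf {} f \<longrightarrow> Pg k (\<lambda>x. P (f x)))"
proof (induction k arbitrary: P f)
  case (Suc k)
  have f: "cf {} (\<lambda>x. prod_encode (f (pfst x), psnd x))" if "cf {} f"
    by (intro c_rules cf_comp[OF that])
  have "Sg (Suc k) (\<lambda>x. P (f x))" if *: "Sg (Suc k) P" "cf {} f"
  proof -
    obtain Q where Q: "Pg k Q" "\<And>x. P x \<longleftrightarrow> (\<exists>y. Q (prod_encode (x, y)))"
      using *(1) unfolding Sg_Suc_iff by blast
    have "Pg k (\<lambda>x. Q (prod_encode (f (pfst x), psnd x)))"
      using Suc[of Q "\<lambda>x. prod_encode (f (pfst x), psnd x)"] Q(1) f[OF *(2)] by blast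
    then show ?thesis unfolding Sg_Suc_iff
      by (intro exI[of _ "\<lambda>x. Q (prod_encode (f (pfst x), psnd x))"]) (simp add: Q(2))
  qed
  moreover have "Pg (Suc k) (\<lambda>x. P (f x))" if *: "Pg (Suc k) P" "cf {} f"
  proof -
    obtain Q where Q: "Sg k Q" "\<And>x. P x \<longleftrightarrow> (\<forall>y. Q (prod_encode (x, y)))"
      using *(1) unfolding Pg_Suc_iff by blast
    have "Sg k (\<lambda>x. Q (prod_encode (f (pfst x), psnd x)))"
      using Suc[of Q "\<lambda>x. prod_encode (f (pfst x), psnd x)"] Q(1) f[OF *(2)] by blast
    then show ?thesis unfolding Pg_Suc_iff
      by (intro exI[of _ "\<lambda>x. Q (prod_encode (f (pfst x), psnd x))"]) (simp add: Q(2))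
  qed
  ultimately show ?case by blast
qed (auto simp: Pg_0 cp_comp)

lemma Sg_subst: "Sg k P \<Longrightarrow> cf {} f \<Longrightarrow> Sg k (\<lambda>x. P (f x))"
  and Pg_subst: "Pg k P \<Longrightarrow> cf {} f \<Longrightarrow> Pg k (\<lambda>x. P (f x))"
  using SPg_subst[of k P f] by blast+

lemma Pg_imp_Sg_Suc: "Pg k P \<Longrightarrow> Sg (Suc k) P" and Sg_imp_Pg_Suc: "Sg k P \<Longrightarrow> Pg (Suc k) P"
  unfolding Sg_Suc_iff Pg_Suc_iff
  by (rule exI[of _ "\<lambda>x. P (pfst x)"]; simp add: Sg_subst Pg_subst c_rules)+

lemma SPg_Suc: "(Sg k P \<longrightarrow> Sg (Suc k) P) \<and> (Pg k P \<longrightarrow> Pg (Suc k) P)"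
proof (induction k arbitrary: P)
  case 0
  then show ?case using Pg_imp_Sg_Suc[of 0 P] Sg_imp_Pg_Suc[of 0 P] by (simp add: Pg_0)
next
  case (Suc k)
  have "Sg (Suc (Suc k)) P" if *: "Sg (Suc k) P"
  proof -
    obtain Q where "Pg k Q" "\<forall>x. P x \<longleftrightarrow> (\<exists>y. Q (prod_encode (x, y)))"
      using * unfolding Sg_Suc_iff by blast
    with Suc.IH[of Q] show ?thesis unfolding Sg_Suc_iff[of "Suc k"] by blast
  qed
  moreover have "Pg (Suc (Suc k)) P" if *: "Pg (Suc k) P"
  proof -
    obtain Q where "Sg k Q" "\<forall>x. P x \<longleftrightarrow> (\<forall>y. Q (prod_encode (x, y)))"
      using * unfolding Pg_Suc_iff by blast
    with Suc.IH[of Q] show ?thesis unfolding Pg_Suc_iff[of "Suc k"] by blast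
  qed
  ultimately show ?case by blast
qed

lemma Sg_Suc: "Sg k P \<Longrightarrow> Sg (Suc k) P" and Pg_Suc: "Pg k P \<Longrightarrow> Pg (Suc k) P"
  using SPg_Suc[of k P] by blast+

lemma Sg_ex: assumes "Sg (Suc k) (\<lambda>z. P (pfst z) (psnd z))" shows "Sg (Suc k) (\<lambda>x. \<exists>y. P x y)"
proof -
  obtain Q where Q: "Pg k Q" "\<And>z. P (pfst z) (psnd z) \<longleftrightarrow> (\<exists>y. Q (prod_encode (z, y)))"
    using assms unfolding Sg_Suc_iff by blast
  have "Pg k (\<lambda>z. Q (prod_encode (prod_encode (pfst z, pfst (psnd z)), psnd (psnd z))))"
    by (intro Pg_subst[OF Q(1)] c_rules)
  moreover have "(\<exists>y. P x y) \<longleftrightarrow> (\<exists>y. Q (prod_encode (prod_encode (x, pfst y), psnd y)))" for x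
  proof -
    have "P x y \<longleftrightarrow> (\<exists>w. Q (prod_encode (prod_encode (x, y), w)))" for y
      using Q(2)[of "prod_encode (x, y)"] by simp
    then show ?thesis by (metis pfst_pair psnd_pair)
  qed
  ultimately show ?thesis unfolding Sg_Suc_iff
    by (intro exI[of _ "\<lambda>z. Q (prod_encode (prod_encode (pfst z, pfst (psnd z)), psnd (psnd z)))"]) simp
qed

lemma Pg_all: "Pg (Suc k) (\<lambda>z. P (pfst z) (psnd z)) \<Longrightarrow> Pg (Suc k) (\<lambda>x. \<forall>y. P x y)"
  using Sg_ex[of k "\<lambda>x y. \<not> P x y"] unfolding Pg_def by simp

lemma Sg_ex_Pg: "Pg k (\<lambda>z. P (pfst z) (psnd z)) \<Longrightarrow> Sg (Suc k) (\<lambda>x. \<exists>y. P x y)"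
  by (rule Sg_ex[OF Pg_imp_Sg_Suc])

lemma Pg_all_Sg: "Sg k (\<lambda>z. P (pfst z) (psnd z)) \<Longrightarrow> Pg (Suc k) (\<lambda>x. \<forall>y. P x y)"
  by (rule Pg_all[OF Sg_imp_Pg_Suc])

text \<open>The negation between levels swaps the two connectives, so neither induction works alone.
  A conjunction pairs two witnesses, while a disjunction can share one.\<close>

lemma SPg_conj_disj:
  "(Sg k P \<longrightarrow> Sg k Q \<longrightarrow> Sg k (\<lambda>x. P x \<and> Q x) \<and> Sg k (\<lambda>x. P x \<or> Q x))"
proof (induction k arbitrary: P Q)
  case 0
  then show ?case by (simp add: cp_and cp_or)
next
  case (Suc k)
  have *: "Sg (Suc k) (\<lambda>x. P x \<and> Q x) \<and> Sg (Suc k) (\<lambda>x. P x \<or> Q x)" if P: "Sg (Suc k) P" and Q: "Sg (Suc k) Q"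
  proof -
    obtain P' Q' where P': "Sg k P'" "\<And>x. P x \<longleftrightarrow> (\<exists>y. \<not> P' (prod_encode (x, y)))"
      and Q': "Sg k Q'" "\<And>x. Q x \<longleftrightarrow> (\<exists>y. \<not> Q' (prod_encode (x, y)))"
      using P Q by auto
    have "Sg k (\<lambda>z. P' (prod_encode (pfst z, pfst (psnd z))) \<or> Q' (prod_encode (pfst z, psnd (psnd z))))"
      using Suc.IH Sg_subst[OF P'(1), of "\<lambda>z. prod_encode (pfst z, pfst (psnd z))"]
        Sg_subst[OF Q'(1), of "\<lambda>z. prod_encode (pfst z, psnd (psnd z))"] by (simp add: c_rules)
    moreover have "P x \<and> Q x \<longleftrightarrow> (\<exists>y. \<not> (P' (prod_encode (x, pfst y)) \<or> Q' (prod_encode (x, psnd y))))" for x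
      using P'(2) Q'(2) by (metis pfst_pair psnd_pair)
    ultimately have "Sg (Suc k) (\<lambda>x. P x \<and> Q x)"
      unfolding Sg.simps by (intro exI[of _ "\<lambda>z. P' (prod_encode (pfst z, pfst (psnd z))) \<or> Q' (prod_encode (pfst z, psnd (psnd z)))"]) simp
    moreover have "Sg (Suc k) (\<lambda>x. P x \<or> Q x)"
      unfolding Sg.simps using P' Q' Suc.IH by (intro exI[of _ "\<lambda>z. P' z \<and> Q' z"]) auto
    ultimately show ?thesis by blast
  qed
  then show ?case by blast
qed

lemma Sg_conj: "Sg k P \<Longrightarrow> Sg k Q \<Longrightarrow> Sg k (\<lambda>x. P x \<and> Q x)"
  and Sg_disj: "Sg k P \<Longrightarrow> Sg k Q \<Longrightarrow> Sg k (\<lambda>x. P x \<or> Q x)"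
  using SPg_conj_disj[of k P Q] by blast+

lemma Pg_conj: "Pg k P \<Longrightarrow> Pg k Q \<Longrightarrow> Pg k (\<lambda>x. P x \<and> Q x)"
  and Pg_disj: "Pg k P \<Longrightarrow> Pg k Q \<Longrightarrow> Pg k (\<lambda>x. P x \<or> Q x)"
  unfolding Pg_def using Sg_conj[of k "\<lambda>x. \<not> P x" "\<lambda>x. \<not> Q x"] Sg_disj[of k "\<lambda>x. \<not> P x" "\<lambda>x. \<not> Q x"]
  by simp_all

lemma Pg_not: "Sg k P \<Longrightarrow> Pg k (\<lambda>x. \<not> P x)"
  unfolding Pg_def by simp

lemma sigma4_iff: "sigma4 A \<longleftrightarrow> Sg 4 (\<lambda>n. n \<in> A)"
proof
  assume "sigma4 A"
  then obtain R where R: "cp {} (\<lambda>x. x \<in> R)"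
    and A: "\<And>n. n \<in> A \<longleftrightarrow> (\<exists>a. \<forall>b. \<exists>c. \<forall>d. list_encode [n, a, b, c, d] \<in> R)"
    unfolding sigma4_def computable_set_iff by blast
  let ?Q = "\<lambda>n a b c d. list_encode [n, a, b, c, d] \<in> R"
  have "cp {} (\<lambda>z. ?Q (pfst (pfst (pfst (pfst z)))) (psnd (pfst (pfst (pfst z)))) (psnd (pfst (pfst z)))
      (psnd (pfst z)) (psnd z))"
    unfolding list_encode.simps by (intro cp_comp[OF R] cf_arith)
  then have "Pg 1 (\<lambda>z. \<forall>d. ?Q (pfst (pfst (pfst z))) (psnd (pfst (pfst z))) (psnd (pfst z)) (psnd z) d)"
    unfolding One_nat_def by (intro Pg_all_Sg) simp
  then have "Sg 2 (\<lambda>z. \<exists>c. \<forall>d. ?Q (pfst (pfst z)) (psnd (pfst z)) (psnd z) c d)"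
    unfolding numeral_2_eq_2 by (intro Sg_ex_Pg) simp
  then have "Pg 3 (\<lambda>z. \<forall>b. \<exists>c. \<forall>d. ?Q (pfst z) (psnd z) b c d)"
    unfolding numeral_3_eq_3 by (intro Pg_all_Sg) (simp add: numeral_2_eq_2)
  then have "Sg (Suc 3) (\<lambda>z. \<exists>a. \<forall>b. \<exists>c. \<forall>d. ?Q z a b c d)"
    by (intro Sg_ex_Pg)
  then show "Sg 4 (\<lambda>n. n \<in> A)" using A by (simp add: numeral_eq_Suc)
next
  assume "Sg 4 (\<lambda>n. n \<in> A)"
  then have "Sg (Suc 3) (\<lambda>n. n \<in> A)" by (simp add: numeral_eq_Suc)
  then obtain Q1 where "Pg (Suc 2) Q1" and 1: "\<And>x. x \<in> A \<longleftrightarrow> (\<exists>y. Q1 (prod_encode (x, y)))"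
    unfolding Sg_Suc_iff by (auto simp: numeral_eq_Suc)
  then obtain Q2 where "Sg (Suc 1) Q2" and 2: "\<And>x. Q1 x \<longleftrightarrow> (\<forall>y. Q2 (prod_encode (x, y)))"
    unfolding Pg_Suc_iff by (auto simp: numeral_eq_Suc)
  then obtain Q3 where "Pg (Suc 0) Q3" and 3: "\<And>x. Q2 x \<longleftrightarrow> (\<exists>y. Q3 (prod_encode (x, y)))"
    unfolding Sg_Suc_iff by (auto simp: numeral_eq_Suc)
  then obtain Q4 where Q4: "cp {} Q4" and 4: "\<And>x. Q3 x \<longleftrightarrow> (\<forall>y. Q4 (prod_encode (x, y)))"
    unfolding Pg_Suc_iff by auto
  let ?R = "{l. Q4 (prod_encode (prod_encode (prod_encode (prod_encode (lnth l 0, lnth l 1), lnth l 2), lnth l 3), lnth l 4))}"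
  have "computable_set ?R"
    unfolding computable_set_iff mem_Collect_eq by (intro cp_comp[OF Q4] cf_arith)
  moreover have "list_encode [n, a, b, c, d] \<in> ?R \<longleftrightarrow>
      Q4 (prod_encode (prod_encode (prod_encode (prod_encode (n, a), b), c), d))" for n a b c d
    unfolding mem_Collect_eq by (subst lnth_list_encode, simp)+ (simp add: numeral_eq_Suc)
  ultimately show "sigma4 A"
    unfolding sigma4_def using 1 2 3 4 by (intro exI[of _ ?R]) simp
qed

section \<open>Embeddings of equivalence structures\<close>

text \<open>For sets of natural numbers this is the existence of an injection of \<open>A\<close>
  into \<open>B\<close>. Infinite sets are treated separately because their \<open>card\<close> is
  0.\<close>

definition fits :: "nat set \<Rightarrow> nat set \<Rightarrow> bool" where
  "fits A B \<longleftrightarrow> infinite B \<or> (finite A \<and> card A \<le> card B)"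

definition big :: "nat \<Rightarrow> nat set \<Rightarrow> bool" where
  "big k C \<longleftrightarrow> infinite C \<or> k \<le> card C"

text \<open>Infinitely many classes satisfy \<open>P\<close>: no finite set meets all of them.
  Phrased with elements instead of a quotient, the property is easily carried along embeddings and
  translated into arithmetic.\<close>

definition many :: "nat set \<Rightarrow> (nat \<times> nat) set \<Rightarrow> (nat set \<Rightarrow> bool) \<Rightarrow> bool" where
  "many U R P \<longleftrightarrow>
     (\<forall>F. finite F \<and> F \<subseteq> U \<longrightarrow> (\<exists>x\<in>U. P (R `` {x}) \<and> (\<forall>y\<in>F. (y, x) \<notin> R)))"

lemma equiv_reflD: "equiv A r \<Longrightarrow> x \<in> A \<Longrightarrow> (x, x) \<in> r"
  and equiv_symD: "equiv A r \<Longrightarrow> (x, y) \<in> r \<Longrightarrow> (y, x) \<in> r"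
  and equiv_transD: "equiv A r \<Longrightarrow> (x, y) \<in> r \<Longrightarrow> (y, z) \<in> r \<Longrightarrow> (x, z) \<in> r"
  and equiv_subset: "equiv A r \<Longrightarrow> r \<subseteq> A \<times> A"
  unfolding equiv_def by (auto dest: refl_onD symD transD)

lemma ex_nth_element:
  fixes B :: "nat set"
  assumes "infinite B \<or> k < card B"
  shows "\<exists>v\<in>B. card {u. u < v \<and> u \<in> B} = k"
  using assms
proof (induction k)
  case 0
  then have "\<exists>v. v \<in> B" by (metis card.empty ex_in_conv finite.emptyI less_nat_zero_code)
  then have "(LEAST v. v \<in> B) \<in> B" by (rule LeastI_ex)
  moreover have "{u. u < (LEAST v. v \<in> B) \<and> u \<in> B} = {}" using not_less_Least by auto
  ultimately show ?case by (metis card.empty)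
next
  case (Suc k)
  then obtain v where v: "v \<in> B" "card {u. u < v \<and> u \<in> B} = k" by auto
  have card: "card {u. u \<le> v \<and> u \<in> B} = Suc k"
  proof -
    have "{u. u \<le> v \<and> u \<in> B} = insert v {u. u < v \<and> u \<in> B}" using v by auto
    then show ?thesis using v by simp
  qed
  have "\<exists>w. w \<in> B \<and> v < w"
  proof (rule ccontr)
    assume "\<nexists>w. w \<in> B \<and> v < w"
    then have "B = {u. u \<le> v \<and> u \<in> B}" by (auto simp: not_less)
    then show False using card Suc.prems by (metis finite_Collect_conjI finite_Collect_le_nat less_irrefl)
  qed
  then have w: "(LEAST w. w \<in> B \<and> v < w) \<in> B \<and> v < (LEAST w. w \<in> B \<and> v < w)" by (rule LeastI_ex)
  have "{u. u < (LEAST w. w \<in> B \<and> v < w) \<and> u \<in> B} = {u. u \<le> v \<and> u \<in> B}"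
    using w not_less_Least[of _ "\<lambda>w. w \<in> B \<and> v < w"] by (fastforce simp: not_le)
  then show ?case using w card by metis
qed

text \<open>The coded lists \<open>rc\<close> and \<open>sc\<close> match finitely many classes by
  hand. For any other x, a number c with \<open>P x c\<close> names a class with enough room by
  \<open>pfst c\<close>, and its second component may carry evidence for this. \<open>P\<close> only
  has to be sufficient, so it can be decidable although class sizes are not.\<close>

locale class_matching =
  fixes V W :: "nat set" and S T :: "(nat \<times> nat) set" and rc sc :: nat and P :: "nat \<Rightarrow> nat \<Rightarrow> bool"
  assumes eqV: "equiv V S" and eqW: "equiv W T"
    and len: "llen rc = llen sc"
    and sc_distinct: "\<And>i j. i < llen sc \<Longrightarrow> j < llen sc \<Longrightarrow> (lnth sc i, lnth sc j) \<in> T \<Longrightarrow> i = j"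
    and rc_fits: "\<And>i. i < llen sc \<Longrightarrow> fits (S `` {lnth rc i}) (T `` {lnth sc i})"
    and available: "\<And>x F. x \<in> V \<Longrightarrow> \<not> (\<exists>i<llen rc. (lnth rc i, x) \<in> S) \<Longrightarrow> finite F \<Longrightarrow> F \<subseteq> W
      \<Longrightarrow> \<exists>c. pfst c \<in> W \<and> P x c \<and> (\<forall>y\<in>F. (y, pfst c) \<notin> T)"
    and P_fits: "\<And>x c. x \<in> V \<Longrightarrow> \<not> (\<exists>i<llen rc. (lnth rc i, x) \<in> S) \<Longrightarrow> P x c
      \<Longrightarrow> fits (S `` {x}) (T `` {pfst c})"
begin

definition special :: "nat \<Rightarrow> bool" where
  "special x \<longleftrightarrow> (\<exists>i<llen rc. (lnth rc i, x) \<in> S)"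

text \<open>The implication makes every number admissible for a special x or one outside
  \<open>V\<close>, so that the search is total. The arbitrary values picked for such x enter the
  history too and merely block finitely many further classes.\<close>

definition admissible :: "nat \<Rightarrow> nat \<Rightarrow> nat \<Rightarrow> bool" where
  "admissible c x l \<longleftrightarrow> (x \<in> V \<and> \<not> special x \<longrightarrow> pfst c \<in> W \<and> P x c \<and>
     (\<forall>i<llen sc. (lnth sc i, pfst c) \<notin> T) \<and> (\<forall>i<llen l. (pfst (lnth l i), pfst c) \<notin> T))"

definition history :: "nat \<Rightarrow> nat" where
  "history n = rec_nat 0 (\<lambda>n l. lcons (LEAST c. admissible c n l) l) n"

definition pick :: "nat \<Rightarrow> nat" where
  "pick n = (LEAST c. admissible c n (history n))"

definition target :: "nat \<Rightarrow> nat" where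
  "target x = (if special x then lnth sc (LEAST i. special x \<longrightarrow> i < llen rc \<and> (lnth rc i, x) \<in> S)
     else pfst (pick (LEAST y. x \<in> V \<longrightarrow> (y, x) \<in> S)))"

definition rank :: "nat \<Rightarrow> nat" where
  "rank x = card {y. y < x \<and> (y, x) \<in> S}"

text \<open>Within a class, elements are placed by their rank in the natural order. This is
  injective and needs no knowledge of the size of either class.\<close>

definition emb :: "nat \<Rightarrow> nat" where
  "emb x = (LEAST v. x \<in> V \<longrightarrow> (target x, v) \<in> T \<and> card {u. u < v \<and> (target x, u) \<in> T} = rank x)"

lemma S_refl: "x \<in> V \<Longrightarrow> (x, x) \<in> S" and T_refl: "x \<in> W \<Longrightarrow> (x, x) \<in> T"
  by (simp_all add: equiv_reflD[OF eqV] equiv_reflD[OF eqW])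

lemma S_sym: "(x, y) \<in> S \<Longrightarrow> (y, x) \<in> S" and T_sym: "(x, y) \<in> T \<Longrightarrow> (y, x) \<in> T"
  by (rule equiv_symD[OF eqV] equiv_symD[OF eqW], assumption)+

lemma S_trans: "(x, y) \<in> S \<Longrightarrow> (y, z) \<in> S \<Longrightarrow> (x, z) \<in> S"
  and T_trans: "(x, y) \<in> T \<Longrightarrow> (y, z) \<in> T \<Longrightarrow> (x, z) \<in> T"
  by (rule equiv_transD[OF eqV] equiv_transD[OF eqW], assumption+)+

lemmas SV = equiv_subset[OF eqV] and TW = equiv_subset[OF eqW]

lemma mem_V_iff: "x \<in> V \<longleftrightarrow> (x, x) \<in> S" and mem_W_iff: "x \<in> W \<longleftrightarrow> (x, x) \<in> T"
  using S_refl T_refl SV TW by auto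

lemma ex_admissible: "\<exists>c. admissible c x l"
proof (cases "x \<in> V \<and> \<not> special x")
  case True
  \<comment> \<open>Numbers outside \<open>W\<close> are related to nothing, so it suffices to avoid
    those in \<open>W\<close>, as \<open>available\<close> requires.\<close>
  let ?F = "(lnth sc ` {..<llen sc} \<union> (\<lambda>i. pfst (lnth l i)) ` {..<llen l}) \<inter> W"
  obtain c where c: "pfst c \<in> W" "P x c" "\<forall>y\<in>?F. (y, pfst c) \<notin> T"
    using available[of x ?F] True unfolding special_def by auto
  have "(y, pfst c) \<notin> T" if "y \<in> lnth sc ` {..<llen sc} \<union> (\<lambda>i. pfst (lnth l i)) ` {..<llen l}" for y
    using c(3) that TW by (cases "y \<in> W") auto
  then show ?thesis using c(1,2) unfolding admissible_def by (intro exI[of _ c]) auto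
qed (auto simp: admissible_def)

lemma admissible_pick: "admissible (pick x) x (history x)"
  unfolding pick_def by (rule LeastI_ex[OF ex_admissible])

lemma history_simps [simp]: "history 0 = 0" "history (Suc n) = lcons (pick n) (history n)"
  by (simp_all add: history_def pick_def)

lemma mem_history: "m < n \<Longrightarrow> \<exists>i<llen (history n). lnth (history n) i = pick m"
proof (induction n)
  case (Suc n)
  show ?case
  proof (cases "m = n")
    case True
    then show ?thesis by (auto intro!: exI[of _ 0])
  next
    case False
    with Suc obtain i where "i < llen (history n)" "lnth (history n) i = pick m" by auto
    then show ?thesis by (auto intro!: exI[of _ "Suc i"])
  qed
qed simp

lemma pick_props:
  assumes "x \<in> V" "\<not> special x"
  shows "pfst (pick x) \<in> W" "P x (pick x)" "i < llen sc \<Longrightarrow> (lnth sc i, pfst (pick x)) \<notin> T"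
    "y < x \<Longrightarrow> (pfst (pick y), pfst (pick x)) \<notin> T"
  using admissible_pick[of x] assms mem_history[of y x] unfolding admissible_def by auto

definition rep :: "nat \<Rightarrow> nat" where "rep x = (LEAST y. x \<in> V \<longrightarrow> (y, x) \<in> S)"

definition index :: "nat \<Rightarrow> nat" where
  "index x = (LEAST i. special x \<longrightarrow> i < llen rc \<and> (lnth rc i, x) \<in> S)"

lemma rep_rel: "x \<in> V \<Longrightarrow> (rep x, x) \<in> S"
  unfolding rep_def using LeastI[of "\<lambda>y. x \<in> V \<longrightarrow> (y, x) \<in> S" x] S_refl by auto

lemma index_rel: "special x \<Longrightarrow> index x < llen rc \<and> (lnth rc (index x), x) \<in> S"
proof -
  assume x: "special x"
  then have "\<exists>i. special x \<longrightarrow> i < llen rc \<and> (lnth rc i, x) \<in> S" unfolding special_def by blast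
  from LeastI_ex[OF this] x show ?thesis unfolding index_def by blast
qed

lemma special_cong: "(x, y) \<in> S \<Longrightarrow> special x \<longleftrightarrow> special y"
  unfolding special_def using S_trans S_sym by blast

lemma target_cong:
  assumes "(x, y) \<in> S" shows "target x = target y"
proof -
  have "(z, x) \<in> S \<longleftrightarrow> (z, y) \<in> S" for z using assms S_trans S_sym by blast
  moreover have "x \<in> V" "y \<in> V" using assms SV by auto
  ultimately show ?thesis unfolding target_def special_cong[OF assms] by simp
qed

lemma target_eq: "target x = (if special x then lnth sc (index x) else pfst (pick (rep x)))"
  unfolding target_def rep_def index_def ..

lemma target_inj:
  assumes x: "x \<in> V" and y: "y \<in> V" and "(target x, target y) \<in> T"
  shows "(x, y) \<in> S"
proof -
  have rV: "rep z \<in> V" if "z \<in> V" for z using rep_rel[OF that] SV by auto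
  have ns: "\<not> special (rep z)" if "z \<in> V" "\<not> special z" for z
    using rep_rel[OF that(1)] special_cong that(2) by blast
  show ?thesis
  proof (cases "special x"; cases "special y")
    assume s: "special x" "special y"
    then have "index x = index y"
      using assms(3) sc_distinct index_rel len unfolding target_eq by auto
    then show ?thesis using index_rel s S_sym S_trans by metis
  next
    assume "special x" "\<not> special y"
    then show ?thesis using assms(3) pick_props(3)[OF rV[OF y] ns[OF y]] index_rel len
      unfolding target_eq by auto
  next
    assume "\<not> special x" "special y"
    then show ?thesis using assms(3) pick_props(3)[OF rV[OF x] ns[OF x]] index_rel len T_sym
      unfolding target_eq by auto
  next
    assume s: "\<not> special x" "\<not> special y"
    then have t: "(pfst (pick (rep x)), pfst (pick (rep y))) \<in> T" using assms(3) unfolding target_eq by simp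
    have "rep x = rep y"
    proof (cases "rep x" "rep y" rule: linorder_cases)
      case less
      then show ?thesis using pick_props(4)[OF rV[OF y] ns[OF y s(2)]] t by blast
    next
      case greater
      then show ?thesis using pick_props(4)[OF rV[OF x] ns[OF x s(1)]] T_sym[OF t] by blast
    qed
    then show ?thesis using rep_rel[OF x] rep_rel[OF y] S_sym S_trans by metis
  qed
qed

lemma class_eq: "(x, y) \<in> S \<Longrightarrow> S `` {x} = S `` {y}"
  using S_sym S_trans by blast

lemma target_fits:
  assumes "x \<in> V" shows "fits (S `` {x}) (T `` {target x})"
proof (cases "special x")
  case True
  then show ?thesis using index_rel[OF True] rc_fits[of "index x"] len class_eq[of "lnth rc (index x)" x]
    unfolding target_eq by simp
next
  case False
  have r: "rep x \<in> V" "\<not> special (rep x)" using rep_rel[OF assms] special_cong False SV by blast+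
  then have "fits (S `` {rep x}) (T `` {pfst (pick (rep x))})"
    using P_fits pick_props(2) unfolding special_def by blast
  then show ?thesis using class_eq[OF rep_rel[OF assms]] False unfolding target_eq by simp
qed

lemma ex_emb: "\<exists>v. x \<in> V \<longrightarrow> (target x, v) \<in> T \<and> card {u. u < v \<and> (target x, u) \<in> T} = rank x"
proof (cases "x \<in> V")
  case True
  have "rank x < card (S `` {x})" if f: "finite (S `` {x})"
  proof -
    have "{y. y < x \<and> (y, x) \<in> S} \<subset> S `` {x}" using S_sym S_refl[OF True] by blast
    then show ?thesis unfolding rank_def by (rule psubset_card_mono[OF f])
  qed
  then have "infinite (T `` {target x}) \<or> rank x < card (T `` {target x})"
    using target_fits[OF True] unfolding fits_def by auto
  from ex_nth_element[OF this] show ?thesis by auto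
qed simp

lemma emb_props:
  assumes "x \<in> V"
  shows "(target x, emb x) \<in> T" "card {u. u < emb x \<and> (target x, u) \<in> T} = rank x"
  using LeastI_ex[OF ex_emb[of x]] assms unfolding emb_def by auto

lemma emb_rel_iff:
  assumes "x \<in> V" "y \<in> V" shows "(x, y) \<in> S \<longleftrightarrow> (emb x, emb y) \<in> T"
proof
  assume "(x, y) \<in> S"
  then show "(emb x, emb y) \<in> T"
    using emb_props(1)[OF assms(1)] emb_props(1)[OF assms(2)] target_cong T_sym T_trans by metis
next
  assume "(emb x, emb y) \<in> T"
  then have "(target x, target y) \<in> T"
    using emb_props(1)[OF assms(1)] emb_props(1)[OF assms(2)] T_sym T_trans by metis
  then show "(x, y) \<in> S" by (rule target_inj[OF assms])
qed

lemma rank_less: "(x, y) \<in> S \<Longrightarrow> x < y \<Longrightarrow> rank x < rank y"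
proof -
  assume *: "(x, y) \<in> S" "x < y"
  then have "x \<in> {z. z < y \<and> (z, y) \<in> S}" "{z. z < x \<and> (z, x) \<in> S} \<subseteq> {z. z < y \<and> (z, y) \<in> S}"
    using S_trans by auto
  then have "{z. z < x \<and> (z, x) \<in> S} \<subset> {z. z < y \<and> (z, y) \<in> S}" by blast
  then show ?thesis unfolding rank_def by (intro psubset_card_mono) auto
qed

theorem is_embedding_emb: "is_embedding emb V S W T"
  unfolding is_embedding_def
proof (intro conjI ballI)
  show "emb ` V \<subseteq> W" using emb_props(1) TW by auto
  show "inj_on emb V"
  proof (rule inj_onI)
    fix x y assume xy: "x \<in> V" "y \<in> V" "emb x = emb y"
    have "emb x \<in> W" using emb_props(1)[OF xy(1)] TW by auto
    then have S: "(x, y) \<in> S" using emb_rel_iff[OF xy(1,2)] xy(3) T_refl by simp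
    then have "rank x = rank y"
      using emb_props(2)[OF xy(1)] emb_props(2)[OF xy(2)] target_cong xy(3) by simp
    then show "x = y" using rank_less[OF S] rank_less[OF S_sym[OF S]] by (metis less_irrefl linorder_cases)
  qed
qed (rule emb_rel_iff)

theorem cf_emb:
  assumes S: "cp X (\<lambda>z. (pfst z, psnd z) \<in> S)" and T: "cp X (\<lambda>z. (pfst z, psnd z) \<in> T)"
    and P: "cp X (\<lambda>z. P (pfst z) (psnd z))"
  shows "cf X emb"
proof -
  note S' = cp_comp2[where P = "\<lambda>x y. (x, y) \<in> S", OF S]
  note T' = cp_comp2[where P = "\<lambda>x y. (x, y) \<in> T", OF T]
  have sp: "cp X (\<lambda>x. special (f x))" if "cf X f" for f
    by (rule cp_comp[OF _ that]) (unfold special_def, intro S' c_rules)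
  have V: "cp X (\<lambda>x. f x \<in> V)" if "cf X f" for f
    unfolding mem_V_iff by (intro S' that)
  have W: "cp X (\<lambda>x. f x \<in> W)" if "cf X f" for f
    unfolding mem_W_iff by (intro T' that)
  have adm: "cp X (\<lambda>z. admissible (pfst z) (pfst (psnd z)) (psnd (psnd z)))"
    unfolding admissible_def by (intro V W sp S' T' cp_comp2[OF P] c_rules)
  have L: "cf X (\<lambda>z. LEAST c. admissible c (pfst z) (psnd z))"
    by (rule cf_Least[OF adm ex_admissible])
  have hist: "cf X history"
    unfolding history_def[abs_def]
    by (intro cf_rec cf_comp2[where h = "\<lambda>x l. LEAST c. admissible c x l", OF L] c_rules)
  have pick: "cf X (\<lambda>x. pick (f x))" if "cf X f" for f
    unfolding pick_def by (intro cf_comp2[where h = "\<lambda>x l. LEAST c. admissible c x l", OF L] cf_comp[OF hist] that)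
  have idx: "cf X (\<lambda>x. LEAST i. special x \<longrightarrow> i < llen rc \<and> (lnth rc i, x) \<in> S)"
    by (rule cf_Least) (intro sp S' c_rules, auto simp: special_def)
  have rep: "cf X (\<lambda>x. LEAST y. x \<in> V \<longrightarrow> (y, x) \<in> S)"
    by (rule cf_Least) (intro V S' c_rules, use S_refl in auto)
  have target: "cf X (\<lambda>x. target (f x))" if "cf X f" for f
    by (rule cf_comp[OF _ that]) (unfold target_def, intro cf_if sp cf_lnth cf_pfst pick idx rep cf_const cf_id)
  have rank: "cf X rank"
    unfolding rank_def[abs_def] by (intro cf_card_less S' c_rules)
  have count: "cf X (\<lambda>z. card {u. u < pfst z \<and> (target (psnd z), u) \<in> T})"
    by (intro cf_card_less T' target c_rules)
  show ?thesis
    unfolding emb_def[abs_def]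
    by (rule cf_Least[OF _ ex_emb]) (intro V T' target cf_comp[OF rank] count c_rules)
qed

end

section \<open>Invariants of embeddings\<close>

lemma cf_computes_on: "cf X f \<Longrightarrow> computes_on X U f"
  unfolding computes_on_def cf_def by blast

text \<open>The competing copies in \<open>be_cat_computes\<close> are arbitrary structures; that
  they are equivalence structures is pulled back along an embedding.\<close>

lemma embedding_equiv:
  assumes "is_embedding f V S U R" "equiv U R" "S \<subseteq> V \<times> V"
  shows "equiv V S"
proof (rule equivI)
  have f: "\<And>x. x \<in> V \<Longrightarrow> f x \<in> U" "\<And>x y. x \<in> V \<Longrightarrow> y \<in> V \<Longrightarrow> (x, y) \<in> S \<longleftrightarrow> (f x, f y) \<in> R"
    using assms(1) unfolding is_embedding_def by auto
  show "refl_on V S" using f equiv_reflD[OF assms(2)] by (auto simp: refl_on_def)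
  show "sym S"
  proof (rule symI)
    fix x y assume "(x, y) \<in> S"
    then show "(y, x) \<in> S" using f(2)[of x y] f(2)[of y x] assms(3) equiv_symD[OF assms(2)] by blast
  qed
  show "trans S"
  proof (rule transI)
    fix x y z assume "(x, y) \<in> S" "(y, z) \<in> S"
    then show "(x, z) \<in> S"
      using f(2)[of x y] f(2)[of y z] f(2)[of x z] assms(3) equiv_transD[OF assms(2)] by blast
  qed
qed (use assms in auto)

lemma fits_embedding:
  assumes "is_embedding f V S W T" "S \<subseteq> V \<times> V" "x \<in> V"
  shows "f ` (S `` {x}) \<subseteq> T `` {f x}" "inj_on f (S `` {x})" "fits (S `` {x}) (T `` {f x})"
proof -
  have "S `` {x} \<subseteq> V" using assms(2) by auto
  then show inj: "inj_on f (S `` {x})"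
    using assms(1) inj_on_subset unfolding is_embedding_def by blast
  show sub: "f ` (S `` {x}) \<subseteq> T `` {f x}"
    using assms unfolding is_embedding_def by auto
  show "fits (S `` {x}) (T `` {f x})"
    unfolding fits_def using sub inj by (meson card_inj_on_le finite_imageD finite_subset)
qed

definition upward :: "(nat set \<Rightarrow> bool) \<Rightarrow> bool" where
  "upward P \<longleftrightarrow> (\<forall>A B. fits A B \<longrightarrow> P A \<longrightarrow> P B)"

lemma upward_infinite: "upward infinite"
  by (auto simp: upward_def fits_def)

lemma upward_big: "upward (big k)"
  by (auto simp: upward_def fits_def big_def)

text \<open>For each member of F that is equivalent to an image, one preimage of such an image is
  chosen. An element that avoids these finitely many preimages has an image that avoids F, and its
  class can only grow.\<close>

lemma many_embedding:
  assumes f: "is_embedding f U R V S" and R: "equiv U R" and S: "equiv V S"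
    and P: "upward P" and m: "many U R P"
  shows "many V S P"
  unfolding many_def
proof (intro allI impI)
  fix F assume F: "finite F \<and> F \<subseteq> V"
  have fU: "\<And>x. x \<in> U \<Longrightarrow> f x \<in> V" "\<And>x y. x \<in> U \<Longrightarrow> y \<in> U \<Longrightarrow> (x, y) \<in> R \<longleftrightarrow> (f x, f y) \<in> S"
    using f unfolding is_embedding_def by auto
  have "\<exists>g. \<forall>y\<in>{y\<in>F. \<exists>x\<in>U. (y, f x) \<in> S}. g y \<in> U \<and> (y, f (g y)) \<in> S"
    by (rule bchoice) blast
  then obtain g where g: "\<And>y x. y \<in> F \<Longrightarrow> x \<in> U \<Longrightarrow> (y, f x) \<in> S \<Longrightarrow> g y \<in> U \<and> (y, f (g y)) \<in> S" by blast
  have "finite (g ` F \<inter> U) \<and> g ` F \<inter> U \<subseteq> U" using F by auto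
  then obtain x where x: "x \<in> U" "P (R `` {x})" "\<forall>y\<in>g ` F \<inter> U. (y, x) \<notin> R"
    using m[unfolded many_def, rule_format, of "g ` F \<inter> U"] by blast
  have "(y, f x) \<notin> S" if y: "y \<in> F" for y
  proof
    assume yx: "(y, f x) \<in> S"
    then have gy: "g y \<in> U" "(y, f (g y)) \<in> S" using g[OF y x(1)] by auto
    have "(f (g y), f x) \<in> S" using equiv_transD[OF S equiv_symD[OF S gy(2)] yx] .
    then have "(g y, x) \<in> R" using fU(2)[OF gy(1) x(1)] by blast
    then show False using x(3) gy(1) y by blast
  qed
  moreover have "P (S `` {f x})"
    using fits_embedding(3)[OF f equiv_subset[OF R] x(1)] x(2) P unfolding upward_def by blast
  ultimately show "\<exists>x\<in>V. P (S `` {x}) \<and> (\<forall>y\<in>F. (y, x) \<notin> S)" using fU(1)[OF x(1)] by blast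
qed

lemma many_bi_embeddable:
  assumes "bi_embeddable V S U R" "equiv U R" "S \<subseteq> V \<times> V" "upward P"
  shows "many V S P \<longleftrightarrow> many U R P"
proof -
  obtain f g where f: "is_embedding f V S U R" and g: "is_embedding g U R V S"
    using assms(1) unfolding bi_embeddable_def embeds_def by blast
  have S: "equiv V S" by (rule embedding_equiv[OF f assms(2,3)])
  show ?thesis
    using many_embedding[OF f S assms(2,4)] many_embedding[OF g assms(2) S assms(4)] by blast
qed

lemma class_representatives:
  assumes S: "equiv V S" and m: "\<not> many V S P"
  obtains rc where "\<And>i. i < llen rc \<Longrightarrow> lnth rc i \<in> V \<and> P (S `` {lnth rc i})"
    "\<And>i j. i < llen rc \<Longrightarrow> j < llen rc \<Longrightarrow> (lnth rc i, lnth rc j) \<in> S \<Longrightarrow> i = j"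
    "\<And>x. x \<in> V \<Longrightarrow> (\<exists>i<llen rc. (lnth rc i, x) \<in> S) \<longleftrightarrow> P (S `` {x})"
proof -
  obtain F where F0: "finite F \<and> F \<subseteq> V" "\<not> (\<exists>x\<in>V. P (S `` {x}) \<and> (\<forall>y\<in>F. (y, x) \<notin> S))"
    using m unfolding many_def by (simp only: not_all not_imp) blast
  then have F: "finite F" "F \<subseteq> V" "\<And>x. x \<in> V \<Longrightarrow> P (S `` {x}) \<Longrightarrow> \<exists>y\<in>F. (y, x) \<in> S"
    by blast+
  define r where "r x = (LEAST y. (y, x) \<in> S)" for x
  have sym: "(x, y) \<in> S \<Longrightarrow> (y, x) \<in> S" and trans: "(x, y) \<in> S \<Longrightarrow> (y, z) \<in> S \<Longrightarrow> (x, z) \<in> S" for x y z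
    by (rule equiv_symD[OF S], assumption, rule equiv_transD[OF S], assumption+)
  have cls: "(x, y) \<in> S \<Longrightarrow> S `` {x} = S `` {y}" for x y using sym trans by blast
  have r: "(r x, x) \<in> S" if "x \<in> V" for x
    unfolding r_def by (rule LeastI[of _ x]) (rule equiv_reflD[OF S that])
  have r_cong: "r x = r y" if "(x, y) \<in> S" for x y
  proof -
    have "(z, x) \<in> S \<longleftrightarrow> (z, y) \<in> S" for z using that sym trans by blast
    then show ?thesis unfolding r_def by simp
  qed
  \<comment> \<open>\<open>F\<close> may meet one class several times and also meet classes without
    \<open>P\<close>. Restricting it and passing to least members leaves exactly one number for each
    class with \<open>P\<close>.\<close>
  define G where "G = r ` {x\<in>F. P (S `` {x})}"
  have "finite G" using F(1) unfolding G_def by simp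
  then obtain xs where xs: "set xs = G" "distinct xs" using finite_distinct_list by blast
  have G: "y \<in> V \<and> P (S `` {y}) \<and> r y = y" if "y \<in> G" for y
  proof -
    obtain x where x: "y = r x" "x \<in> F" "P (S `` {x})" using \<open>y \<in> G\<close> unfolding G_def by blast
    have "(y, x) \<in> S" using r x F(2) by blast
    then show ?thesis using equiv_subset[OF S] cls x(1,3) r_cong by auto
  qed
  have inx: "lnth (list_encode xs) i \<in> G" if "i < length xs" for i
    using that xs(1) by (simp add: lnth_list_encode flip: xs(1))
  show ?thesis
  proof (rule that[of "list_encode xs"])
    show "lnth (list_encode xs) i \<in> V \<and> P (S `` {lnth (list_encode xs) i})" if "i < llen (list_encode xs)" for i
      using G[OF inx] that by simp
    show "i = j" if "i < llen (list_encode xs)" "j < llen (list_encode xs)"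
      "(lnth (list_encode xs) i, lnth (list_encode xs) j) \<in> S" for i j
    proof -
      have ij: "i < length xs" "j < length xs" using that by simp_all
      have "lnth (list_encode xs) i = lnth (list_encode xs) j"
        using G[OF inx[OF ij(1)]] G[OF inx[OF ij(2)]] r_cong[OF that(3)] by argo
      then show ?thesis using that xs(2) by (simp add: lnth_list_encode nth_eq_iff_index_eq)
    qed
    show "(\<exists>i<llen (list_encode xs). (lnth (list_encode xs) i, x) \<in> S) \<longleftrightarrow> P (S `` {x})" if x: "x \<in> V" for x
    proof
      assume "\<exists>i<llen (list_encode xs). (lnth (list_encode xs) i, x) \<in> S"
      then obtain i where i: "i < length xs" "(lnth (list_encode xs) i, x) \<in> S" by auto
      then show "P (S `` {x})" using G[OF inx[OF i(1)]] cls[OF i(2)] by simp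
    next
      assume Px: "P (S `` {x})"
      then obtain y where y: "y \<in> F" "(y, x) \<in> S" using F(3) x by blast
      have "P (S `` {y})" using Px cls[OF y(2)] by simp
      then have "r y \<in> G" using y(1) unfolding G_def by blast
      moreover have "(r y, x) \<in> S" using r[of y] F(2) y trans by blast
      moreover obtain i where "i < length xs" "xs ! i = r y"
        using \<open>r y \<in> G\<close> unfolding xs(1)[symmetric] in_set_conv_nth by blast
      ultimately show "\<exists>i<llen (list_encode xs). (lnth (list_encode xs) i, x) \<in> S"
        by (intro exI[of _ i]) (simp add: lnth_list_encode)
    qed
  qed
qed

section \<open>Degrees of bi-embeddable categoricity\<close>

lemma big_initial_segment:
  assumes "big k C" shows "\<exists>b. k \<le> card {u. u < b \<and> u \<in> C}"
proof (cases "finite C")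
  case True
  then obtain b where "C \<subseteq> {..<b}" by (meson finite_nat_iff_bounded)
  then have "{u. u < b \<and> u \<in> C} = C" by auto
  then show ?thesis using assms True unfolding big_def by metis
next
  case False
  then show ?thesis using ex_nth_element[of C k] by auto
qed

lemma initial_segment_fits:
  assumes "finite A" "card A \<le> k" "k \<le> card {u. u < b \<and> u \<in> B}"
  shows "fits A B"
proof (cases "finite B")
  case True
  then have "card {u. u < b \<and> u \<in> B} \<le> card B" by (intro card_mono) auto
  then show ?thesis using assms unfolding fits_def by simp
qed (simp add: fits_def)

text \<open>The classes with \<open>Q\<close> are matched as the given embedding \<open>g\<close>
  does, which takes only finitely much information. For the others a bound on the size is required
  that \<open>X\<close> computes and that infinitely many target classes attain. The test
  \<open>sp\<close> for \<open>Q\<close> is handed over so that the computation of the bound can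
  skip classes that have none.\<close>

lemma computable_embedding:
  assumes S: "equiv V S" "computable_rel S" and T: "equiv W T" "computable_rel T"
    and g: "is_embedding g V S W T" and Q: "\<not> many V S Q"
    and sz: "\<And>sp. cp {} sp \<Longrightarrow> (\<And>x. x \<in> V \<Longrightarrow> sp x \<longleftrightarrow> Q (S `` {x})) \<Longrightarrow>
      \<exists>sz. cf X sz \<and> (\<forall>x\<in>V. \<not> Q (S `` {x}) \<longrightarrow>
        finite (S `` {x}) \<and> card (S `` {x}) \<le> sz x \<and> many W T (big (sz x)))"
  shows "\<exists>f. is_embedding f V S W T \<and> computes_on X V f"
proof -
  obtain rc where rc: "\<And>i. i < llen rc \<Longrightarrow> lnth rc i \<in> V \<and> Q (S `` {lnth rc i})"
    "\<And>i j. i < llen rc \<Longrightarrow> j < llen rc \<Longrightarrow> (lnth rc i, lnth rc j) \<in> S \<Longrightarrow> i = j"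
    "\<And>x. x \<in> V \<Longrightarrow> (\<exists>i<llen rc. (lnth rc i, x) \<in> S) \<longleftrightarrow> Q (S `` {x})"
    using class_representatives[OF S(1) Q] by blast
  note S' = S(2)[unfolded computable_rel_iff] and T' = T(2)[unfolded computable_rel_iff]
  have "cp {} (\<lambda>x. \<exists>i<llen rc. (lnth rc i, x) \<in> S)"
    by (intro cp_comp2[where P = "\<lambda>x y. (x, y) \<in> S", OF S'] c_rules)
  from sz[OF this rc(3)] obtain sz where cf_sz: "cf X sz"
    and sz: "\<And>x. x \<in> V \<Longrightarrow> \<not> Q (S `` {x}) \<Longrightarrow> finite (S `` {x}) \<and> card (S `` {x}) \<le> sz x \<and> many W T (big (sz x))"
    by blast
  define sc where "sc = list_encode (map (\<lambda>i. g (lnth rc i)) [0..<llen rc])"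
  have sc: "llen sc = llen rc" "\<And>i. i < llen rc \<Longrightarrow> lnth sc i = g (lnth rc i)"
    by (simp_all add: sc_def lnth_list_encode)
  have gV: "\<And>x y. x \<in> V \<Longrightarrow> y \<in> V \<Longrightarrow> (x, y) \<in> S \<longleftrightarrow> (g x, g y) \<in> T"
    using g unfolding is_embedding_def by auto
  \<comment> \<open>The component \<open>psnd c\<close> is a bound below which enough elements of
    the target class occur; counting them is computable from \<open>T\<close>, unlike finding the
    size of the class.\<close>
  interpret class_matching V W S T rc sc "\<lambda>x c. sz x \<le> card {u. u < psnd c \<and> (pfst c, u) \<in> T}"
  proof
    show "equiv V S" "equiv W T" "llen rc = llen sc" using S T sc by auto
    show "i = j" if "i < llen sc" "j < llen sc" "(lnth sc i, lnth sc j) \<in> T" for i j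
      using that sc gV rc(1,2) by simp
    show "fits (S `` {lnth rc i}) (T `` {lnth sc i})" if "i < llen sc" for i
      using that sc fits_embedding(3)[OF g equiv_subset[OF S(1)]] rc(1) by simp
  next
    fix x and F :: "nat set" assume x: "x \<in> V" "\<not> (\<exists>i<llen rc. (lnth rc i, x) \<in> S)" and F: "finite F" "F \<subseteq> W"
    have "many W T (big (sz x))" using sz x rc(3) by blast
    then obtain w where w: "w \<in> W" "big (sz x) (T `` {w})" "\<forall>y\<in>F. (y, w) \<notin> T"
      using F unfolding many_def by meson
    obtain b where "sz x \<le> card {u. u < b \<and> u \<in> T `` {w}}" using big_initial_segment[OF w(2)] by blast
    then show "\<exists>c. pfst c \<in> W \<and> sz x \<le> card {u. u < psnd c \<and> (pfst c, u) \<in> T} \<and> (\<forall>y\<in>F. (y, pfst c) \<notin> T)"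
      using w by (intro exI[of _ "prod_encode (w, b)"]) simp
  next
    fix x c assume x: "x \<in> V" "\<not> (\<exists>i<llen rc. (lnth rc i, x) \<in> S)"
      and c: "sz x \<le> card {u. u < psnd c \<and> (pfst c, u) \<in> T}"
    show "fits (S `` {x}) (T `` {pfst c})"
      by (rule initial_segment_fits[of _ "sz x" "psnd c"]) (use sz[OF x(1)] x rc(3) c in auto)
  qed
  have "cf X emb"
    by (intro cf_emb cp_oracle[OF S'] cp_oracle[OF T'] cp_le cf_comp[OF cf_sz] cf_card_less
        cp_comp2[where P = "\<lambda>x y. (x, y) \<in> T", OF cp_oracle[OF T']] cf_pfst cf_psnd cf_id)
  then show ?thesis using is_embedding_emb cf_computes_on by blast
qed

lemma is_embedding_comp:
  assumes f: "is_embedding f V S U R" and g: "is_embedding g U R W T"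
  shows "is_embedding (g \<circ> f) V S W T"
proof -
  have U: "\<And>x. x \<in> V \<Longrightarrow> f x \<in> U" using f unfolding is_embedding_def by blast
  show ?thesis
    unfolding is_embedding_def
  proof (intro conjI ballI)
    show "(g \<circ> f) ` V \<subseteq> W" using f g unfolding is_embedding_def by auto
    show "inj_on (g \<circ> f) V"
      by (rule comp_inj_on[OF _ inj_on_subset[of g U]]) (use f g in \<open>simp_all add: is_embedding_def\<close>)
    show "(x, y) \<in> S \<longleftrightarrow> ((g \<circ> f) x, (g \<circ> f) y) \<in> T" if "x \<in> V" "y \<in> V" for x y
      using f g U that unfolding is_embedding_def by simp
  qed
qed

text \<open>The premise is symmetric in the two copies, so one direction suffices. Bi-embeddability
  survives as some embedding \<open>g\<close>, not assumed computable, and as the invariance of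
  \<open>many\<close>.\<close>

lemma be_cat_computesI:
  assumes R: "equiv U R"
    and emb: "\<And>V S W T g. equiv V S \<Longrightarrow> computable_rel S \<Longrightarrow> equiv W T \<Longrightarrow> computable_rel T \<Longrightarrow>
      is_embedding g V S W T \<Longrightarrow> (\<And>P. upward P \<Longrightarrow> many V S P \<longleftrightarrow> many U R P) \<Longrightarrow>
      (\<And>P. upward P \<Longrightarrow> many W T P \<longleftrightarrow> many U R P) \<Longrightarrow>
      \<exists>f. is_embedding f V S W T \<and> computes_on X V f"
  shows "be_cat_computes X U R"
  unfolding be_cat_computes_def
proof (intro allI impI, elim conjE)
  fix V S W T
  assume s: "computable_struct V S" "computable_struct W T"
    and b: "bi_embeddable V S U R" "bi_embeddable W T U R"
  obtain f g h k where e: "is_embedding f V S U R" "is_embedding g U R V S"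
    "is_embedding h W T U R" "is_embedding k U R W T"
    using b unfolding bi_embeddable_def embeds_def by blast
  have S: "S \<subseteq> V \<times> V" "computable_rel S" and T: "T \<subseteq> W \<times> W" "computable_rel T"
    using s unfolding computable_struct_def by auto
  have eq: "equiv V S" "equiv W T" using embedding_equiv e R S T by blast+
  have m: "upward P \<Longrightarrow> many V S P \<longleftrightarrow> many U R P" "upward P \<Longrightarrow> many W T P \<longleftrightarrow> many U R P" for P
    using many_bi_embeddable b R S T by blast+
  show "(\<exists>f. is_embedding f V S W T \<and> computes_on X V f) \<and> (\<exists>g. is_embedding g W T V S \<and> computes_on X W g)"
    using emb[OF eq(1) S(2) eq(2) T(2) is_embedding_comp[OF e(1,4)] m]
      emb[OF eq(2) T(2) eq(1) S(2) is_embedding_comp[OF e(3,2)] m(2,1)] by blast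
qed

lemma bounded_be_cat_computes_empty:
  assumes R: "equiv U R" and k: "\<not> many U R (big k)"
  shows "be_cat_computes {} U R"
proof (rule be_cat_computesI[OF R])
  define k0 where "k0 = (LEAST k. \<not> many U R (big k))"
  have k0: "\<not> many U R (big k0)" unfolding k0_def by (rule LeastI[of "\<lambda>k. \<not> many U R (big k)", OF k])
  fix V S W T g
  assume S: "equiv V S" "computable_rel S" and T: "equiv W T" "computable_rel T"
    and g: "is_embedding g V S W T"
    and mS: "\<And>P. upward P \<Longrightarrow> many V S P \<longleftrightarrow> many U R P"
    and mT: "\<And>P. upward P \<Longrightarrow> many W T P \<longleftrightarrow> many U R P"
  show "\<exists>f. is_embedding f V S W T \<and> computes_on {} V f"
  proof (rule computable_embedding[OF S T g, of "big k0"])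
    show "\<not> many V S (big k0)" using k0 mS upward_big by blast
    have "finite (S `` {x}) \<and> card (S `` {x}) \<le> k0 - 1 \<and> many W T (big (k0 - 1))"
      if "\<not> big k0 (S `` {x})" for x
    proof -
      \<comment> \<open>Every set satisfies \<open>big 0\<close>. Hence \<open>k0 - 1\<close> is
        smaller than \<open>k0\<close>, and minimality provides infinitely many classes with room
        for the at most \<open>k0 - 1\<close> elements of this one.\<close>
      have "k0 \<noteq> 0" using that by (auto simp: big_def)
      then have "many U R (big (k0 - 1))"
        using not_less_Least[of "k0 - 1" "\<lambda>k. \<not> many U R (big k)"] unfolding k0_def by simp
      then show ?thesis using that mT upward_big unfolding big_def by auto
    qed
    then show "\<exists>sz. cf {} sz \<and> (\<forall>x\<in>V. \<not> big k0 (S `` {x}) \<longrightarrow>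
        finite (S `` {x}) \<and> card (S `` {x}) \<le> sz x \<and> many W T (big (sz x)))"
      using cf_const[of "{}" "k0 - 1"] by blast
  qed
qed

lemma unbounded_be_cat_computes_halting_set:
  assumes R: "equiv U R" and inf: "\<not> many U R infinite" and big: "\<And>k. many U R (big k)"
  shows "be_cat_computes halting_set U R"
proof (rule be_cat_computesI[OF R])
  fix V S W T g
  assume S: "equiv V S" "computable_rel S" and T: "equiv W T" "computable_rel T"
    and g: "is_embedding g V S W T"
    and mS: "\<And>P. upward P \<Longrightarrow> many V S P \<longleftrightarrow> many U R P"
    and mT: "\<And>P. upward P \<Longrightarrow> many W T P \<longleftrightarrow> many U R P"
  show "\<exists>f. is_embedding f V S W T \<and> computes_on halting_set V f"
  proof (rule computable_embedding[OF S T g, of infinite])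
    show "\<not> many V S infinite" using inf mS upward_infinite by blast
    fix sp assume sp: "cp {} sp" "\<And>x. x \<in> V \<Longrightarrow> sp x \<longleftrightarrow> infinite (S `` {x})"
    \<comment> \<open>The last disjunct says that the class of x has no member k + d, that is, none
      from k on; the least such k bounds the size. The first two stop the search on infinite classes
      and outside \<open>V\<close>.\<close>
    let ?P = "\<lambda>k x. sp x \<or> (x, x) \<notin> S \<or> \<not> (\<exists>d. (x, k + d) \<in> S)"
    note S' = S(2)[unfolded computable_rel_iff]
    have ex: "\<exists>k. ?P k x" for x
    proof (cases "x \<in> V \<and> \<not> sp x")
      case True
      then have "finite (S `` {x})" using sp(2) by blast
      then obtain b where "S `` {x} \<subseteq> {..<b}" by (meson finite_nat_iff_bounded)
      then have "\<not> (\<exists>d. (x, b + d) \<in> S)" by auto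
      then show ?thesis by blast
    qed (use equiv_subset[OF S(1)] in auto)
    have "cp halting_set (\<lambda>z. \<exists>d. (psnd z, pfst z + d) \<in> S)"
      by (intro cp_halting_set_semidecidable cp_comp2[where P = "\<lambda>x y. (x, y) \<in> S", OF S'] c_rules)
    then have "cf halting_set (\<lambda>x. LEAST k. ?P k x)"
      by (intro cf_Least[OF _ ex] cp_or cp_not cp_comp[OF cp_oracle[OF sp(1)]]
          cp_comp2[where P = "\<lambda>x y. (x, y) \<in> S", OF cp_oracle[OF S']] c_rules)
    moreover have "finite (S `` {x}) \<and> card (S `` {x}) \<le> (LEAST k. ?P k x) \<and> many W T (big (LEAST k. ?P k x))"
      if "x \<in> V" "\<not> infinite (S `` {x})" for x
    proof -
      have "\<not> (\<exists>d. (x, (LEAST k. ?P k x) + d) \<in> S)"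
        using LeastI_ex[OF ex[of x]] that sp(2) equiv_reflD[OF S(1)] by blast
      then have "S `` {x} \<subseteq> {..<LEAST k. ?P k x}" by (auto simp: not_less le_iff_add simp flip: not_le)
      then have "card (S `` {x}) \<le> (LEAST k. ?P k x)" using card_mono[of "{..<LEAST k. ?P k x}"] by fastforce
      then show ?thesis using that mT upward_big big by blast
    qed
    ultimately show "\<exists>sz. cf halting_set sz \<and> (\<forall>x\<in>V. \<not> infinite (S `` {x}) \<longrightarrow>
        finite (S `` {x}) \<and> card (S `` {x}) \<le> sz x \<and> many W T (big (sz x)))"
      by blast
  qed
qed

section \<open>Structures given by groups\<close>

text \<open>The number prod_encode (g, t) is the t-th candidate for the g-th class; rejected candidates form
  classes of their own.\<close>

definition grp_rel :: "(nat \<Rightarrow> nat \<Rightarrow> bool) \<Rightarrow> (nat \<times> nat) set" where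
  "grp_rel G = {(x, y). x = y \<or> (pfst x = pfst y \<and> G (pfst x) (psnd x) \<and> G (pfst y) (psnd y))}"

lemma equiv_grp_rel: "equiv UNIV (grp_rel G)"
  unfolding grp_rel_def by (intro equivI refl_onI symI transI) auto

lemma cp_grp_rel:
  assumes "cp X (\<lambda>z. G (pfst z) (psnd z))" "cf X f" "cf X g"
  shows "cp X (\<lambda>x. (f x, g x) \<in> grp_rel G)"
  unfolding grp_rel_def mem_Collect_eq prod.case
  by (intro cp_or cp_and cp_eq cp_comp2[OF assms(1)] cf_pfst cf_psnd assms)

lemma computable_struct_grp_rel:
  assumes "cp {} (\<lambda>z. G (pfst z) (psnd z))"
  shows "computable_struct UNIV (grp_rel G)"
  unfolding computable_struct_def computable_set_iff computable_rel_iff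
  using cp_grp_rel[OF assms cf_pfst[OF cf_id] cf_psnd[OF cf_id]] by (simp add: cp_const)

lemma grp_rel_class:
  "grp_rel G `` {x} = (if G (pfst x) (psnd x) then (\<lambda>t. prod_encode (pfst x, t)) ` {t. G (pfst x) t} else {x})"
proof (cases "G (pfst x) (psnd x)")
  case True
  have "y \<in> (\<lambda>t. prod_encode (pfst x, t)) ` {t. G (pfst x) t} \<longleftrightarrow> pfst y = pfst x \<and> G (pfst y) (psnd y)" for y
    by (auto intro!: image_eqI[of _ _ "psnd y"]) (metis pair_pfst_psnd)
  then show ?thesis using True by (auto simp: grp_rel_def)
qed (auto simp: grp_rel_def)

lemma inj_pair: "inj_on (\<lambda>t. prod_encode (g, t)) A"
  by (auto intro: inj_onI)

lemma infinite_grp_class: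
  "infinite (grp_rel G `` {x}) \<longleftrightarrow> G (pfst x) (psnd x) \<and> infinite {t. G (pfst x) t}"
  unfolding grp_rel_class by (auto simp: finite_image_iff[OF inj_pair])

lemma big_grp_class:
  "G (pfst x) (psnd x) \<Longrightarrow> big k (grp_rel G `` {x}) \<longleftrightarrow> big k {t. G (pfst x) t}"
  unfolding grp_rel_class big_def by (auto simp: finite_image_iff[OF inj_pair] card_image[OF inj_pair])

lemma many_grpI:
  assumes "infinite {g. P g}"
    and "\<And>g. P g \<Longrightarrow> \<exists>t. G g t \<and> Q (grp_rel G `` {prod_encode (g, t)})"
  shows "many UNIV (grp_rel G) Q"
  unfolding many_def
proof (intro allI impI)
  fix F :: "nat set" assume "finite F \<and> F \<subseteq> UNIV"
  then have "\<not> {g. P g} \<subseteq> pfst ` F" using assms(1) finite_subset by blast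
  then obtain g where g: "P g" "g \<notin> pfst ` F" by blast
  obtain t where "G g t" "Q (grp_rel G `` {prod_encode (g, t)})" using assms(2)[OF g(1)] by blast
  moreover have "(y, prod_encode (g, t)) \<notin> grp_rel G" if "y \<in> F" for y
  proof
    assume "(y, prod_encode (g, t)) \<in> grp_rel G"
    then have "pfst y = g" by (auto simp: grp_rel_def)
    then show False using g(2) \<open>y \<in> F\<close> by blast
  qed
  ultimately show "\<exists>x\<in>UNIV. Q (grp_rel G `` {x}) \<and> (\<forall>y\<in>F. (y, x) \<notin> grp_rel G)" by blast
qed

lemma many_infinite_grp: "many UNIV (grp_rel G) infinite \<longleftrightarrow> infinite {g. infinite {t. G g t}}"
proof
  assume m: "many UNIV (grp_rel G) infinite"
  show "infinite {g. infinite {t. G g t}}"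
  proof
    assume fin: "finite {g. infinite {t. G g t}}"
    let ?F = "(\<lambda>g. prod_encode (g, SOME t. G g t)) ` {g. infinite {t. G g t}}"
    obtain x where x: "infinite (grp_rel G `` {x})" "\<forall>y\<in>?F. (y, x) \<notin> grp_rel G"
      using m[unfolded many_def, rule_format, of ?F] fin by blast
    have g: "G (pfst x) (psnd x)" "infinite {t. G (pfst x) t}" using x(1) unfolding infinite_grp_class by auto
    have "G (pfst x) (SOME t. G (pfst x) t)" by (rule someI, rule g(1))
    then have "(prod_encode (pfst x, SOME t. G (pfst x) t), x) \<in> grp_rel G"
      using g(1) by (auto simp: grp_rel_def)
    then show False using x(2) g(2) by blast
  qed
next
  assume "infinite {g. infinite {t. G g t}}"
  then show "many UNIV (grp_rel G) infinite"
  proof (rule many_grpI)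
    fix g assume g: "infinite {t. G g t}"
    then obtain t where "G g t" using not_finite_existsD by blast
    then show "\<exists>t. G g t \<and> infinite (grp_rel G `` {prod_encode (g, t)})"
      using g unfolding infinite_grp_class by auto
  qed
qed

text \<open>The successor matters for k = 0: \<open>big 0\<close> holds of an empty group, which
  yields no class, whereas \<open>big 1\<close> forces an element.\<close>

lemma many_big_grp:
  assumes "infinite {g. big (Suc k) {t. G g t}}" shows "many UNIV (grp_rel G) (big k)"
  using assms
proof (rule many_grpI)
  fix g assume g: "big (Suc k) {t. G g t}"
  have "{t. G g t} \<noteq> {}"
  proof
    assume "{t. G g t} = {}"
    then show False using g unfolding big_def by (metis card.empty finite.emptyI not_less_eq_eq zero_le)
  qed
  then obtain t where "G g t" by blast
  then show "\<exists>t. G g t \<and> big k (grp_rel G `` {prod_encode (g, t)})"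
    using g by (intro exI[of _ t]) (auto simp: big_grp_class, auto simp: big_def)
qed

text \<open>Every class fits into an infinite one, so the greedy matching runs with empty lists of
  special classes. Only existence is wanted here, and \<open>P\<close> may be undecidable.\<close>

lemma embeds_many_infinite:
  assumes "equiv V S" "equiv W T" "many W T infinite"
  shows "embeds V S W T"
proof -
  interpret class_matching V W S T 0 0 "\<lambda>x c. infinite (T `` {pfst c})"
  proof
    fix x and F :: "nat set" assume "finite F" "F \<subseteq> W"
    then obtain w where "w \<in> W" "infinite (T `` {w})" "\<forall>y\<in>F. (y, w) \<notin> T"
      using assms(3) unfolding many_def by meson
    then show "\<exists>c. pfst c \<in> W \<and> infinite (T `` {pfst c}) \<and> (\<forall>y\<in>F. (y, pfst c) \<notin> T)"
      by (intro exI[of _ "prod_encode (w, 0)"]) simp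
  qed (use assms in \<open>auto simp: fits_def\<close>)
  show ?thesis using is_embedding_emb unfolding embeds_def by blast
qed

text \<open>Infinite classes go to infinite classes by position in the lists; each finite class
  finds room because arbitrarily large classes occur infinitely often.\<close>

lemma embeds_same_number_infinite:
  assumes S: "equiv V S" and T: "equiv W T" and big: "\<And>k. many W T (big k)" and len: "llen rc = llen sc"
    and rc: "\<And>x. x \<in> V \<Longrightarrow> infinite (S `` {x}) \<Longrightarrow> \<exists>i<llen rc. (lnth rc i, x) \<in> S"
    and sc: "\<And>i. i < llen sc \<Longrightarrow> infinite (T `` {lnth sc i})"
    "\<And>i j. i < llen sc \<Longrightarrow> j < llen sc \<Longrightarrow> (lnth sc i, lnth sc j) \<in> T \<Longrightarrow> i = j"
  shows "embeds V S W T"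
proof -
  interpret class_matching V W S T rc sc "\<lambda>x c. fits (S `` {x}) (T `` {pfst c})"
  proof
    fix x and F :: "nat set" assume x: "x \<in> V" "\<not> (\<exists>i<llen rc. (lnth rc i, x) \<in> S)" and F: "finite F" "F \<subseteq> W"
    then obtain w where "w \<in> W" "big (card (S `` {x})) (T `` {w})" "\<forall>y\<in>F. (y, w) \<notin> T"
      using big[of "card (S `` {x})"] unfolding many_def by meson
    moreover have "finite (S `` {x})" using rc x by blast
    ultimately show "\<exists>c. pfst c \<in> W \<and> fits (S `` {x}) (T `` {pfst c}) \<and> (\<forall>y\<in>F. (y, pfst c) \<notin> T)"
      by (intro exI[of _ "prod_encode (w, 0)"]) (auto simp: big_def fits_def)
  qed (use assms in \<open>auto simp: fits_def\<close>)
  show ?thesis using is_embedding_emb unfolding embeds_def by blast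
qed

lemma grp_bi_embeddable:
  assumes inf: "\<And>g. infinite {t. G g t} \<longleftrightarrow> g < llen rc" and G: "\<And>g t. g < llen rc \<Longrightarrow> G g t"
    and big: "\<And>k. infinite {g. big k {t. G g t}}"
    and R: "equiv UNIV R" and bigR: "\<And>k. many UNIV R (big k)"
    and rc: "\<And>i. i < llen rc \<Longrightarrow> infinite (R `` {lnth rc i})"
    "\<And>i j. i < llen rc \<Longrightarrow> j < llen rc \<Longrightarrow> (lnth rc i, lnth rc j) \<in> R \<Longrightarrow> i = j"
    "\<And>x. infinite (R `` {x}) \<Longrightarrow> \<exists>i<llen rc. (lnth rc i, x) \<in> R"
  shows "bi_embeddable UNIV (grp_rel G) UNIV R"
proof -
  define sc where "sc = list_encode (map (\<lambda>g. prod_encode (g, 0)) [0..<llen rc])"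
  have sc: "llen sc = llen rc" "\<And>i. i < llen rc \<Longrightarrow> lnth sc i = prod_encode (i, 0)"
    by (simp_all add: sc_def lnth_list_encode)
  have sc_inf: "infinite (grp_rel G `` {lnth sc i})" if "i < llen sc" for i
    using that sc G inf by (simp add: infinite_grp_class)
  have sc_dist: "i = j" if "i < llen sc" "j < llen sc" "(lnth sc i, lnth sc j) \<in> grp_rel G" for i j
    using that sc by (auto simp: grp_rel_def)
  have sc_cover: "\<exists>i<llen sc. (lnth sc i, x) \<in> grp_rel G" if "infinite (grp_rel G `` {x})" for x
  proof -
    have "G (pfst x) (psnd x)" "pfst x < llen rc" using that inf unfolding infinite_grp_class by auto
    then show ?thesis using sc G by (intro exI[of _ "pfst x"]) (simp add: grp_rel_def)
  qed
  have bigG: "many UNIV (grp_rel G) (big k)" for k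
    by (rule many_big_grp[OF big])
  show ?thesis
    unfolding bi_embeddable_def
    using embeds_same_number_infinite[OF equiv_grp_rel R bigR, of sc rc G] sc(1) sc_cover rc
      embeds_same_number_infinite[OF R equiv_grp_rel bigG, of rc sc] sc_inf sc_dist by auto
qed

section \<open>Two copies whose embeddings compute the halting set\<close>

definition first_halt :: "nat \<Rightarrow> nat \<Rightarrow> bool" where
  "first_halt e s \<longleftrightarrow> halt_wit e s \<and> (\<forall>s'<s. \<not> halt_wit e s')"

text \<open>From m on, the number of a group determines its size, which is
  \<open>Suc g\<close>.\<close>

definition tame_grp :: "nat \<Rightarrow> nat \<Rightarrow> nat \<Rightarrow> bool" where
  "tame_grp m g t \<longleftrightarrow> g < m \<or> t \<le> g"

text \<open>A class of the second structure can be as large as the least halting witness of a program.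
  An embedding sends it into a class of known size of the first structure, which bounds the witness.\<close>
definition wild_grp :: "nat \<Rightarrow> nat \<Rightarrow> nat \<Rightarrow> bool" where
  "wild_grp m g t \<longleftrightarrow> g < m \<or> (if pfst (g - m) = 0 then t \<le> g
     else t = 0 \<or> (first_halt (psnd (g - m)) (pfst (t - 1)) \<and> psnd (t - 1) \<le> pfst (t - 1)))"

lemma tame_grp_less: "g < m \<Longrightarrow> tame_grp m g t" and wild_grp_less: "g < m \<Longrightarrow> wild_grp m g t"
  by (simp_all add: tame_grp_def wild_grp_def)

lemma cp_tame_grp: "cp {} (\<lambda>z. tame_grp m (pfst z) (psnd z))"
  unfolding tame_grp_def by (intro c_rules)

lemma cp_wild_grp: "cp {} (\<lambda>z. wild_grp m (pfst z) (psnd z))"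
  unfolding wild_grp_def first_halt_def by (intro cp_halt_wit cp_if c_rules)

lemma tame_grp_eq: "{t. tame_grp m g t} = (if g < m then UNIV else {..g})"
  by (auto simp: tame_grp_def)

lemma first_halt_unique: "first_halt e s \<Longrightarrow> first_halt e s' \<Longrightarrow> s = s'"
  unfolding first_halt_def by (metis linorder_cases)

lemma finite_wild_grp: assumes "\<not> g < m" shows "finite {t. wild_grp m g t}"
proof (cases "pfst (g - m) = 0")
  case True
  then show ?thesis using assms by (simp add: wild_grp_def)
next
  case False
  let ?e = "psnd (g - m)"
  have "{t. wild_grp m g t} \<subseteq> {0} \<union> (\<Union>s\<in>{s. first_halt ?e s}. (\<lambda>i. Suc (prod_encode (s, i))) ` {..s})"
  proof
    fix t assume t: "t \<in> {t. wild_grp m g t}"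
    show "t \<in> {0} \<union> (\<Union>s\<in>{s. first_halt ?e s}. (\<lambda>i. Suc (prod_encode (s, i))) ` {..s})"
    proof (cases t)
      case (Suc u)
      then have "first_halt ?e (pfst u)" "psnd u \<le> pfst u" "t = Suc (prod_encode (pfst u, psnd u))"
        using t assms False by (auto simp: wild_grp_def)
      then show ?thesis by blast
    qed simp
  qed
  moreover have "finite {s. first_halt ?e s}"
  proof (cases "\<exists>s. first_halt ?e s")
    case True
    then obtain s where "{s. first_halt ?e s} \<subseteq> {s}" using first_halt_unique by blast
    then show ?thesis by (rule finite_subset) simp
  qed simp
  ultimately show ?thesis by (elim finite_subset) simp
qed

lemma infinite_tame_grp: "infinite {t. tame_grp m g t} \<longleftrightarrow> g < m"
  by (simp add: tame_grp_eq)

lemma infinite_wild_grp: "infinite {t. wild_grp m g t} \<longleftrightarrow> g < m"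
  using finite_wild_grp by (auto simp: wild_grp_def)

lemma infinite_big_grpI:
  assumes "inj h" "\<And>e. k \<le> e \<Longrightarrow> {..e} \<subseteq> {t. G (h e) t}"
  shows "infinite {g. big k {t. G g t}}"
proof -
  have "big k {t. G (h e) t}" if "k \<le> e" for e
    unfolding big_def using card_mono[OF _ assms(2)[OF that]] that by fastforce
  then have "h ` {k..} \<subseteq> {g. big k {t. G g t}}" by auto
  moreover have "infinite (h ` {k..})"
    using finite_imageD[OF _ inj_on_subset[OF assms(1) subset_UNIV]] infinite_Ici by blast
  ultimately show ?thesis using finite_subset by blast
qed

lemma big_tame_grp: "infinite {g. big k {t. tame_grp m g t}}"
  by (rule infinite_big_grpI[of id]) (auto simp: tame_grp_def)

lemma big_wild_grp: "infinite {g. big k {t. wild_grp m g t}}"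
  by (rule infinite_big_grpI[of "\<lambda>e. m + prod_encode (0, e)"])
    (auto simp: wild_grp_def intro: injI order_trans[OF _ trans_le_add2[OF le_prod_encode_2]])

lemma unbounded_lower_bound:
  assumes R: "equiv UNIV R" and inf: "\<not> many UNIV R infinite" and big: "\<And>k. many UNIV R (big k)"
    and X: "be_cat_computes X UNIV R"
  shows "turing_le halting_set X"
proof -
  obtain rc where rc: "\<And>i. i < llen rc \<Longrightarrow> lnth rc i \<in> UNIV \<and> infinite (R `` {lnth rc i})"
    "\<And>i j. i < llen rc \<Longrightarrow> j < llen rc \<Longrightarrow> (lnth rc i, lnth rc j) \<in> R \<Longrightarrow> i = j"
    "\<And>x. x \<in> UNIV \<Longrightarrow> (\<exists>i<llen rc. (lnth rc i, x) \<in> R) \<longleftrightarrow> infinite (R `` {x})"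
    using class_representatives[OF R inf] by blast
  define m where "m = llen rc"
  let ?V = "grp_rel (wild_grp m)" and ?W = "grp_rel (tame_grp m)"
  have bV: "bi_embeddable UNIV ?V UNIV R"
    by (rule grp_bi_embeddable[where G = "wild_grp m" and rc = rc])
      (use rc infinite_wild_grp[of m] big_wild_grp[of _ m] wild_grp_less R big in \<open>simp_all add: m_def\<close>)
  have bW: "bi_embeddable UNIV ?W UNIV R"
    by (rule grp_bi_embeddable[where G = "tame_grp m" and rc = rc])
      (use rc infinite_tame_grp[of m] big_tame_grp[of _ m] tame_grp_less R big in \<open>simp_all add: m_def\<close>)
  obtain f where f: "is_embedding f UNIV ?V UNIV ?W" and "computes_on X UNIV f"
    using X[unfolded be_cat_computes_def] bV bW computable_struct_grp_rel[OF cp_wild_grp]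
      computable_struct_grp_rel[OF cp_tame_grp] by blast
  then have cf: "cf X f" unfolding computes_on_def cf_def by blast
  have rel: "(x, y) \<in> ?V \<longleftrightarrow> (f x, f y) \<in> ?W" for x y using f unfolding is_embedding_def by blast
  have fit: "fits (?V `` {x}) (?W `` {f x})" for x using fits_embedding(3)[OF f] by simp
  \<comment> \<open>The candidate 0 is accepted at once, so \<open>v e\<close> lies in the class
    attached to e and is computed without knowing whether e halts.\<close>
  define v where "v e = prod_encode (m + prod_encode (1, e), 0)" for e
  have wild_v: "wild_grp m (m + prod_encode (1, e)) 0" for e by (simp add: wild_grp_def)
  have fv: "\<not> pfst (f (v e)) < m" for e
  proof
    assume lt: "pfst (f (v e)) < m"
    \<comment> \<open>The embedding sends the m infinite classes injectively to the m infinite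
      classes of the other copy. By counting, these are all used up, and the class of
      \<open>v e\<close> has to go to a finite one.\<close>
    define p where "p i = pfst (f (prod_encode (i, 0)))" for i
    have p: "p i < m" if "i < m" for i
    proof -
      have "infinite (?V `` {prod_encode (i, 0)})"
        using that infinite_wild_grp by (simp add: infinite_grp_class wild_grp_def)
      then have "infinite (?W `` {f (prod_encode (i, 0))})" using fit[of "prod_encode (i, 0)"] unfolding fits_def by blast
      then show ?thesis unfolding p_def infinite_grp_class infinite_tame_grp by blast
    qed
    have "inj_on p {..<m}"
    proof (rule inj_onI)
      fix i j assume ij: "i \<in> {..<m}" "j \<in> {..<m}" "p i = p j"
      then have "(f (prod_encode (i, 0)), f (prod_encode (j, 0))) \<in> ?W"
        using p[of i] p[of j] unfolding p_def grp_rel_def tame_grp_def by simp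
      then have "(prod_encode (i, 0), prod_encode (j, 0)) \<in> ?V" by (simp only: rel)
      then show "i = j" unfolding grp_rel_def by fastforce
    qed
    then have "p ` {..<m} = {..<m}" using p by (intro endo_inj_surj) auto
    then obtain i where i: "i < m" "p i = pfst (f (v e))" using lt by (metis imageE lessThan_iff)
    then have "(f (prod_encode (i, 0)), f (v e)) \<in> ?W"
      using lt unfolding p_def grp_rel_def tame_grp_def by simp
    then have "(prod_encode (i, 0), v e) \<in> ?V" by (simp only: rel)
    then have "i = m + prod_encode (1, e)" unfolding v_def grp_rel_def by fastforce
    then show False using i(1) by simp
  qed
  have "e \<in> halting_set \<longleftrightarrow> (\<exists>s\<le>pfst (f (v e)). halt_wit e s)" for e
  proof
    assume "e \<in> halting_set"
    then obtain s where s: "halt_wit e s" unfolding halting_set_iff by blast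
    define s0 where "s0 = (LEAST s. halt_wit e s)"
    have s0: "first_halt e s0" unfolding first_halt_def s0_def
      using LeastI[of "halt_wit e", OF s] not_less_Least by blast
    let ?g = "m + prod_encode (1, e)" and ?h = "pfst (f (v e))"
    \<comment> \<open>The first witness contributes \<open>Suc s0\<close> elements, and the image
      class has at most \<open>Suc ?h\<close>. The two successors cancel and give
      \<open>s0 \<le> ?h\<close>.\<close>
    have sub: "(\<lambda>i. Suc (prod_encode (s0, i))) ` {..s0} \<subseteq> {t. wild_grp m ?g t}"
      using s0 by (auto simp: wild_grp_def)
    have fin: "finite {t. wild_grp m ?g t}" by (rule finite_wild_grp) simp
    have "card ((\<lambda>i. Suc (prod_encode (s0, i))) ` {..s0}) = Suc s0"
      by (subst card_image) (auto intro: inj_onI)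
    then have "Suc s0 \<le> card {t. wild_grp m ?g t}"
      using card_mono[OF fin sub] by (simp only:)
    also have "\<dots> = card (?V `` {v e})"
      using wild_v by (simp add: grp_rel_class v_def card_image[OF inj_pair])
    also have "\<dots> \<le> card (?W `` {f (v e)})"
      using fit[of "v e"] fv[of e] unfolding fits_def infinite_grp_class infinite_tame_grp by blast
    also have "\<dots> \<le> Suc ?h"
      using fv[of e] by (simp add: grp_rel_class tame_grp_eq card_image[OF inj_pair])
    finally show "\<exists>s\<le>?h. halt_wit e s" using s0 unfolding first_halt_def by auto
  qed (auto simp: halting_set_iff)
  moreover have "cp X (\<lambda>e. \<exists>s\<le>pfst (f (v e)). halt_wit e s)"
    unfolding v_def by (intro cp_halt_wit cf_comp[OF cf] c_rules)
  ultimately show ?thesis unfolding turing_le_iff by simp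
qed

section \<open>Structures with infinitely many infinite classes\<close>

text \<open>If each position allows at most one entry, a list is determined by its length, and a
  position without an entry bounds all lengths. In this way a statement \<forall>j. \<exists>x
  becomes the infinity of a set.\<close>

lemma infinite_unique_lists:
  assumes uniq: "\<And>j x y. R j x \<Longrightarrow> R j y \<Longrightarrow> x = y"
  shows "infinite {l. \<forall>j<llen l. R j (lnth l j)} \<longleftrightarrow> (\<forall>j. \<exists>x. R j x)"
    and "inj_on llen {l. \<forall>j<llen l. R j (lnth l j)}"
proof -
  let ?L = "{l. \<forall>j<llen l. R j (lnth l j)}"
  show inj: "inj_on llen ?L"
  proof (rule inj_onI)
    fix k l assume k: "k \<in> ?L" and l: "l \<in> ?L" and len: "llen k = llen l"
    have "list_decode k = list_decode l"
    proof (rule nth_equalityI)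
      show "length (list_decode k) = length (list_decode l)" using len by (simp add: llen_def)
      fix i assume "i < length (list_decode k)"
      then have i: "i < llen k" "i < llen l" using len by (simp_all add: llen_def)
      then have "lnth k i = lnth l i" using k l uniq by blast
      then show "list_decode k ! i = list_decode l ! i" using i by (simp add: lnth_eq_nth)
    qed
    then show "k = l" by (metis list_decode_inverse)
  qed
  show "infinite ?L \<longleftrightarrow> (\<forall>j. \<exists>x. R j x)"
  proof
    assume L: "infinite ?L"
    show "\<forall>j. \<exists>x. R j x"
    proof (rule ccontr)
      assume "\<not> (\<forall>j. \<exists>x. R j x)"
      then obtain j where j: "\<And>x. \<not> R j x" by blast
      then have "llen ` ?L \<subseteq> {..j}" by (auto simp: not_le) (meson not_le)
      then show False using L finite_imageD[OF _ inj] finite_subset by blast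
    qed
  next
    assume "\<forall>j. \<exists>x. R j x"
    then obtain w where w: "\<And>j. R j (w j)" by metis
    have "range (\<lambda>k. list_encode (map w [0..<k])) \<subseteq> ?L"
      using w by (auto simp: lnth_list_encode)
    moreover have "inj (\<lambda>k. list_encode (map w [0..<k]))"
      by (rule injI) (metis diff_zero length_map length_upt list_encode_eq)
    ultimately show "infinite ?L" using range_inj_infinite finite_subset by blast
  qed
qed

text \<open>A canonical witness of \<open>\<exists>b. \<forall>c. \<exists>d. Q b c d\<close> is a list whose length is the least b satisfying the
  rest of the formula, and whose i-th entry is the least c refuting it for the number i < b. Being such
  a list is the condition \<open>\<forall>m. \<exists>d. wit_level Q w m d\<close>, which has one quantifier alternation less.\<close>
definition wit_level :: "(nat \<Rightarrow> nat \<Rightarrow> nat \<Rightarrow> bool) \<Rightarrow> nat \<Rightarrow> nat \<Rightarrow> nat \<Rightarrow> bool" where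
  "wit_level Q w m d \<longleftrightarrow> (\<exists>d'\<le>d. Q (llen w) m d') \<and>
     (\<forall>i<llen w. \<not> Q i (lnth w i) m \<and> (\<forall>c<lnth w i. \<exists>d'\<le>d. Q i c d'))"

definition wit :: "(nat \<Rightarrow> nat \<Rightarrow> nat \<Rightarrow> bool) \<Rightarrow> nat \<Rightarrow> bool" where
  "wit Q w \<longleftrightarrow> (\<forall>c. \<exists>d. Q (llen w) c d) \<and>
     (\<forall>i<llen w. (\<forall>d. \<not> Q i (lnth w i) d) \<and> (\<forall>c<lnth w i. \<exists>d. Q i c d))"

lemma ex_uniform_bound:
  assumes "\<And>i d d'. P i d \<Longrightarrow> d \<le> d' \<Longrightarrow> P i d'" "\<forall>i<n. \<exists>d. P i d"
  shows "\<exists>d::nat. \<forall>i<(n::nat). P i d"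
  using assms(2)
proof (induction n)
  case (Suc n)
  then obtain d d' where "\<forall>i<n. P i d" "P n d'" by auto
  then have "\<forall>i<Suc n. P i (max d d')" using assms(1) by (metis less_Suc_eq max.cobounded1 max.cobounded2)
  then show ?case by blast
qed simp

lemma wit_level_mono: "wit_level Q w m d \<Longrightarrow> d \<le> d' \<Longrightarrow> wit_level Q w m d'"
  unfolding wit_level_def by (meson order_trans)

text \<open>Finitely many values of d have a common bound, which moves the existential quantifier
  outside the bounded ones. The single variable m serves both as the c of the condition to be
  verified and as the d against which the refutations are tested.\<close>

lemma wit_iff: "wit Q w \<longleftrightarrow> (\<forall>m. \<exists>d. wit_level Q w m d)"
proof
  assume w: "wit Q w"
  show "\<forall>m. \<exists>d. wit_level Q w m d"
  proof
    fix m
    obtain d where d: "Q (llen w) m d" using w unfolding wit_def by blast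
    have "\<exists>d. \<forall>c<lnth w i. \<exists>d'\<le>d. Q i c d'" if "i < llen w" for i
    proof (rule ex_uniform_bound)
      show "\<forall>c<lnth w i. \<exists>d. \<exists>d'\<le>d. Q i c d'" using w that unfolding wit_def by blast
    qed (meson order_trans)
    then have "\<exists>e. \<forall>i<llen w. \<forall>c<lnth w i. \<exists>d'\<le>e. Q i c d'"
      by (intro ex_uniform_bound) (meson order_trans, blast)
    then obtain e where e: "\<forall>i<llen w. \<forall>c<lnth w i. \<exists>d'\<le>e. Q i c d'" by blast
    have "wit_level Q w m (max d e)"
      unfolding wit_level_def
    proof (intro conjI allI impI)
      show "\<exists>d'\<le>max d e. Q (llen w) m d'" using d max.cobounded1 by blast
      fix i assume i: "i < llen w"
      show "\<not> Q i (lnth w i) m" using w i unfolding wit_def by blast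
      fix c assume "c < lnth w i"
      then obtain d' where "d' \<le> e" "Q i c d'" using e i by blast
      then show "\<exists>d'\<le>max d e. Q i c d'" by (intro exI[of _ d']) simp
    qed
    then show "\<exists>d. wit_level Q w m d" by blast
  qed
next
  assume "\<forall>m. \<exists>d. wit_level Q w m d"
  then show "wit Q w" unfolding wit_def wit_level_def by meson
qed

text \<open>If one list were shorter, the longer one would contain a refutation of the number that
  the shorter one claims to verify. Entries agree because they are least refutations.\<close>

lemma wit_unique:
  assumes v: "wit Q v" and w: "wit Q w" shows "v = w"
proof -
  have len: "llen v = llen w"
  proof (cases "llen v" "llen w" rule: linorder_cases)
    case less
    then show ?thesis using v w unfolding wit_def by meson
  next
    case greater
    then show ?thesis using v w unfolding wit_def by meson
  qed
  let ?R = "\<lambda>i c. (\<forall>d. \<not> Q i c d) \<and> (\<forall>c'<c. \<exists>d. Q i c' d)"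
  have "inj_on llen {l. \<forall>j<llen l. ?R j (lnth l j)}"
    by (rule infinite_unique_lists(2)) (metis linorder_cases)
  moreover have "v \<in> {l. \<forall>j<llen l. ?R j (lnth l j)}" "w \<in> {l. \<forall>j<llen l. ?R j (lnth l j)}"
    using v w unfolding wit_def by blast+
  ultimately show ?thesis using len by (simp only: inj_on_def)
qed

lemma ex_wit_iff: "(\<exists>w. wit Q w) \<longleftrightarrow> (\<exists>b. \<forall>c. \<exists>d. Q b c d)"
proof
  assume "\<exists>b. \<forall>c. \<exists>d. Q b c d"
  define b where "b = (LEAST b. \<forall>c. \<exists>d. Q b c d)"
  have b: "\<forall>c. \<exists>d. Q b c d" unfolding b_def by (rule LeastI_ex) fact
  define c where "c i = (LEAST c. \<forall>d. \<not> Q i c d)" for i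
  have c: "(\<forall>d. \<not> Q i (c i) d) \<and> (\<forall>c'<c i. \<exists>d. Q i c' d)" if "i < b" for i
  proof -
    have "\<exists>c. \<forall>d. \<not> Q i c d" using not_less_Least[of i "\<lambda>b. \<forall>c. \<exists>d. Q b c d"] that unfolding b_def by blast
    from LeastI_ex[OF this] show ?thesis unfolding c_def using not_less_Least by blast
  qed
  have "wit Q (list_encode (map c [0..<b]))"
    unfolding wit_def using b c by (simp add: lnth_list_encode)
  then show "\<exists>w. wit Q w" by blast
qed (auto simp: wit_def)

definition wit_lists :: "(nat \<Rightarrow> nat \<Rightarrow> nat \<Rightarrow> nat \<Rightarrow> bool) \<Rightarrow> nat set" where
  "wit_lists Q = {l. \<forall>j<llen l. wit (Q j) (lnth l j)}"

lemma infinite_wit_lists: "infinite (wit_lists Q) \<longleftrightarrow> (\<forall>a. \<exists>b. \<forall>c. \<exists>d. Q a b c d)"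
  unfolding wit_lists_def ex_wit_iff[symmetric]
  by (rule infinite_unique_lists(1)[of "\<lambda>j. wit (Q j)"]) (rule wit_unique)

lemma inj_llen_wit_lists: "inj_on llen (wit_lists Q)"
  unfolding wit_lists_def by (rule infinite_unique_lists(2)) (rule wit_unique)

definition lists_level :: "(nat \<Rightarrow> nat \<Rightarrow> nat \<Rightarrow> nat \<Rightarrow> bool) \<Rightarrow> nat \<Rightarrow> nat \<Rightarrow> nat \<Rightarrow> bool" where
  "lists_level Q l m d \<longleftrightarrow> (\<forall>j<llen l. wit_level (Q j) (lnth l j) m d)"

lemma wit_lists_iff: "l \<in> wit_lists Q \<longleftrightarrow> (\<forall>m. \<exists>d. lists_level Q l m d)"
proof
  assume l: "l \<in> wit_lists Q"
  show "\<forall>m. \<exists>d. lists_level Q l m d"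
    unfolding lists_level_def
    by (intro allI ex_uniform_bound) (use l wit_level_mono in \<open>auto simp: wit_lists_def wit_iff\<close>)
qed (auto simp: wit_lists_def wit_iff lists_level_def)

text \<open>The groups whose number has a nonzero first component only provide arbitrarily large finite
  classes.\<close>
definition wit_grp :: "(nat \<Rightarrow> nat \<Rightarrow> nat \<Rightarrow> nat \<Rightarrow> bool) \<Rightarrow> nat \<Rightarrow> nat \<Rightarrow> bool" where
  "wit_grp Q g t \<longleftrightarrow> (if pfst g = 0
     then \<forall>m<llen t. lists_level Q (psnd g) m (lnth t m) \<and> (\<forall>d<lnth t m. \<not> lists_level Q (psnd g) m d)
     else t \<le> psnd g)"

text \<open>The lists of unique entries are used a second time, now inside a group: its members
  record the least d for the first levels m. A level that fails bounds their lengths and leaves the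
  group finite.\<close>

lemma infinite_wit_grp: "infinite {t. wit_grp Q g t} \<longleftrightarrow> pfst g = 0 \<and> psnd g \<in> wit_lists Q"
proof (cases "pfst g = 0")
  case True
  let ?R = "\<lambda>m x. lists_level Q (psnd g) m x \<and> (\<forall>d<x. \<not> lists_level Q (psnd g) m d)"
  have "infinite {t. \<forall>m<llen t. ?R m (lnth t m)} \<longleftrightarrow> (\<forall>m. \<exists>d. ?R m d)"
    by (rule infinite_unique_lists(1)) (metis linorder_cases)
  moreover have "(\<exists>d. ?R m d) \<longleftrightarrow> (\<exists>d. lists_level Q (psnd g) m d)" for m
    by (metis LeastI not_less_Least)
  ultimately show ?thesis using True by (simp add: wit_grp_def wit_lists_iff)
qed (simp add: wit_grp_def)

lemma many_infinite_wit_grp: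
  "many UNIV (grp_rel (wit_grp Q)) infinite \<longleftrightarrow> (\<forall>a. \<exists>b. \<forall>c. \<exists>d. Q a b c d)"
proof -
  have "{g. infinite {t. wit_grp Q g t}} = (\<lambda>l. prod_encode (0, l)) ` wit_lists Q"
    unfolding infinite_wit_grp by (auto intro!: image_eqI[of _ _ "psnd _"]) (metis pair_pfst_psnd)
  then show ?thesis unfolding many_infinite_grp
    by (simp add: finite_image_iff[OF inj_pair] flip: infinite_wit_lists)
qed

lemma many_big_wit_grp: "many UNIV (grp_rel (wit_grp Q)) (big k)"
  by (rule many_big_grp[OF infinite_big_grpI[of "\<lambda>e. prod_encode (1, e)"]])
    (auto simp: wit_grp_def intro: injI)

text \<open>The formula keeps a parameter n, because the reduction needs the groups to be decidable
  uniformly in n.\<close>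

lemma cp_wit_grp:
  assumes Q: "\<And>n a b c d. cf X n \<Longrightarrow> cf X a \<Longrightarrow> cf X b \<Longrightarrow> cf X c \<Longrightarrow> cf X d \<Longrightarrow>
      cp X (\<lambda>x. Q (n x) (a x) (b x) (c x) (d x))"
    and "cf X n" "cf X g" "cf X t"
  shows "cp X (\<lambda>x. wit_grp (Q (n x)) (g x) (t x))"
  by (rule cp_comp3[where P = "\<lambda>n g t. wit_grp (Q n) g t", OF _ assms(2-4)])
    (unfold wit_grp_def lists_level_def wit_level_def, intro Q cp_if c_rules)

text \<open>The value b = 0 claims that a is outside \<open>diag_set\<close>, and b > 0 that
  \<open>b - 1\<close> witnesses membership. One of the claims is always correct, and a correct b
  reveals which.\<close>

definition diag_formula :: "nat \<Rightarrow> nat \<Rightarrow> nat \<Rightarrow> nat \<Rightarrow> bool" where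
  "diag_formula a b c d \<longleftrightarrow> (if b = 0 then \<not> diag_wit a c d else diag_wit a (b - 1) c)"

lemma diag_formula_holds:
  "(\<forall>c. \<exists>d. diag_formula a b c d) \<Longrightarrow> b = 0 \<longleftrightarrow> a \<notin> diag_set"
  unfolding diag_formula_def diag_set_iff by (cases b) auto

lemma diag_formula_ex: "\<exists>b. \<forall>c. \<exists>d. diag_formula a b c d"
proof (cases "a \<in> diag_set")
  case True
  then obtain z where "\<And>u. diag_wit a z u" unfolding diag_set_iff by blast
  then show ?thesis unfolding diag_formula_def by (intro exI[of _ "Suc z"]) simp
next
  case False
  then show ?thesis unfolding diag_formula_def diag_set_iff by (intro exI[of _ 0]) auto
qed

lemma many_infinite_not_be_cat:
  assumes R: "equiv UNIV R" and inf: "many UNIV R infinite"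
  shows "\<not> be_cat_computes halting_set UNIV R"
proof
  assume K: "be_cat_computes halting_set UNIV R"
  let ?G = "\<lambda>g t :: nat. True" and ?H = "wit_grp diag_formula"
  have base: "cp {} (\<lambda>z. diag_formula (pfst z) (pfst (psnd z)) (pfst (psnd (psnd z))) (psnd (psnd (psnd z))))"
    unfolding diag_formula_def
    by (intro cp_if cp_comp3[where P = diag_wit, OF cp_diag_wit] c_rules)
  have "cp {} (\<lambda>x. diag_formula (a x) (b x) (c x) (d x))"
    if "cf {} a" "cf {} b" "cf {} c" "cf {} d" for a b c d
    using cp_comp[OF base, of "\<lambda>x. prod_encode (a x, prod_encode (b x, prod_encode (c x, d x)))"] that
    by (simp add: cf_pair)
  then have "cp {} (\<lambda>z. ?H (pfst z) (psnd z))"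
    using cp_wit_grp[of "{}" "\<lambda>_. diag_formula" "\<lambda>_. 0" pfst psnd] cf_pfst[OF cf_id] cf_psnd[OF cf_id] cf_const by blast
  then have H: "computable_struct UNIV (grp_rel ?H)" by (rule computable_struct_grp_rel)
  have G: "computable_struct UNIV (grp_rel ?G)" by (rule computable_struct_grp_rel[OF cp_const])
  have mH: "many UNIV (grp_rel ?H) infinite"
    unfolding many_infinite_wit_grp using diag_formula_ex by blast
  have mG: "many UNIV (grp_rel ?G) infinite"
    unfolding many_infinite_grp by simp
  have "bi_embeddable UNIV (grp_rel ?G) UNIV R" "bi_embeddable UNIV (grp_rel ?H) UNIV R"
    unfolding bi_embeddable_def
    by (intro conjI embeds_many_infinite R equiv_grp_rel inf mG mH)+
  then obtain f where f: "is_embedding f UNIV (grp_rel ?G) UNIV (grp_rel ?H)" and "computes_on halting_set UNIV f"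
    using K[unfolded be_cat_computes_def] G H by blast
  then have cf: "cf halting_set f" unfolding computes_on_def cf_def by blast
  \<comment> \<open>The numbers \<open>prod_encode (i, 0)\<close> represent the classes of the copy
    that has only infinite ones. Their images lie in infinite groups, and \<open>s i\<close> is the
    list of canonical witnesses attached to the group.\<close>
  define s where "s i = psnd (pfst (f (prod_encode (i, 0))))" for i
  have s: "pfst (pfst (f (prod_encode (i, 0)))) = 0 \<and> s i \<in> wit_lists diag_formula \<and>
      ?H (pfst (f (prod_encode (i, 0)))) (psnd (f (prod_encode (i, 0))))" for i
  proof -
    have "infinite (grp_rel ?G `` {prod_encode (i, 0)})" by (simp add: infinite_grp_class)
    then have "infinite (grp_rel ?H `` {f (prod_encode (i, 0))})"
      using fits_embedding(3)[OF f, of "prod_encode (i, 0)"] unfolding fits_def by auto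
    then show ?thesis unfolding infinite_grp_class infinite_wit_grp s_def by blast
  qed
  have "inj s"
  proof (rule injI)
    fix i j assume "s i = s j"
    then have "pfst (f (prod_encode (i, 0))) = pfst (f (prod_encode (j, 0)))"
      using s[of i] s[of j] unfolding s_def by (metis pair_pfst_psnd)
    then have "(f (prod_encode (i, 0)), f (prod_encode (j, 0))) \<in> grp_rel ?H"
      using s[of i] s[of j] by (simp add: grp_rel_def)
    then have "(prod_encode (i, 0), prod_encode (j, 0)) \<in> grp_rel ?G"
      using f unfolding is_embedding_def by blast
    then show "i = j" by (auto simp: grp_rel_def)
  qed
  \<comment> \<open>The lists \<open>s i\<close> are pairwise different, and canonical lists of
    equal length coincide, so their lengths are unbounded.\<close>
  have long: "\<exists>i. a < llen (s i)" for a
  proof (rule ccontr)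
    assume "\<nexists>i. a < llen (s i)"
    then have "llen ` range s \<subseteq> {..a}" by (auto simp: not_less)
    moreover have "inj_on llen (range s)" by (rule inj_on_subset[OF inj_llen_wit_lists]) (use s in auto)
    ultimately have "finite (range s)" using finite_imageD finite_subset by blast
    then show False using \<open>inj s\<close> range_inj_infinite by blast
  qed
  let ?i = "\<lambda>a. LEAST i. a < llen (s i)"
  \<comment> \<open>Entry number a of a long enough list is the canonical witness for a, and the
    length of that entry is the b of \<open>diag_formula\<close>.\<close>
  have "a \<in> diag_set \<longleftrightarrow> llen (lnth (s (?i a)) a) \<noteq> 0" for a
  proof -
    have "a < llen (s (?i a))" by (rule LeastI_ex[OF long])
    then have "wit (diag_formula a) (lnth (s (?i a)) a)" using s unfolding wit_lists_def by blast
    then have "\<forall>c. \<exists>d. diag_formula a (llen (lnth (s (?i a)) a)) c d" unfolding wit_def by blast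
    from diag_formula_holds[OF this] show ?thesis by argo
  qed
  moreover have "cp halting_set (\<lambda>a. llen (lnth (s (?i a)) a) \<noteq> 0)"
  proof -
    have cs: "cf halting_set s" unfolding s_def[abs_def] by (intro cf_comp[OF cf] c_rules)
    have "cf halting_set ?i" by (rule cf_Least[OF _ long]) (intro cf_comp[OF cs] c_rules)
    then show ?thesis by (intro cf_comp[OF cs] c_rules)
  qed
  ultimately show False using diag_set_not_computable by simp
qed

theorem degree_halting_set_iff:
  assumes R: "equiv UNIV R"
  shows "be_cat_degree_is halting_set UNIV R \<longleftrightarrow> \<not> many UNIV R infinite \<and> (\<forall>k. many UNIV R (big k))"
proof
  assume d: "be_cat_degree_is halting_set UNIV R"
  have "many UNIV R (big k)" for k
  proof (rule ccontr)
    assume "\<not> many UNIV R (big k)"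
    then have "turing_le halting_set {}"
      using d bounded_be_cat_computes_empty[OF R] unfolding be_cat_degree_is_def by blast
    then show False using halting_set_undecidable by (simp add: turing_le_iff)
  qed
  then show "\<not> many UNIV R infinite \<and> (\<forall>k. many UNIV R (big k))"
    using d many_infinite_not_be_cat[OF R] unfolding be_cat_degree_is_def by blast
next
  assume "\<not> many UNIV R infinite \<and> (\<forall>k. many UNIV R (big k))"
  then show "be_cat_degree_is halting_set UNIV R"
    unfolding be_cat_degree_is_def
    using unbounded_be_cat_computes_halting_set[OF R] unbounded_lower_bound[OF R] by blast
qed

section \<open>The index set\<close>

lemma Sg_phi:
  assumes "cf {} e" "cf {} x" "cf {} y"
  shows "Sg (Suc 0) (\<lambda>z. phi {} (e z) [x z, y z] v)"
proof -
  have "cp {} (\<lambda>w. valid (psnd w) \<and> oracle_ok {} (psnd w) \<and>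
      lmem (fev (e (pfst w)) (lcons (x (pfst w)) (lcons (y (pfst w)) 0)) v) (psnd w))"
    by (intro cp_valid cp_oracle_ok_empty cf_fev c_rules cf_comp[OF assms(1)] cf_comp[OF assms(2)]
        cf_comp[OF assms(3)])
  then have "Sg (Suc 0) (\<lambda>z. \<exists>c. valid c \<and> oracle_ok {} c \<and>
      lmem (fev (e z) (lcons (x z) (lcons (y z) 0)) v) c)"
    by (intro Sg_ex_Pg) (simp add: Pg_0)
  moreover have "lcons (x z) (lcons (y z) 0) = list_encode [x z, y z]" for z
    by (simp add: lcons_def)
  ultimately show ?thesis unfolding phi_list_encode_iff by simp
qed

lemma cp_Pg: "cp {} P \<Longrightarrow> Pg k P"
  by (induction k) (auto simp: Pg_0 intro: Pg_Suc)

lemma cp_Sg: "cp {} P \<Longrightarrow> Sg k P"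
  by (induction k) (auto intro: Sg_Suc simp del: Sg.simps(2))

lemma C_rel_iff: "(x, y) \<in> C_rel e \<longleftrightarrow> phi {} e [x, y] 1"
  by (simp add: C_rel_def)

text \<open>Being related has both a \<open>\<Sigma>\<^sub>1\<close> and, by totality, a
  \<open>\<Pi>\<^sub>1\<close> description; choosing the right one saves a quantifier later.\<close>

lemma C_rel_not_iff: "C_is_comp_eq e \<Longrightarrow> (x, y) \<in> C_rel e \<longleftrightarrow> \<not> phi {} e [x, y] 0"
  unfolding C_rel_iff C_is_comp_eq_def using phi_det zero_neq_one by blast

lemma C_is_comp_eq_iff:
  "C_is_comp_eq e \<longleftrightarrow> (\<forall>x y. phi {} e [x, y] 0 \<or> phi {} e [x, y] 1) \<and> (\<forall>x. phi {} e [x, x] 1) \<and>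
     (\<forall>x y. \<not> phi {} e [x, y] 1 \<or> phi {} e [y, x] 1) \<and>
     (\<forall>x y z. (\<not> phi {} e [x, y] 1 \<or> \<not> phi {} e [y, z] 1) \<or> phi {} e [x, z] 1)"
  unfolding C_is_comp_eq_def equiv_def refl_on_def sym_def trans_def C_rel_iff
  by simp

lemma Pg_C_is_comp_eq: "Pg (Suc (Suc 0)) C_is_comp_eq"
proof -
  have "Pg (Suc (Suc 0)) (\<lambda>e. C_is_comp_eq e)"
    unfolding C_is_comp_eq_iff
    by (intro Pg_conj Pg_all Pg_disj Sg_imp_Pg_Suc[OF Sg_phi] Pg_Suc[OF Pg_not[OF Sg_phi]] c_rules)
  then show ?thesis .
qed

lemma not_many_infinite_iff:
  assumes R: "equiv UNIV R"
  shows "\<not> many UNIV R infinite \<longleftrightarrow>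
    (\<exists>n. \<forall>x. (\<exists>y. y < n \<and> (y, x) \<in> R) \<or> (\<exists>s. \<forall>t. t < s \<or> (x, t) \<notin> R))"
proof -
  have fin: "finite (R `` {x}) \<longleftrightarrow> (\<exists>s. \<forall>t. t < s \<or> (x, t) \<notin> R)" for x
    unfolding finite_nat_set_iff_bounded by auto
  show ?thesis
  proof
    assume "\<not> many UNIV R infinite"
    then obtain F where F0: "finite F \<and> F \<subseteq> UNIV"
        "\<not> (\<exists>x\<in>UNIV. infinite (R `` {x}) \<and> (\<forall>y\<in>F. (y, x) \<notin> R))"
      unfolding many_def by (simp only: not_all not_imp) blast
    then have F: "finite F" "\<And>x. infinite (R `` {x}) \<Longrightarrow> \<exists>y\<in>F. (y, x) \<in> R" by blast+
    obtain n where n: "\<forall>y\<in>F. y < n" using F(1) unfolding finite_nat_set_iff_bounded by blast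
    show "\<exists>n. \<forall>x. (\<exists>y. y < n \<and> (y, x) \<in> R) \<or> (\<exists>s. \<forall>t. t < s \<or> (x, t) \<notin> R)"
    proof (intro exI allI)
      fix x show "(\<exists>y. y < n \<and> (y, x) \<in> R) \<or> (\<exists>s. \<forall>t. t < s \<or> (x, t) \<notin> R)"
        using F(2)[of x] n unfolding fin[symmetric] by blast
    qed
  next
    assume "\<exists>n. \<forall>x. (\<exists>y. y < n \<and> (y, x) \<in> R) \<or> (\<exists>s. \<forall>t. t < s \<or> (x, t) \<notin> R)"
    then obtain n where n: "\<And>x. (\<exists>y<n. (y, x) \<in> R) \<or> finite (R `` {x})" unfolding fin by blast
    show "\<not> many UNIV R infinite"
    proof
      assume "many UNIV R infinite"
      then obtain x where "infinite (R `` {x})" "\<forall>y\<in>{..<n}. (y, x) \<notin> R"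
        unfolding many_def by (meson finite_lessThan subset_UNIV)
      then show False using n[of x] by auto
    qed
  qed
qed

text \<open>A list without repetitions witnesses the size. Membership of its entries is written with
  an unbounded quantifier and a disjunction, so that \<open>Pg_all\<close> and
  \<open>Pg_disj\<close> apply; bounded quantifiers remain only in the decidable part.\<close>

lemma big_iff_list:
  "big k C \<longleftrightarrow> (\<exists>l. llen l = k \<and> (\<forall>i<llen l. \<forall>j<i. lnth l i \<noteq> lnth l j) \<and> (\<forall>i. llen l \<le> i \<or> lnth l i \<in> C))"
proof
  assume "big k C"
  then obtain B where B: "B \<subseteq> C" "finite B" "card B = k"
  proof (cases "finite C")
    case True
    then have "k \<le> card C" using \<open>big k C\<close> unfolding big_def by blast
    from obtain_subset_with_card_n[OF this] show ?thesis using that by blast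
  next
    case False
    from infinite_arbitrarily_large[OF this, of k] show ?thesis using that by blast
  qed
  then obtain xs where xs: "set xs = B" "distinct xs" using finite_distinct_list by blast
  have "length xs = k" using distinct_card[OF xs(2)] xs(1) B(3) by simp
  have mem: "length xs \<le> i \<or> lnth (list_encode xs) i \<in> C" for i
    using xs(1) B(1) nth_mem[of i xs] by (cases "i < length xs") (auto simp: lnth_list_encode)
  show "\<exists>l. llen l = k \<and> (\<forall>i<llen l. \<forall>j<i. lnth l i \<noteq> lnth l j) \<and> (\<forall>i. llen l \<le> i \<or> lnth l i \<in> C)"
    using xs(2) \<open>length xs = k\<close> mem
    by (intro exI[of _ "list_encode xs"]) (simp add: lnth_list_encode nth_eq_iff_index_eq)
next
  assume "\<exists>l. llen l = k \<and> (\<forall>i<llen l. \<forall>j<i. lnth l i \<noteq> lnth l j) \<and> (\<forall>i. llen l \<le> i \<or> lnth l i \<in> C)"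
  then obtain l where l: "llen l = k" "\<And>i j. i < k \<Longrightarrow> j < i \<Longrightarrow> lnth l i \<noteq> lnth l j" "\<And>i. i < k \<Longrightarrow> lnth l i \<in> C"
    by (auto simp: not_le[symmetric])
  have "inj_on (lnth l) {..<k}" by (rule inj_onI) (metis l(2) lessThan_iff linorder_cases)
  then have "card (lnth l ` {..<k}) = k" by (simp add: card_image)
  then show "big k C" unfolding big_def using card_mono[of C "lnth l ` {..<k}"] l(3) by fastforce
qed

lemma many_big_iff:
  assumes R: "equiv UNIV R"
  shows "many UNIV R (big k) \<longleftrightarrow> (\<forall>n. \<exists>x l. (\<forall>y. n \<le> y \<or> (y, x) \<notin> R) \<and>
    llen l = k \<and> (\<forall>i<llen l. \<forall>j<i. lnth l i \<noteq> lnth l j) \<and> (\<forall>i. llen l \<le> i \<or> (x, lnth l i) \<in> R))"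
proof -
  have *: "(\<exists>l. (\<forall>y. n \<le> y \<or> (y, x) \<notin> R) \<and> llen l = k \<and> (\<forall>i<llen l. \<forall>j<i. lnth l i \<noteq> lnth l j) \<and>
      (\<forall>i. llen l \<le> i \<or> (x, lnth l i) \<in> R)) \<longleftrightarrow> big k (R `` {x}) \<and> (\<forall>y\<in>{..<n}. (y, x) \<notin> R)" for n x
    unfolding big_iff_list by (auto simp: not_le[symmetric])
  show ?thesis
    unfolding *
  proof
    assume "many UNIV R (big k)"
    then show "\<forall>n. \<exists>x. big k (R `` {x}) \<and> (\<forall>y\<in>{..<n}. (y, x) \<notin> R)"
      unfolding many_def by (meson finite_lessThan subset_UNIV)
  next
    assume n: "\<forall>n. \<exists>x. big k (R `` {x}) \<and> (\<forall>y\<in>{..<n}. (y, x) \<notin> R)"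
    show "many UNIV R (big k)"
      unfolding many_def
    proof (intro allI impI)
      fix F :: "nat set" assume "finite F \<and> F \<subseteq> UNIV"
      then obtain b where b: "F \<subseteq> {..<b}" by (meson finite_nat_iff_bounded)
      obtain x where "big k (R `` {x})" "\<forall>y\<in>{..<b}. (y, x) \<notin> R" using n by blast
      then show "\<exists>x\<in>UNIV. big k (R `` {x}) \<and> (\<forall>y\<in>F. (y, x) \<notin> R)" using b by blast
    qed
  qed
qed

text \<open>Membership of the list entries uses the value 0 under a negation. Everything behind the
  witnesses x and l is then \<open>\<Pi>\<^sub>1\<close>, and the last conjunct is
  \<open>\<Pi>\<^sub>3\<close>.\<close>

lemma index_set_iff:
  "C_is_comp_eq e \<and> be_cat_degree_is halting_set UNIV (C_rel e) \<longleftrightarrow> C_is_comp_eq e \<and>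
    (\<exists>n. \<forall>x. (\<exists>y. y < n \<and> phi {} e [y, x] 1) \<or> (\<exists>s. \<forall>t. t < s \<or> \<not> phi {} e [x, t] 1)) \<and>
    (\<forall>k n. \<exists>x l. (\<forall>y. n \<le> y \<or> \<not> phi {} e [y, x] 1) \<and> llen l = k \<and>
       (\<forall>i<llen l. \<forall>j<i. lnth l i \<noteq> lnth l j) \<and> (\<forall>i. llen l \<le> i \<or> \<not> phi {} e [x, lnth l i] 0))"
proof (rule conj_cong[OF refl])
  assume e: "C_is_comp_eq e"
  then have R: "equiv UNIV (C_rel e)" unfolding C_is_comp_eq_def by blast
  show "be_cat_degree_is halting_set UNIV (C_rel e) \<longleftrightarrow>
    (\<exists>n. \<forall>x. (\<exists>y. y < n \<and> phi {} e [y, x] 1) \<or> (\<exists>s. \<forall>t. t < s \<or> \<not> phi {} e [x, t] 1)) \<and>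
    (\<forall>k n. \<exists>x l. (\<forall>y. n \<le> y \<or> \<not> phi {} e [y, x] 1) \<and> llen l = k \<and>
       (\<forall>i<llen l. \<forall>j<i. lnth l i \<noteq> lnth l j) \<and> (\<forall>i. llen l \<le> i \<or> \<not> phi {} e [x, lnth l i] 0))"
    unfolding degree_halting_set_iff[OF R] not_many_infinite_iff[OF R] many_big_iff[OF R]
      C_rel_not_iff[OF e, symmetric] C_rel_iff[symmetric] ..
qed

lemma sigma4_index_set:
  "sigma4 {e. C_is_comp_eq e \<and> be_cat_degree_is halting_set UNIV (C_rel e)}"
proof -
  \<comment> \<open>Finiteness of a class is \<open>\<Sigma>\<^sub>2\<close>; the quantifier over x
    leads to \<open>\<Pi>\<^sub>3\<close> and the bound n to
    \<open>\<Sigma>\<^sub>4\<close>.\<close>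
  have "Sg (Suc (Suc (Suc (Suc 0)))) (\<lambda>e. \<exists>n. \<forall>x. (\<exists>y. y < n \<and> phi {} e [y, x] 1) \<or>
      (\<exists>s. \<forall>t. t < s \<or> \<not> phi {} e [x, t] 1))"
    by (intro Sg_ex_Pg Pg_all Pg_disj Sg_imp_Pg_Suc[OF Sg_Suc[OF Sg_ex]] Sg_imp_Pg_Suc[OF Sg_ex_Pg]
        Sg_conj Pg_not Sg_phi c_rules cp_Sg cp_Pg)
  moreover have "Pg (Suc (Suc (Suc 0))) (\<lambda>e. \<forall>k n. \<exists>x l. (\<forall>y. n \<le> y \<or> \<not> phi {} e [y, x] 1) \<and> llen l = k \<and>
       (\<forall>i<llen l. \<forall>j<i. lnth l i \<noteq> lnth l j) \<and> (\<forall>i. llen l \<le> i \<or> \<not> phi {} e [x, lnth l i] 0))"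
    by (intro Pg_all Sg_imp_Pg_Suc Sg_ex Pg_imp_Sg_Suc Pg_conj Pg_disj Pg_not Sg_phi
        cp_Pg[OF cp_le] cp_Pg[OF cp_eq] cp_Pg[OF cp_all_less] c_rules)
  ultimately show ?thesis
    unfolding sigma4_iff mem_Collect_eq index_set_iff
    using Pg_imp_Sg_Suc[of "Suc (Suc (Suc 0))"] Pg_imp_Sg_Suc[OF Pg_Suc[OF Pg_C_is_comp_eq]]
    by (simp add: numeral_eq_Suc Sg_conj del: Sg.simps)
qed

lemma sigma4_hard_index_set:
  assumes "sigma4 B"
  shows "\<exists>f. computable_fun f \<and>
    (\<forall>n. n \<in> B \<longleftrightarrow> f n \<in> {e. C_is_comp_eq e \<and> be_cat_degree_is halting_set UNIV (C_rel e)})"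
proof -
  obtain R where R: "cp {} (\<lambda>x. x \<in> R)"
    and B: "\<And>n. n \<in> B \<longleftrightarrow> (\<exists>a. \<forall>b. \<exists>c. \<forall>d. list_encode [n, a, b, c, d] \<in> R)"
    using assms unfolding sigma4_def computable_set_iff by blast
  \<comment> \<open>The matrix is negated because infinitely many infinite classes have to mean that
    n is outside B.\<close>
  define Q where "Q n a b c d \<longleftrightarrow> list_encode [n, a, b, c, d] \<notin> R" for n a b c d
  have Q: "cp {} (\<lambda>x. Q (n x) (a x) (b x) (c x) (d x))"
    if "cf {} n" "cf {} a" "cf {} b" "cf {} c" "cf {} d" for n a b c d
    unfolding Q_def by (intro cp_not cp_comp[OF R] cf_list_encode_Cons that cf_const)
  have "cp {} (\<lambda>z. (pfst (psnd z), psnd (psnd z)) \<in> grp_rel (wit_grp (Q (pfst z))))"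
    unfolding grp_rel_def mem_Collect_eq prod.case by (intro cp_wit_grp[of "{}" Q, OF Q] c_rules)
  from smn_decidable[of "\<lambda>n x y. (x, y) \<in> grp_rel (wit_grp (Q n))", OF this]
  obtain f where f: "cf {} f"
    and phi: "\<And>n x y. phi {} (f n) [x, y] (if (x, y) \<in> grp_rel (wit_grp (Q n)) then 1 else 0)"
    by blast
  have C: "C_rel (f n) = grp_rel (wit_grp (Q n))" for n
  proof -
    have "(x, y) \<in> C_rel (f n) \<longleftrightarrow> (x, y) \<in> grp_rel (wit_grp (Q n))" for x y
      using phi[where n = n and x = x and y = y] phi_det[of "{}" "f n" "[x, y]" 0 1] unfolding C_rel_iff
      by (auto split: if_splits)
    then show ?thesis by auto
  qed
  have eq: "C_is_comp_eq (f n)" for n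
    unfolding C_is_comp_eq_def C
  proof (intro conjI allI equiv_grp_rel)
    fix x y show "phi {} (f n) [x, y] 0 \<or> phi {} (f n) [x, y] 1"
      using phi[where n = n and x = x and y = y] by (auto split: if_splits)
  qed
  \<comment> \<open>Arbitrarily large classes are present for every n, so the degree is that of the
    halting set exactly when only finitely many classes are infinite.\<close>
  have "n \<in> B \<longleftrightarrow> f n \<in> {e. C_is_comp_eq e \<and> be_cat_degree_is halting_set UNIV (C_rel e)}" for n
    using eq unfolding B mem_Collect_eq C degree_halting_set_iff[OF equiv_grp_rel] many_infinite_wit_grp
    by (simp add: many_big_wit_grp Q_def)
  then show ?thesis using f unfolding computable_fun_iff by blast
qed

theorem theorem4p5:
  shows "sigma4_complete {e. C_is_comp_eq e \<and> be_cat_degree_is halting_set UNIV (C_rel e)}"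
  unfolding sigma4_complete_def using sigma4_index_set sigma4_hard_index_set by blast

end
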